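(* Let $q=e^{-\omega}$ with $\omega>0$, and let $a,b,c,d,e,f$ be complex parameters with $\max\{|q^f|,|q^{1+f-d}|,|q^{1+c+f-d}|\}<1$, and suppose that $\mathrm{Re}\{s\log q-\log(\sin\pi s\,\sin\pi(d+s))\}<0$ for large $|s|$. Then $$\frac{1}{2\pi i}\int_{-i\infty}^{i\infty}\frac{(q^{1+s},q^{d+s},q^{1+a+b+c+s-d},q^{e+f+s};q)_\infty}{(q^{a+s},q^{b+s},q^{c+s},q^{f+s};q)_\infty}\,\frac{\pi q^s}{\sin \pi s\,\sin\pi(d+s)}$$ $$\times\;{}_{3}\phi_2\left[\begin{array}{c}q^e,\ q^{a+s},\ q^{b+s}\\ q^{e+f+s},\ q^{1+a+b+c+s-d}\end{array};q,q^{1+c+f-d}\right]ds$$ $$=\csc (\pi d)\,\frac{(q,q^d,q^{1-d},q^{1+b+c-d},q^{1+a+c-d},q^{1+a+b-d},q^{e+f};q)_{\infty}}{(q^a,q^b,q^c,q^{f},q^{1+a-d},q^{1+b-d},q^{1+c-d};q)_{\infty}}\;{}_{3}\phi_2\left[\begin{array}{c}q^a,\ q^{b},\ q^{e}\\ q^{e+f},\ q^{1+a+b-d}\end{array};q,q^{1+f-d}\right],$$ where the contour of integration runs from $-i\infty$ to $i\infty$ so that the increasing sequences of poles of the integrand lie to its right and the decreasing sequences of poles lie to its left.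
   Context: The $q$-shifted factorials are $(x;q)_\infty=\prod_{k=0}^{\infty}(1-xq^k)$ and $(x;q)_n=(x;q)_\infty/(xq^n;q)_\infty$, with $(x_1,\ldots,x_m;q)_n=(x_1;q)_n\cdots(x_m;q)_n$ for $n$ an integer or $\infty$. The basic hypergeometric series ${}_3\phi_2$ is ${}_{3}\phi_2\left[\begin{array}{c}a_1,a_2,a_3\\ b_1,b_2\end{array};q,z\right]=\sum_{k=0}^\infty\frac{(a_1,a_2,a_3;q)_k}{(q,b_1,b_2;q)_k}z^k$. Here $q^x=e^{-\omega x}$, and in exponents $e$ is a parameter. As is standard for basic hypergeometric series, parameters are assumed to be such that no denominator vanishes (and that a contour separating the poles as described exists).
   Formalization: The printed right-hand side has the wrong sign for a contour from -i∞ to i∞ with the increasing poles on its right (compare the residue at s=0 as a→0); the formal statement has -csc(πd) in place of csc(πd). *)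

theory Defs
  imports "HOL-Complex_Analysis.Complex_Analysis"
begin

section \<open>$q$-shifted factorials\<close>

definition qpoch_inf :: "complex \<Rightarrow> complex \<Rightarrow> complex" where
  "qpoch_inf q x = (\<Prod>k. 1 - x * q ^ k)"

text \<open>The quotient \<open>(x;q)\<^sub>\<infinity> / (xq\<^sup>n;q)\<^sub>\<infinity>\<close> is \<open>0 / 0\<close> when \<open>x = q\<^sup>-\<^sup>j\<close> with \<open>j \<ge> n\<close>;
  the finite product is its value there too. Lemma \<open>qpoch_eq_quotient\<close> below covers the other cases.\<close>

definition qpoch :: "complex \<Rightarrow> complex \<Rightarrow> nat \<Rightarrow> complex" where
  "qpoch q x n = (\<Prod>k<n. 1 - x * q ^ k)"

definition qpochs_inf :: "complex \<Rightarrow> complex list \<Rightarrow> complex" where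
  "qpochs_inf q xs = (\<Prod>x\<leftarrow>xs. qpoch_inf q x)"

definition qpochs :: "complex \<Rightarrow> complex list \<Rightarrow> nat \<Rightarrow> complex" where
  "qpochs q xs n = (\<Prod>x\<leftarrow>xs. qpoch q x n)"

lemma convergent_prod_qpoch:
  fixes q x :: complex
  assumes "norm q < 1"
  shows "convergent_prod (\<lambda>k. 1 - x * q ^ k)"
proof -
  have "summable (\<lambda>k. norm (- x * q ^ k))"
    using assms by (simp add: norm_mult norm_power summable_geometric summable_mult)
  then have "abs_convergent_prod (\<lambda>k. 1 + (- x * q ^ k))"
    by (intro summable_imp_abs_convergent_prod) auto
  then show ?thesis
    by (auto dest: abs_convergent_prod_imp_convergent_prod)
qed

lemma qpoch_eq_quotient:
  assumes "norm q < 1" and "qpoch_inf q (x * q ^ n) \<noteq> 0"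
  shows "qpoch q x n = qpoch_inf q x / qpoch_inf q (x * q ^ n)"
proof -
  have lim: "(\<lambda>N. qpoch q y N) \<longlonglongrightarrow> qpoch_inf q y" for y
    using convergent_prod_LIMSEQ[OF convergent_prod_qpoch[OF assms(1), of y]]
    unfolding qpoch_def qpoch_inf_def lessThan_Suc_atMost[symmetric]
    by (rule LIMSEQ_imp_Suc)
  have split: "qpoch q x (N + n) = qpoch q x n * qpoch q (x * q ^ n) N" for N
    by (induction N) (simp_all add: qpoch_def power_add mult_ac)
  have "(\<lambda>N. qpoch q x (N + n)) \<longlonglongrightarrow> qpoch q x n * qpoch_inf q (x * q ^ n)"
    unfolding split by (intro tendsto_intros lim)
  moreover have "(\<lambda>N. qpoch q x (N + n)) \<longlonglongrightarrow> qpoch_inf q x"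
    by (rule LIMSEQ_ignore_initial_segment[OF lim])
  ultimately have "qpoch_inf q x = qpoch q x n * qpoch_inf q (x * q ^ n)"
    using LIMSEQ_unique by blast
  then show ?thesis
    using assms(2) by simp
qed

section \<open>Basic hypergeometric series\<close>

definition phi32 ::
  "complex \<Rightarrow> complex \<Rightarrow> complex \<Rightarrow> complex \<Rightarrow> complex \<Rightarrow> complex \<Rightarrow> complex \<Rightarrow> complex" where
  "phi32 q a1 a2 a3 b1 b2 z =
     (\<Sum>k. qpochs q [a1, a2, a3] k / qpochs q [q, b1, b2] k * z ^ k)"

section \<open>Contours from $-i\infty$ to $i\infty$\<close>

text \<open>A simple piecewise smooth curve that is vertical near both ends; the two abscissae
  may differ.\<close>

definition imag_contour :: "(real \<Rightarrow> complex) \<Rightarrow> bool" where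
  "imag_contour \<gamma> \<longleftrightarrow>
     inj \<gamma> \<and> \<gamma> piecewise_C1_differentiable_on UNIV \<and>
     (\<exists>T \<sigma> \<tau>. \<forall>t\<ge>T. \<gamma> t = Complex \<sigma> t \<and> \<gamma> (- t) = Complex \<tau> (- t))"

text \<open>The two sides are the components of the complement of the curve that contain
  a left, respectively a right, half-plane.\<close>

definition left_side :: "(real \<Rightarrow> complex) \<Rightarrow> complex set" where
  "left_side \<gamma> = {s. \<exists>x. \<forall>z. Re z < x \<longrightarrow> connected_component (- range \<gamma>) s z}"

definition right_side :: "(real \<Rightarrow> complex) \<Rightarrow> complex set" where
  "right_side \<gamma> = {s. \<exists>x. \<forall>z. Re z > x \<longrightarrow> connected_component (- range \<gamma>) s z}"

text \<open>Same integrand as in \<^const>\<open>has_contour_integral\<close>, over the whole real line. The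
  Henstock--Kurzweil integral includes the improper integral.\<close>

definition imag_contour_integrable :: "(complex \<Rightarrow> complex) \<Rightarrow> (real \<Rightarrow> complex) \<Rightarrow> bool" where
  "imag_contour_integrable g \<gamma> \<longleftrightarrow>
     (\<lambda>t. g (\<gamma> t) * vector_derivative \<gamma> (at t)) integrable_on UNIV"

definition imag_contour_integral :: "(real \<Rightarrow> complex) \<Rightarrow> (complex \<Rightarrow> complex) \<Rightarrow> complex" where
  "imag_contour_integral \<gamma> g =
     integral UNIV (\<lambda>t. g (\<gamma> t) * vector_derivative \<gamma> (at t))"

end

theory Submission
  imports Defs
begin

text \<open>
  Close the contour to the right. The factor \<open>1 / (sin \<pi>s sin \<pi>(d+s))\<close> decays exponentially in
  \<open>\<bar>Im s\<bar>\<close> and the factor \<open>q\<^sup>s\<close> decays exponentially in \<open>Re s\<close>, so the integral equals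
  \<open>-2\<pi>i\<close> times the sum of the residues at \<open>s = n\<close> and \<open>s = 1 - d + n\<close> with \<open>n = 0, 1, \<dots>\<close>;
  the minus sign comes from closing an upward contour clockwise. Put \<open>x = q\<^sup>s\<close> and \<open>D = q\<^sup>d\<close>.
  Apart from the two sines the integrand is a function \<open>x h(x)\<close> of \<open>x\<close>, where \<open>h\<close> is
  meromorphic in the whole plane and regular at \<open>0\<close>, and the residues are
  \<open>x h(x) / sin \<pi>d\<close> at \<open>x = q\<^sup>n\<close> and \<open>- x h(x) / sin \<pi>d\<close> at \<open>x = q\<^sup>n\<^sup>+\<^sup>1 / D\<close>. Up to constants the
  integral is therefore the \<open>q\<close>-integral \<open>J\<close> of \<open>x h(x)\<close>, where
  \<open>J g = \<Sum>\<^sub>n g(q\<^sup>n) - \<Sum>\<^sub>n g(q\<^sup>n\<^sup>+\<^sup>1 / D)\<close>.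

  Write \<open>A, B, C, E, z\<close> for \<open>q\<^sup>a, q\<^sup>b, q\<^sup>c, q\<^sup>e, q\<^sup>f\<close>. By the \<open>q\<close>-binomial theorem both
  \<open>x h(x)\<close> and the right-hand side become series over \<open>N\<close> whose \<open>N\<close>-th term is
  \<open>(E;q)\<^sub>N z\<^sup>N\<close> times a finite sum that contains neither \<open>E\<close> nor \<open>z\<close>, so it suffices to compare these finite
  sums (\<open>profile_eq_layers\<close>, \<open>jackson_evaluation\<close>). A terminating transformation
  (\<open>terminating_transformation\<close>) turns the finite sum for \<open>x h(x)\<close> into a combination, with
  coefficients free of \<open>x\<close>, of the kernels
  \<open>x (qx, Dx, ABCq\<^sup>j\<^sup>+\<^sup>1x/D;q)\<^sub>\<infinity> / (Ax, Bq\<^sup>jx, Cx;q)\<^sub>\<infinity>\<close>. Their \<open>q\<close>-integrals are infinite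
  products; this is the nonterminating \<open>q\<close>-Saalschuetz sum (\<open>nonterminating_saalschuetz\<close>). The
  sum over \<open>j\<close> that results is the transformed side of the same terminating
  transformation, now with \<open>x = C = 1\<close>, and reading it backwards gives the \<open>N\<close>-th term on the right
  (\<open>jackson_layer\<close>).

  The nonterminating \<open>q\<close>-Saalschuetz sum follows from a first-order recurrence in each parameter.
  Replacing \<open>c\<close> by \<open>cq\<close> multiplies the \<open>q\<close>-integral of the kernel by an explicit factor, because the
  difference telescopes; iterating it removes \<open>c\<close>, and likewise \<open>b\<close> and \<open>a\<close>. The same recurrence,
  started where the denominator cancels against \<open>(qx;q)\<^sub>\<infinity>\<close>, evaluates the parameter-free integral.

  The contour is an arbitrary simple curve with vertical ends, and its two sides are given as
  connected components. Truncate it at height \<open>r\<close> and close it by three sides of a rectangle on the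
  right. A path from \<open>p\<close> to a far point that avoids the contour also avoids the rectangle once this
  is large, so the winding number about \<open>p\<close> is that about a far left or a far right point: \<open>0\<close> on
  the left side and \<open>-1\<close> on the right side (\<open>winding_left_side\<close>, \<open>winding_right_side\<close>).
\<close>

section \<open>The $q$-shifted factorials\<close>

lemma qpoch_0 [simp]: "qpoch q x 0 = 1"
  by (simp add: qpoch_def)

lemma qpoch_Suc: "qpoch q x (Suc n) = qpoch q x n * (1 - x * q ^ n)"
  by (simp add: qpoch_def)

lemma qpoch_add: "qpoch q x (m + n) = qpoch q x m * qpoch q (x * q ^ m) n"
  by (induction n) (simp_all add: qpoch_Suc power_add mult_ac)

lemma qpoch_Suc': "qpoch q x (Suc n) = (1 - x) * qpoch q (x * q) n"
  using qpoch_add[of q x 1 n] by (simp add: qpoch_Suc)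

lemma qpoch_zero_base [simp]: "qpoch q 0 n = 1"
  by (simp add: qpoch_def)

lemma qpoch_inf_zero_base [simp]: "qpoch_inf q 0 = 1"
  by (simp add: qpoch_inf_def)

locale q_base =
  fixes q :: complex
  assumes q_nz: "q \<noteq> 0" and q_lt_1: "norm q < 1"
begin

abbreviation P :: "complex \<Rightarrow> nat \<Rightarrow> complex" where "P \<equiv> qpoch q"
abbreviation Q :: "complex \<Rightarrow> complex" where "Q \<equiv> qpoch_inf q"

lemma qpoch_LIMSEQ: "(\<lambda>N. P x N) \<longlonglongrightarrow> Q x"
  using convergent_prod_LIMSEQ[OF convergent_prod_qpoch[OF q_lt_1, of x]]
  unfolding qpoch_def qpoch_inf_def lessThan_Suc_atMost[symmetric]
  by (rule LIMSEQ_imp_Suc)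

lemma qpoch_inf_split: "Q x = P x n * Q (x * q ^ n)"
proof -
  have "(\<lambda>N. P x (n + N)) \<longlonglongrightarrow> P x n * Q (x * q ^ n)"
    unfolding qpoch_add by (intro tendsto_intros qpoch_LIMSEQ)
  moreover have "(\<lambda>N. P x (n + N)) \<longlonglongrightarrow> Q x"
    using LIMSEQ_ignore_initial_segment[OF qpoch_LIMSEQ, of x n] by (simp add: add.commute)
  ultimately show ?thesis
    using LIMSEQ_unique by blast
qed

lemma qpoch_inf_step: "Q x = (1 - x) * Q (q * x)"
  using qpoch_inf_split[of x 1] by (simp add: qpoch_Suc mult.commute)

lemma qpoch_inf_one [simp]: "Q 1 = 0"
  by (subst qpoch_inf_step) simp

lemma qpoch_inf_eq_0_iff: "Q x = 0 \<longleftrightarrow> (\<exists>k. x * q ^ k = 1)"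
proof
  assume "Q x = 0"
  then obtain k where "1 - x * q ^ k = 0"
    using prodinf_nonzero[OF convergent_prod_qpoch[OF q_lt_1, of x]] unfolding qpoch_inf_def by blast
  then show "\<exists>k. x * q ^ k = 1" by auto
next
  assume "\<exists>k. x * q ^ k = 1"
  then obtain k where "x * q ^ k = 1" ..
  then show "Q x = 0"
    by (subst qpoch_inf_split[of x k]) simp
qed

lemma qpoch_inf_nz_shift: "Q x \<noteq> 0 \<Longrightarrow> Q (x * q ^ n) \<noteq> 0"
  using qpoch_inf_split[of x n] by auto

lemma qpoch_inf_nz_small: "norm x < 1 \<Longrightarrow> Q x \<noteq> 0"
proof
  assume x: "norm x < 1" and "Q x = 0"
  then obtain k where "x * q ^ k = 1"
    unfolding qpoch_inf_eq_0_iff by blast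
  then have "norm x * norm q ^ k = 1"
    by (metis norm_mult norm_one norm_power)
  moreover have "norm x * norm q ^ k \<le> norm x * 1"
    using q_lt_1 by (intro mult_left_mono power_le_one) auto
  ultimately show False using x by linarith
qed

lemma qpoch_qq_nz: "P q n \<noteq> 0"
proof
  assume "P q n = 0"
  then have "Q q = 0" by (subst qpoch_inf_split[of q n]) simp
  then show False using qpoch_inf_nz_small[OF q_lt_1] by simp
qed

text \<open>Every estimate below rests on this bound: it is uniform in \<open>n\<close>, hence passes to the infinite product,
  and it is uniform on the orbits \<open>y q\<^sup>n\<close>, where the argument only shrinks.\<close>

lemma norm_qpoch_le: "norm (P x n) \<le> exp (norm x / (1 - norm q))"
proof -
  have "norm (P x n) \<le> (\<Prod>k<n. 1 + norm (x * q ^ k))"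
    unfolding qpoch_def prod_norm[symmetric]
    by (intro prod_mono conjI norm_ge_zero norm_triangle_le_diff) auto
  also have "\<dots> \<le> exp (\<Sum>k<n. norm (x * q ^ k))"
    by (intro prod_le_exp_sum) auto
  also have "(\<Sum>k<n. norm (x * q ^ k)) = norm x * (\<Sum>k<n. norm q ^ k)"
    by (simp add: norm_mult norm_power sum_distrib_left)
  also have "\<dots> \<le> norm x * (\<Sum>k. norm q ^ k)"
    using q_lt_1 by (intro mult_left_mono sum_le_suminf summable_geometric) auto
  also have "(\<Sum>k. norm q ^ k) = 1 / (1 - norm q)"
    using q_lt_1 by (intro suminf_geometric) auto
  finally show ?thesis by simp
qed

lemma norm_qpoch_inf_le: "norm (Q x) \<le> exp (norm x / (1 - norm q))"
  by (rule tendsto_upperbound[OF tendsto_norm[OF qpoch_LIMSEQ]]) (auto intro!: always_eventually norm_qpoch_le)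

lemma exp_orbit_le: "exp (norm (t * (y * q ^ n)) / (1 - norm q)) \<le> exp (norm (t * y) / (1 - norm q))"
proof -
  have "norm (t * (y * q ^ n)) \<le> norm (t * y) * 1"
    unfolding norm_mult norm_power mult.assoc[symmetric]
    using q_lt_1 by (intro mult_left_mono power_le_one) auto
  then show ?thesis
    using q_lt_1 by (simp add: divide_right_mono)
qed

lemmas norm_qpoch_orbit_le = order.trans[OF norm_qpoch_le exp_orbit_le]
lemmas norm_qpoch_inf_orbit_le = order.trans[OF norm_qpoch_inf_le exp_orbit_le]

lemma holomorphic_qpoch_inf: "Q holomorphic_on UNIV"
proof (rule holomorphic_uniform_sequence[where f = "\<lambda>N x. P x N"])
  show "(\<lambda>x. P x n) holomorphic_on UNIV" for n
    unfolding qpoch_def by (intro holomorphic_intros)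
  show "\<exists>d>0. cball x d \<subseteq> UNIV \<and>
      uniform_limit (cball x d) (\<lambda>N x. P x N) (Q) sequentially" for x
  proof (intro exI[of _ 1] conjI)
    have "uniformly_convergent_on (cball x 1) (\<lambda>N y. \<Sum>n<N. norm ((1 - y * q ^ n) - 1))"
    proof (rule Weierstrass_m_test')
      show "norm (norm ((1 - y * q ^ n) - 1)) \<le> (norm x + 1) * norm q ^ n" if "y \<in> cball x 1" for y n
        using that norm_triangle_sub[of y x]
        by (auto simp: norm_mult norm_power dist_norm norm_minus_commute intro!: mult_right_mono)
    qed (use q_lt_1 in \<open>auto intro!: summable_mult summable_geometric\<close>)
    then have "uniformly_convergent_on (cball x 1) (\<lambda>N y. P y N)"
      unfolding qpoch_def
      by (intro uniformly_convergent_on_prod') (auto intro!: continuous_intros)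
    then obtain l where l: "uniform_limit (cball x 1) (\<lambda>N y. P y N) l sequentially"
      by (auto simp: uniformly_convergent_on_def)
    have "l y = Q y" if "y \<in> cball x 1" for y
      using tendsto_uniform_limitI[OF l that] qpoch_LIMSEQ LIMSEQ_unique by blast
    with l show "uniform_limit (cball x 1) (\<lambda>N y. P y N) (Q) sequentially"
      by (auto elim!: uniform_limit_cong' [THEN iffD1, rotated -1])
  qed auto
qed auto

lemma analytic_qpoch_inf [analytic_intros]:
  "f analytic_on A \<Longrightarrow> (\<lambda>x. Q (f x)) analytic_on A"
  using analytic_on_compose[of f A "Q"] holomorphic_qpoch_inf
  by (auto simp: o_def analytic_on_holomorphic)

lemma holomorphic_qpoch_inf' [holomorphic_intros]:
  "f holomorphic_on A \<Longrightarrow> (\<lambda>x. Q (f x)) holomorphic_on A"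
  using holomorphic_on_compose[of f A "Q"] holomorphic_on_subset[OF holomorphic_qpoch_inf]
  by (auto simp: o_def)

lemma isCont_qpoch_inf [continuous_intros]:
  "isCont f x \<Longrightarrow> isCont (\<lambda>x. Q (f x)) x"
proof -
  have "isCont (Q) y" for y
    using holomorphic_on_imp_continuous_on[OF holomorphic_qpoch_inf]
    by (simp add: continuous_on_eq_continuous_at)
  then show "isCont f x \<Longrightarrow> isCont (\<lambda>x. Q (f x)) x"
    using isCont_o2 by blast
qed

text \<open>Along an orbit the argument tends to \<open>0\<close>, where the product is \<open>1\<close>, so the reciprocals are bounded as soon
  as none is infinite.\<close>

lemma qpoch_inf_nz_Bseq_inverse:
  assumes "Q x \<noteq> 0"
  obtains B where "B > 0" "\<And>n. norm (inverse (Q (x * q ^ n))) \<le> B"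
proof -
  have "(\<lambda>n. x * q ^ n) \<longlonglongrightarrow> x * 0"
    using q_lt_1 by (intro tendsto_intros LIMSEQ_power_zero)
  then have "(\<lambda>n. Q (x * q ^ n)) \<longlonglongrightarrow> Q 0"
    using isCont_tendsto_compose[OF isCont_qpoch_inf[OF continuous_ident]] by force
  then have "(\<lambda>n. inverse (Q (x * q ^ n))) \<longlonglongrightarrow> inverse 1"
    by (intro tendsto_inverse) auto
  then have "Bseq (\<lambda>n. inverse (Q (x * q ^ n)))"
    using convergent_def convergent_imp_Bseq by blast
  then show ?thesis using that by (auto simp: Bseq_def)
qed

end

section \<open>The nonterminating $q$-Saalschuetz sum\<close>

definition qsum :: "complex \<Rightarrow> complex \<Rightarrow> (complex \<Rightarrow> complex) \<Rightarrow> complex" where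
  "qsum q y g = (\<Sum>n. g (y * q ^ n))"

locale q_pair = q_base +
  fixes D :: complex
  assumes D_nz: "D \<noteq> 0"
begin

text \<open>Up to the factor \<open>1 - q\<close> this is Jackson's \<open>q\<close>-integral of \<open>g(t) / t\<close> from \<open>q / D\<close> to \<open>1\<close>. The two
  orbits are the values of \<open>q\<^sup>s\<close> at the two sequences of poles to the right of the contour.\<close>

definition jackson :: "(complex \<Rightarrow> complex) \<Rightarrow> complex" where
  "jackson g = qsum q 1 g - qsum q (q / D) g"

text \<open>The zeros of \<open>(ax;q)\<^sub>\<infinity>\<close> avoid both orbits.\<close>

definition admissible :: "complex \<Rightarrow> bool" where
  "admissible a \<longleftrightarrow> Q a \<noteq> 0 \<and> Q (a * q / D) \<noteq> 0"

text \<open>The integrand of the nonterminating \<open>q\<close>-Saalschuetz sum, \<open>(qx, Dx, abcqx/D;q)\<^sub>\<infinity>\<close> over \<open>(ax, bx, cx;q)\<^sub>\<infinity>\<close>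
  being balanced in the sense that the products of the parameters above and below satisfy
  \<open>q D \<cdot> (abcq/D) = q\<^sup>2 abc\<close>.\<close>

definition kernel :: "complex \<Rightarrow> complex \<Rightarrow> complex \<Rightarrow> complex \<Rightarrow> complex" where
  "kernel a b c x = x * Q (q * x) * Q (D * x) * Q (a * b * c * q / D * x)
     / (Q (a * x) * Q (b * x) * Q (c * x))"

lemma tendsto_orbit: "isCont w 0 \<Longrightarrow> (\<lambda>n. w (y * q ^ n)) \<longlonglongrightarrow> w 0"
proof -
  have "(\<lambda>n. y * q ^ n) \<longlonglongrightarrow> y * 0"
    using q_lt_1 by (intro tendsto_intros LIMSEQ_power_zero)
  then show "isCont w 0 \<Longrightarrow> (\<lambda>n. w (y * q ^ n)) \<longlonglongrightarrow> w 0"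
    by (intro isCont_tendsto_compose[where g = w]) auto
qed

lemma summable_orbit:
  assumes "isCont w 0"
  shows "summable (\<lambda>n. y * q ^ n * w (y * q ^ n))"
proof -
  have "Bseq (\<lambda>n. w (y * q ^ n))"
    using tendsto_orbit[OF assms] convergent_def convergent_imp_Bseq by blast
  then obtain B where B: "\<And>n. norm (w (y * q ^ n)) \<le> B"
    by (auto simp: Bseq_def)
  show ?thesis
  proof (rule summable_comparison_test')
    show "summable (\<lambda>n. (norm y * B) * norm q ^ n)"
      using q_lt_1 by (intro summable_mult summable_geometric) auto
    show "norm (y * q ^ n * w (y * q ^ n)) \<le> norm y * B * norm q ^ n" for n
      using mult_left_mono[OF B[of n], of "norm y * norm q ^ n"]
      by (simp add: norm_mult norm_power mult_ac)
  qed
qed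

lemma qsum_telescope:
  fixes g h :: "complex \<Rightarrow> complex"
  assumes "isCont g 0" "\<And>n. h (y * q ^ n) = g (y * q ^ n) - g (q * (y * q ^ n))"
  shows "(\<lambda>n. h (y * q ^ n)) sums (g y - g 0)"
proof -
  have "(\<lambda>n. g (y * q ^ n) - g (y * q ^ Suc n)) sums (g (y * q ^ 0) - g 0)"
    by (rule telescope_sums'[where f = "\<lambda>n. g (y * q ^ n)"]) (rule tendsto_orbit[OF assms(1)])
  then show ?thesis
    by (simp add: assms(2) mult_ac)
qed

lemma admissible_orbit:
  assumes "admissible a" "y = 1 \<or> y = q / D"
  shows "Q (a * (y * q ^ n)) \<noteq> 0"
  using assms qpoch_inf_nz_shift[of a n] qpoch_inf_nz_shift[of "a * q / D" n]
  by (auto simp: admissible_def mult_ac)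

lemma admissible_inverse_bounded:
  assumes "admissible a" "y = 1 \<or> y = q / D"
  shows "\<exists>B>0. \<forall>n. norm (inverse (Q (a * (y * q ^ n)))) \<le> B"
proof -
  have "Q (a * y) \<noteq> 0" using admissible_orbit[OF assms, of 0] by simp
  then show ?thesis by (metis qpoch_inf_nz_Bseq_inverse mult.assoc)
qed

lemma admissible_0 [simp]: "admissible 0"
  by (simp add: admissible_def)

lemma admissible_shift: "admissible a \<Longrightarrow> admissible (a * q ^ n)"
  using qpoch_inf_nz_shift[of a n] qpoch_inf_nz_shift[of "a * q / D" n]
  by (simp add: admissible_def mult_ac)

lemma summable_kernel: "summable (\<lambda>n. kernel a b c (y * q ^ n))"
proof -
  let ?w = "\<lambda>x. Q (q * x) * Q (D * x) * Q (a * b * c * q / D * x)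
     / (Q (a * x) * Q (b * x) * Q (c * x))"
  have "summable (\<lambda>n. y * q ^ n * ?w (y * q ^ n))"
    by (rule summable_orbit, intro continuous_intros) auto
  then show ?thesis
    by (simp add: kernel_def mult_ac)
qed

text \<open>The certificate \<open>g\<close> is the kernel without its factor \<open>x\<close>, moved back by one step of \<open>q\<close> in the first two
  factors of the numerator. After division by the common factor the right-hand side is a cubic in \<open>x\<close> whose
  constant term vanishes trivially and whose leading term vanishes because the kernel is balanced, so
  only two coefficients remain to be matched with the left-hand side.\<close>

lemma kernel_certificate:
  assumes "Q (a * x) \<noteq> 0" "Q (b * x) \<noteq> 0" "Q (c * x) \<noteq> 0"
  defines "g \<equiv> \<lambda>x. - (c * q / D) * (Q x * Q (D * x / q) * Q (a * b * c * q / D * x))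
     / (Q (a * x) * Q (b * x) * Q (c * x))"
  shows "(1 - b * c * q / D) * (1 - a * c * q / D) * kernel a b (c * q) x
         - (1 - c) * (1 - c * q / D) * kernel a b c x = g x - g (q * x)"
proof -
  define A B C L X Y where "A = Q (q * (a * x))" and "B = Q (q * (b * x))"
    and "C = Q (q * (c * x))" and "L = Q (q * (a * b * c * q / D * x))"
    and "X = Q (q * x)" and "Y = Q (D * x)"
  have step: "Q (a * x) = (1 - a * x) * A" "Q (b * x) = (1 - b * x) * B" "Q (c * x) = (1 - c * x) * C"
    "Q (a * b * c * q / D * x) = (1 - a * b * c * q / D * x) * L" "Q x = (1 - x) * X"
    unfolding A_def B_def C_def L_def X_def by (rule qpoch_inf_step)+
  have stepY: "Q (D * x / q) = (1 - D * x / q) * Y"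
    unfolding Y_def using qpoch_inf_step[of "D * x / q"] q_nz by simp
  have nz: "1 - a * x \<noteq> 0" "1 - b * x \<noteq> 0" "1 - c * x \<noteq> 0" "A \<noteq> 0" "B \<noteq> 0" "C \<noteq> 0"
    using assms(1-3) unfolding step by auto
  have s1: "kernel a b (c * q) x = x * X * Y * L / (((1 - a * x) * A) * ((1 - b * x) * B) * C)"
    unfolding kernel_def step by (simp add: A_def B_def C_def L_def X_def Y_def mult_ac)
  have s2: "kernel a b c x = x * X * Y * ((1 - a * b * c * q / D * x) * L)
      / (((1 - a * x) * A) * ((1 - b * x) * B) * ((1 - c * x) * C))"
    unfolding kernel_def step by (simp add: X_def Y_def)
  have s3: "g x = - (c * q / D) * ((1 - x) * X * ((1 - D * x / q) * Y) * ((1 - a * b * c * q / D * x) * L))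
      / (((1 - a * x) * A) * ((1 - b * x) * B) * ((1 - c * x) * C))"
    unfolding g_def step stepY by simp
  have s4: "g (q * x) = - (c * q / D) * (X * Y * L) / (A * B * C)"
    unfolding g_def using q_nz by (simp add: A_def B_def C_def L_def X_def Y_def mult_ac)
  \<comment> \<open>All four terms of the identity are \<open>R\<close> times a polynomial in \<open>x\<close>.\<close>
  define R where "R = X * Y * L / (((1 - a * x) * A) * ((1 - b * x) * B) * ((1 - c * x) * C))"
  have cancel: "m * n / (u * v * w) = n / (u * v * (t * w)) * (m * t)" if "t \<noteq> 0"
    for m n t u v w :: complex using that by (simp add: mult_ac)
  have cancel3: "k * n / (a' * b' * c') = n / ((u * a') * (v * b') * (w * c')) * (k * (u * v * w))"
    if "u \<noteq> 0" "v \<noteq> 0" "w \<noteq> 0" for k n a' b' c' u v w :: complex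
    using that by (simp add: mult_ac)
  have t1: "kernel a b (c * q) x = R * (x * (1 - c * x))"
    unfolding s1 R_def using cancel[OF nz(3), of x "X * Y * L" "(1 - a * x) * A" "(1 - b * x) * B" C] by (simp only: mult.assoc)
  have t2: "kernel a b c x = R * (x * (1 - a * b * c * q / D * x))"
    unfolding s2 R_def by simp
  have t3: "g x = R * (- (c * q / D) * ((1 - x) * (1 - D * x / q) * (1 - a * b * c * q / D * x)))"
    unfolding s3 R_def by (simp add: mult_ac)
  have t4: "g (q * x) = R * (- (c * q / D) * ((1 - a * x) * (1 - b * x) * (1 - c * x)))"
    unfolding s4 R_def by (rule cancel3[OF nz(1-3)])
  have "(1 - b * c * q / D) * (1 - a * c * q / D) * (x * (1 - c * x))
         - (1 - c) * (1 - c * q / D) * (x * (1 - a * b * c * q / D * x))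
       = (- (c * q / D) * ((1 - x) * (1 - D * x / q) * (1 - a * b * c * q / D * x)))
         - (- (c * q / D) * ((1 - a * x) * (1 - b * x) * (1 - c * x)))"
    using q_nz D_nz by (simp add: field_simps)
  note poly = this
  have comb: "m * (R * u) - n * (R * v) = R * (m * u - n * v)" for m n u v
    by (simp add: algebra_simps)
  show ?thesis
    unfolding t1 t2 t3 t4 comb poly by (rule right_diff_distrib)
qed

text \<open>The sum over each orbit collapses to the difference of \<open>g\<close> at its start and at \<open>0\<close>; the values at \<open>0\<close> cancel
  between the orbits.\<close>

lemma jackson_telescope:
  assumes "isCont g 0" "g 1 = g (q / D)"
    and "\<And>y n. y = 1 \<or> y = q / D \<Longrightarrow> h (y * q ^ n) = g (y * q ^ n) - g (q * (y * q ^ n))"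
  shows "jackson h = 0"
proof -
  have "qsum q y h = g y - g 0" if "y = 1 \<or> y = q / D" for y
    unfolding qsum_def using qsum_telescope[OF assms(1,3), of y] that by (intro sums_unique[symmetric]) auto
  then show ?thesis by (simp add: jackson_def assms(2))
qed

lemma jackson_linear:
  assumes "\<And>y. summable (\<lambda>n. g (y * q ^ n))" "\<And>y. summable (\<lambda>n. h (y * q ^ n))"
  shows "jackson (\<lambda>x. \<alpha> * g x - \<beta> * h x) = \<alpha> * jackson g - \<beta> * jackson h"
proof -
  have "qsum q y (\<lambda>x. \<alpha> * g x - \<beta> * h x) = \<alpha> * qsum q y g - \<beta> * qsum q y h" for y
    unfolding qsum_def
    by (intro sums_unique[symmetric] sums_diff sums_mult summable_sums assms)
  then show ?thesis by (simp add: jackson_def algebra_simps)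
qed

lemma jackson_kernel_step:
  assumes "admissible a" "admissible b" "admissible c"
  shows "(1 - b * c * q / D) * (1 - a * c * q / D) * jackson (kernel a b (c * q))
       = (1 - c) * (1 - c * q / D) * jackson (kernel a b c)"
proof -
  let ?g = "\<lambda>x. - (c * q / D) * (Q x * Q (D * x / q) * Q (a * b * c * q / D * x))
     / (Q (a * x) * Q (b * x) * Q (c * x))"
  have "jackson (\<lambda>x. (1 - b * c * q / D) * (1 - a * c * q / D) * kernel a b (c * q) x
         - (1 - c) * (1 - c * q / D) * kernel a b c x) = 0"
  proof (rule jackson_telescope)
    show "isCont ?g 0" by (intro continuous_intros) (auto simp: q_nz)
    \<comment> \<open>Both values vanish: \<open>(x;q)\<^sub>\<infinity>\<close> at \<open>x = 1\<close> and \<open>(Dx/q;q)\<^sub>\<infinity>\<close> at \<open>x = q/D\<close>.\<close>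
    show "?g 1 = ?g (q / D)" using q_nz D_nz by simp
  qed (intro kernel_certificate admissible_orbit assms)
  then show ?thesis
    by (simp add: jackson_linear summable_kernel)
qed

lemma jackson_tannery:
  assumes lim: "\<And>y n. y = 1 \<or> y = q / D \<Longrightarrow> (\<lambda>N. g N (y * q ^ n)) \<longlonglongrightarrow> h (y * q ^ n)"
    and bound: "\<And>y. y = 1 \<or> y = q / D \<Longrightarrow> \<exists>B. \<forall>n N. norm (g N (y * q ^ n)) \<le> B * norm q ^ n"
  shows "(\<lambda>N. jackson (g N)) \<longlonglongrightarrow> jackson h"
proof -
  have *: "(\<lambda>N. qsum q y (g N)) \<longlonglongrightarrow> qsum q y h" if y: "y = 1 \<or> y = q / D" for y
  proof -
    obtain B where B: "\<And>n N. norm (g N (y * q ^ n)) \<le> B * norm q ^ n" using bound[OF y] by blast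
    have "(\<lambda>N. \<Sum>n. g N (y * q ^ n)) \<longlonglongrightarrow> (\<Sum>n. h (y * q ^ n))"
    proof (rule tannerys_theorem[THEN conjunct2, THEN conjunct2])
      show "\<forall>\<^sub>F (n, N) in sequentially \<times>\<^sub>F sequentially. norm (g N (y * q ^ n)) \<le> B * norm q ^ n"
        using B by (auto intro!: always_eventually)
      show "summable (\<lambda>n. B * norm q ^ n)"
        using q_lt_1 by (intro summable_mult summable_geometric) auto
    qed (use lim[OF y] in auto)
    then show ?thesis by (simp add: qsum_def)
  qed
  show ?thesis unfolding jackson_def by (intro tendsto_diff *) auto
qed

lemma jackson_kernel_tendsto_0:
  assumes "admissible a" "admissible b" "admissible c"
  shows "(\<lambda>N. jackson (kernel a b (c * q ^ N))) \<longlonglongrightarrow> jackson (kernel a b 0)"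
proof (rule jackson_tannery)
  fix y n assume y: "y = 1 \<or> y = q / D"
  let ?x = "y * q ^ n"
  let ?w = "\<lambda>t. ?x * Q (q * ?x) * Q (D * ?x) * Q (a * b * t * q / D * ?x)
     / (Q (a * ?x) * Q (b * ?x) * Q (t * ?x))"
  have "(\<lambda>N. ?w (c * q ^ N)) \<longlonglongrightarrow> ?w 0"
    by (rule tendsto_orbit, intro continuous_intros)
      (use admissible_orbit[OF assms(1) y] admissible_orbit[OF assms(2) y] D_nz in auto)
  then show "(\<lambda>N. kernel a b (c * q ^ N) ?x) \<longlonglongrightarrow> kernel a b 0 ?x"
    by (simp add: kernel_def)
next
  fix y assume y: "y = 1 \<or> y = q / D"
  obtain A B C where AB: "\<And>n. norm (inverse (Q (a * (y * q ^ n)))) \<le> A"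
    "\<And>n. norm (inverse (Q (b * (y * q ^ n)))) \<le> B"
    "\<And>n. norm (inverse (Q (c * (y * q ^ n)))) \<le> C"
    and pos: "A > 0" "B > 0" "C > 0"
    using admissible_inverse_bounded[OF assms(1) y] admissible_inverse_bounded[OF assms(2) y]
      admissible_inverse_bounded[OF assms(3) y] by metis
  define E where "E = (\<lambda>t. exp (norm (t * y) / (1 - norm q)))"
  have E: "norm (Q (t * (y * q ^ n))) \<le> E t" for t n
    unfolding E_def by (rule norm_qpoch_inf_orbit_le)
  have E0: "0 \<le> E t" for t by (simp add: E_def)
  have "norm (kernel a b (c * q ^ N) (y * q ^ n))
     \<le> (norm y * E q * E D * E (a * b * c * q / D) * A * B * C) * norm q ^ n" for n N
  proof -
    let ?x = "y * q ^ n"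
    have "kernel a b (c * q ^ N) ?x = ?x * Q (q * ?x) * Q (D * ?x)
        * Q ((a * b * c * q / D) * (y * q ^ (n + N)))
       * inverse (Q (a * ?x)) * inverse (Q (b * ?x))
       * inverse (Q (c * (y * q ^ (n + N))))"
      unfolding kernel_def by (simp add: divide_inverse power_add mult_ac)
    then have "norm (kernel a b (c * q ^ N) ?x) = norm ?x * norm (Q (q * ?x)) * norm (Q (D * ?x))
        * norm (Q ((a * b * c * q / D) * (y * q ^ (n + N))))
       * norm (inverse (Q (a * ?x))) * norm (inverse (Q (b * ?x)))
       * norm (inverse (Q (c * (y * q ^ (n + N)))))"
      by (simp only: norm_mult)
    also have "\<dots> \<le> norm ?x * E q * E D * E (a * b * c * q / D) * A * B * C"
      by (intro mult_mono mult_nonneg_nonneg E AB norm_ge_zero E0 order.refl less_imp_le[OF pos(1)]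
          less_imp_le[OF pos(2)] less_imp_le[OF pos(3)])
    finally show ?thesis by (simp add: norm_mult norm_power mult_ac)
  qed
  then show "\<exists>B. \<forall>n N. norm (kernel a b (c * q ^ N) (y * q ^ n)) \<le> B * norm q ^ n" by blast
qed

text \<open>Iterating the recurrence \<open>c \<mapsto> c q\<close> drives \<open>c\<close> to \<open>0\<close>.\<close>

lemma jackson_kernel_reduce:
  assumes adm: "admissible a" "admissible b" "admissible c"
  shows "Q c * Q (c * q / D) * jackson (kernel a b c)
     = Q (b * c * q / D) * Q (a * c * q / D) * jackson (kernel a b 0)"
proof -
  have fin: "P c N * P (c * q / D) N * jackson (kernel a b c)
     = P (b * c * q / D) N * P (a * c * q / D) N * jackson (kernel a b (c * q ^ N))" for N
  proof (induction N)
    case (Suc N)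
    have "P c (Suc N) * P (c * q / D) (Suc N) * jackson (kernel a b c)
      = (1 - c * q ^ N) * (1 - c * q / D * q ^ N) * (P c N * P (c * q / D) N * jackson (kernel a b c))"
      by (simp add: qpoch_Suc mult_ac)
    also have "\<dots> = P (b * c * q / D) N * P (a * c * q / D) N *
        ((1 - c * q ^ N) * (1 - c * q ^ N * q / D) * jackson (kernel a b (c * q ^ N)))"
      unfolding Suc by (simp add: mult_ac)
    also have "\<dots> = P (b * c * q / D) (Suc N) * P (a * c * q / D) (Suc N) * jackson (kernel a b (c * q ^ Suc N))"
      using jackson_kernel_step[OF adm(1,2) admissible_shift[OF adm(3), of N]]
      by (simp add: qpoch_Suc mult_ac)
    finally show ?case .
  qed simp
  have "(\<lambda>N. P c N * P (c * q / D) N * jackson (kernel a b c))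
     \<longlonglongrightarrow> Q c * Q (c * q / D) * jackson (kernel a b c)"
    by (intro tendsto_intros qpoch_LIMSEQ)
  moreover have "(\<lambda>N. P c N * P (c * q / D) N * jackson (kernel a b c))
     \<longlonglongrightarrow> Q (b * c * q / D) * Q (a * c * q / D) * jackson (kernel a b 0)"
    unfolding fin by (intro tendsto_intros qpoch_LIMSEQ jackson_kernel_tendsto_0 adm)
  ultimately show ?thesis using LIMSEQ_unique by blast
qed

text \<open>For \<open>a = b = 0\<close> and \<open>c = q\<^sup>m\<^sup>+\<^sup>1\<close> the denominator of the kernel divides \<open>(qx;q)\<^sub>\<infinity>\<close>, leaving this polynomial
  multiple of \<open>(Dx;q)\<^sub>\<infinity>\<close>. Written without the quotient it is meaningful also when \<open>q\<^sup>m\<^sup>+\<^sup>1\<close> is not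
  admissible, that is, for \<open>D\<close> a suitable power of \<open>q\<close>.\<close>

definition kernel_start :: "nat \<Rightarrow> complex \<Rightarrow> complex" where
  "kernel_start m x = x * Q (D * x) * P (q * x) m"

lemma isCont_qpoch [continuous_intros]: "isCont f x \<Longrightarrow> isCont (\<lambda>x. P (f x) n) x"
  unfolding qpoch_def by (intro continuous_intros)

lemma summable_start: "summable (\<lambda>n. kernel_start m (y * q ^ n))"
proof -
  have "summable (\<lambda>n. y * q ^ n * (\<lambda>x. Q (D * x) * P (q * x) m) (y * q ^ n))"
    by (rule summable_orbit, intro continuous_intros)
  then show ?thesis by (simp add: kernel_start_def mult_ac)
qed

lemma qpoch_inf_D_over_q: "Q (D * x / q) = (1 - D * x / q) * Q (D * x)"
  using qpoch_inf_step[of "D * x / q"] q_nz by simp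

text \<open>For \<open>m = 0\<close> the summand itself telescopes, \<open>x (Dx;q)\<^sub>\<infinity>\<close> being a multiple of
  \<open>(Dx/q;q)\<^sub>\<infinity> - (Dx;q)\<^sub>\<infinity>\<close>; the step from \<open>m\<close> to \<open>m + 1\<close> is the recurrence of the kernel at \<open>c = q\<^sup>m\<^sup>+\<^sup>1\<close>.\<close>

lemma jackson_kernel_start: "jackson (kernel_start m) = P q m * Q D * P (q / D) (Suc m)"
proof (induction m)
  case 0
  let ?g = "\<lambda>x. - (q / D) * Q (D * x / q)"
  have cont: "isCont ?g 0" by (intro continuous_intros) (use q_nz in auto)
  have step: "kernel_start 0 x = ?g x - ?g (q * x)" for x
    using D_nz q_nz by (simp add: kernel_start_def qpoch_inf_D_over_q[of x] field_simps)
  have "(\<lambda>n. kernel_start 0 (y * q ^ n)) sums (?g y - ?g 0)" for y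
    by (rule qsum_telescope[OF cont step])
  from this[of 1] this[of "q / D"] have "jackson (kernel_start 0) = - (q / D) * Q (D / q)"
    using D_nz q_nz by (auto simp: jackson_def qsum_def sums_iff)
  also have "\<dots> = Q D * (1 - q / D)"
    using qpoch_inf_D_over_q[of 1] D_nz q_nz by (simp add: field_simps)
  finally show ?case by (simp add: qpoch_Suc)
next
  case (Suc m)
  let ?r = "(1 - q ^ Suc m) * (1 - q ^ Suc (Suc m) / D)"
  let ?g = "\<lambda>x. - (q ^ Suc (Suc m) / D) * (P x (Suc m) * Q (D * x / q))"
  have "jackson (\<lambda>x. 1 * kernel_start (Suc m) x - ?r * kernel_start m x) = 0"
  proof (rule jackson_telescope)
    show "isCont ?g 0" by (intro continuous_intros) (use q_nz in auto)
    show "?g 1 = ?g (q / D)" using q_nz D_nz by (simp add: qpoch_Suc')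
    show "1 * kernel_start (Suc m) x - ?r * kernel_start m x = ?g x - ?g (q * x)" for x
    proof -
      define u v t where "u = P (q * x) m" and "v = Q (D * x)" and "t = q ^ Suc m"
      have g1: "?g x = - (q * t / D) * ((1 - x) * u * ((1 - D * x / q) * v))"
        by (simp add: qpoch_Suc' qpoch_inf_D_over_q u_def v_def t_def mult.commute)
      have g2: "?g (q * x) = - (q * t / D) * (u * (1 - t * x) * v)"
        using q_nz by (simp add: qpoch_Suc u_def v_def t_def mult_ac)
      have "?r * kernel_start m x = (1 - t) * (1 - q * t / D) * (x * v * u)"
        by (simp add: kernel_start_def u_def v_def t_def)
      moreover have "kernel_start (Suc m) x = x * v * (u * (1 - t * x))"
        by (simp add: kernel_start_def qpoch_Suc u_def v_def t_def mult_ac)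
      moreover have "x * v * (u * (1 - t * x)) - (1 - t) * (1 - q * t / D) * (x * v * u)
         = - (q * t / D) * ((1 - x) * u * ((1 - D * x / q) * v)) - - (q * t / D) * (u * (1 - t * x) * v)"
        using q_nz D_nz by (simp add: field_simps)
      ultimately show ?thesis unfolding g1 g2 by simp
    qed
  qed
  then have "jackson (kernel_start (Suc m)) = ?r * jackson (kernel_start m)"
    by (subst (asm) jackson_linear) (auto intro: summable_start)
  then show ?case unfolding Suc by (simp add: qpoch_Suc mult_ac)
qed

text \<open>Letting \<open>m\<close> tend to infinity turns \<open>kernel_start m\<close> into the kernel without parameters.\<close>

lemma jackson_kernel_000: "jackson (kernel 0 0 0) = Q q * Q D * Q (q / D)"
proof -
  have "(\<lambda>m. jackson (kernel_start m)) \<longlonglongrightarrow> jackson (kernel 0 0 0)"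
  proof (rule jackson_tannery)
    fix y :: complex and n :: nat
    have "(\<lambda>m. kernel_start m (y * q ^ n)) \<longlonglongrightarrow> y * q ^ n * Q (D * (y * q ^ n)) * Q (q * (y * q ^ n))"
      unfolding kernel_start_def by (intro tendsto_intros qpoch_LIMSEQ)
    then show "(\<lambda>m. kernel_start m (y * q ^ n)) \<longlonglongrightarrow> kernel 0 0 0 (y * q ^ n)"
      by (simp add: kernel_def mult_ac)
  next
    fix y :: complex
    define E where "E = (\<lambda>t. exp (norm (t * y) / (1 - norm q)))"
    have "norm (kernel_start m (y * q ^ n)) \<le> (norm y * E D * E q) * norm q ^ n" for n m
    proof -
      have "norm (kernel_start m (y * q ^ n)) = norm (y * q ^ n) * norm (Q (D * (y * q ^ n))) * norm (P (q * (y * q ^ n)) m)"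
        by (simp add: kernel_start_def norm_mult)
      also have "\<dots> \<le> norm (y * q ^ n) * E D * E q"
        unfolding E_def
        by (intro mult_mono mult_nonneg_nonneg norm_qpoch_inf_orbit_le norm_qpoch_orbit_le norm_ge_zero
            order.refl exp_ge_zero)
      finally show ?thesis by (simp add: norm_mult norm_power mult_ac)
    qed
    then show "\<exists>B. \<forall>n m. norm (kernel_start m (y * q ^ n)) \<le> B * norm q ^ n" by blast
  qed
  moreover have "(\<lambda>m. jackson (kernel_start m)) \<longlonglongrightarrow> Q q * Q D * Q (q / D)"
    unfolding jackson_kernel_start by (intro tendsto_intros qpoch_LIMSEQ LIMSEQ_Suc)
  ultimately show ?thesis using LIMSEQ_unique by blast
qed

text \<open>The three parameters are removed one after another, the kernel being symmetric in them.\<close>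

theorem nonterminating_saalschuetz:
  assumes adm: "admissible a" "admissible b" "admissible c"
  shows "jackson (kernel a b c) =
     Q q * Q D * Q (q / D) * Q (b * c * q / D)
     * Q (a * c * q / D) * Q (a * b * q / D)
     / (Q a * Q b * Q c
        * Q (a * q / D) * Q (b * q / D) * Q (c * q / D))"
proof -
  have sym: "kernel a b c = kernel b c a" for a b c
    by (rule ext) (simp add: kernel_def mult_ac)
  have nz: "Q a \<noteq> 0" "Q b \<noteq> 0" "Q c \<noteq> 0"
    "Q (a * q / D) \<noteq> 0" "Q (b * q / D) \<noteq> 0" "Q (c * q / D) \<noteq> 0"
    using adm by (auto simp: admissible_def)
  have 1: "Q a * Q (a * q / D) * jackson (kernel a 0 0) = jackson (kernel 0 0 0)"
    using jackson_kernel_reduce[of 0 0 a] adm sym[of a 0 0] by simp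
  have 2: "Q b * Q (b * q / D) * jackson (kernel a b 0)
     = Q (a * b * q / D) * jackson (kernel a 0 0)"
    using jackson_kernel_reduce[of 0 a b] adm sym[of 0 a 0] sym[of 0 a b] by simp
  have 3: "Q c * Q (c * q / D) * jackson (kernel a b c)
     = Q (b * c * q / D) * Q (a * c * q / D) * jackson (kernel a b 0)"
    using jackson_kernel_reduce[of a b c] adm by simp
  have "jackson (kernel a 0 0) = jackson (kernel 0 0 0) / (Q a * Q (a * q / D))"
    using 1 nz by (simp add: field_simps)
  moreover have "jackson (kernel a b 0) = Q (a * b * q / D) * jackson (kernel a 0 0)
      / (Q b * Q (b * q / D))"
    using 2 nz by (simp add: field_simps)
  moreover have "jackson (kernel a b c) = Q (b * c * q / D) * Q (a * c * q / D) * jackson (kernel a b 0)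
      / (Q c * Q (c * q / D))"
    using 3 nz by (simp add: field_simps)
  ultimately show ?thesis
    by (simp add: jackson_kernel_000 mult_ac)
qed

end

section \<open>Rearrangement of double series\<close>

lemma sum_triangle_swap:
  fixes f :: "nat \<Rightarrow> nat \<Rightarrow> 'a :: comm_monoid_add"
  shows "(\<Sum>k\<le>N. \<Sum>j\<le>k. f k j) = (\<Sum>j\<le>N. \<Sum>m\<le>N - j. f (j + m) j)"
  unfolding sum.Sigma[OF finite_atMost ballI[OF finite_atMost]]
  by (rule sum.reindex_bij_witness[of _ "\<lambda>(j, m). (j + m, j)" "\<lambda>(k, j). (j, k - j)"]) auto

text \<open>A product bound makes the double family absolutely summable, so that its sum may be taken by rows; by
  columns and by diagonals it is taken in the next two lemmas.\<close>

lemma has_sum_rows: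
  fixes f :: "nat \<Rightarrow> nat \<Rightarrow> complex"
  assumes A: "summable A" and B: "summable B" and le: "\<And>n N. norm (f n N) \<le> A n * B N"
    and nonneg: "\<And>n. 0 \<le> A n" "\<And>n. 0 \<le> B n"
  shows "(\<lambda>(n, N). f n N) summable_on UNIV" "summable (\<lambda>N. f n N)"
    "(\<lambda>n. \<Sum>N. f n N) sums infsum (\<lambda>(n, N). f n N) UNIV"
proof -
  have nz: "summable (\<lambda>N. norm (f n N))" for n
    by (rule summable_comparison_test'[where g = "\<lambda>N. A n * B N"]) (use B le in \<open>auto intro: summable_mult\<close>)
  then show 1: "summable (\<lambda>N. f n N)" for n
    by (rule summable_norm_cancel)
  have row: "((\<lambda>N. f n N) has_sum (\<Sum>N. f n N)) UNIV" for n
    by (rule norm_summable_imp_has_sum[OF nz summable_sums[OF 1]])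
  have "(\<lambda>x. A (fst x) * B (snd x)) summable_on UNIV \<times> UNIV"
  proof (rule summable_on_SigmaI[where g = "\<lambda>n. A n * suminf B"])
    have "(B has_sum suminf B) UNIV"
      by (intro norm_summable_imp_has_sum summable_sums B) (use B nonneg in auto)
    then show "((\<lambda>N. A (fst (n, N)) * B (snd (n, N))) has_sum (A n * suminf B)) UNIV" for n
      by (simp add: has_sum_cmult_right)
    have "A summable_on UNIV"
      by (intro norm_summable_imp_summable_on) (use A nonneg in auto)
    then show "(\<lambda>n. A n * suminf B) summable_on UNIV"
      by (rule summable_on_cmult_left)
  qed (use nonneg in auto)
  then have "(\<lambda>x. norm ((\<lambda>(n, N). f n N) x)) summable_on UNIV"
    unfolding UNIV_Times_UNIV
    by (rule summable_on_comparison_test) (use le in auto)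
  then show 2: "(\<lambda>(n, N). f n N) summable_on UNIV"
    by (rule abs_summable_summable)
  have "((\<lambda>(n, N). f n N) has_sum infsum (\<lambda>(n, N). f n N) UNIV) (UNIV \<times> UNIV)"
    using has_sum_infsum[OF 2] by simp
  then have "((\<lambda>n. \<Sum>N. f n N) has_sum infsum (\<lambda>(n, N). f n N) UNIV) UNIV"
    by (rule has_sum_SigmaD) (use row in auto)
  then show "(\<lambda>n. \<Sum>N. f n N) sums infsum (\<lambda>(n, N). f n N) UNIV"
    by (rule has_sum_imp_sums)
qed

lemma suminf_swap:
  fixes f :: "nat \<Rightarrow> nat \<Rightarrow> complex"
  assumes A: "summable A" and B: "summable B" and le: "\<And>n N. norm (f n N) \<le> A n * B N"
    and nonneg: "\<And>n. 0 \<le> A n" "\<And>n. 0 \<le> B n"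
  shows "(\<lambda>n. \<Sum>N. f n N) sums (\<Sum>N. \<Sum>n. f n N)" "summable (\<lambda>N. \<Sum>n. f n N)"
proof -
  note 1 = has_sum_rows[OF A B le nonneg]
  have le': "norm (f n N) \<le> B N * A n" for n N using le[of n N] by (simp add: mult.commute)
  note 2 = has_sum_rows[where f = "\<lambda>N n. f n N", OF B A le' nonneg(2,1)]
  have "infsum (\<lambda>(N, n). f n N) UNIV = infsum (\<lambda>(n, N). f n N) UNIV"
    by (rule infsum_reindex_bij_witness[of _ prod.swap prod.swap]) auto
  then show "(\<lambda>n. \<Sum>N. f n N) sums (\<Sum>N. \<Sum>n. f n N)" "summable (\<lambda>N. \<Sum>n. f n N)"
    using 1(3) 2(3) by (auto simp: sums_iff)
qed

lemma suminf_diagonals: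
  fixes f :: "nat \<Rightarrow> nat \<Rightarrow> complex"
  assumes A: "summable A" and B: "summable B" and le: "\<And>n N. norm (f n N) \<le> A n * B N"
    and nonneg: "\<And>n. 0 \<le> A n" "\<And>n. 0 \<le> B n"
  shows "(\<lambda>N. \<Sum>k\<le>N. f k (N - k)) sums (\<Sum>k. \<Sum>m. f k m)"
proof -
  note 1 = has_sum_rows[OF A B le nonneg]
  have "((\<lambda>(n, N). f n N) has_sum (\<Sum>k. \<Sum>m. f k m)) UNIV"
    using has_sum_infsum[OF 1(1)] 1(3) by (simp add: sums_iff)
  also have "?this \<longleftrightarrow> ((\<lambda>(N, k). f k (N - k)) has_sum (\<Sum>k. \<Sum>m. f k m)) (Sigma UNIV (\<lambda>N. {..N}))"
    by (rule has_sum_reindex_bij_witness[of _ "\<lambda>(N, k). (k, N - k)" "\<lambda>(k, m). (k + m, k)"]) auto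
  finally have "((\<lambda>N. \<Sum>k\<le>N. f k (N - k)) has_sum (\<Sum>k. \<Sum>m. f k m)) UNIV"
    by (rule has_sum_SigmaD) (auto intro!: has_sum_finite)
  then show ?thesis by (rule has_sum_imp_sums)
qed

section \<open>Terminating sums and the $q$-binomial theorem\<close>

context q_base
begin

lemma one_minus_q_power_nz: "1 - q * q ^ n \<noteq> 0"
  using qpoch_qq_nz[of "Suc n"] by (auto simp: qpoch_Suc)

text \<open>The Pascal rule for Gaussian binomial coefficients, in the form that all inductions over \<open>N\<close> below use: the
  coefficients are kept as \<open>1 / ((q;q)\<^sub>k (q;q)\<^sub>N\<^sub>-\<^sub>k)\<close>, and the rule comes from
  \<open>1 - q\<^sup>N\<^sup>+\<^sup>1 = (1 - q\<^sup>k) + q\<^sup>k (1 - q\<^sup>N\<^sup>+\<^sup>1\<^sup>-\<^sup>k)\<close>.\<close>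

lemma gauss_sum_Suc:
  "(1 - q ^ Suc N) * (\<Sum>k\<le>Suc N. g k / (P q k * P q (Suc N - k)))
   = (\<Sum>k\<le>N. (g (Suc k) + q ^ k * g k) / (P q k * P q (N - k)))"
proof -
  let ?h = "\<lambda>k. g k / (P q k * P q (Suc N - k))"
  have "(1 - q ^ Suc N) * (\<Sum>k\<le>Suc N. ?h k) = (\<Sum>k\<le>Suc N. (1 - q ^ k) * ?h k + q ^ k * (1 - q ^ (Suc N - k)) * ?h k)"
    unfolding sum_distrib_left
  proof (intro sum.cong refl)
    fix k assume "k \<in> {..Suc N}"
    then have "q ^ Suc N = q ^ k * q ^ (Suc N - k)"
      by (simp flip: power_add)
    then have "1 - q ^ Suc N = (1 - q ^ k) + q ^ k * (1 - q ^ (Suc N - k))"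
      by (simp only: right_diff_distrib) simp
    then show "(1 - q ^ Suc N) * ?h k = (1 - q ^ k) * ?h k + q ^ k * (1 - q ^ (Suc N - k)) * ?h k"
      by (simp only: distrib_right)
  qed
  also have "\<dots> = (\<Sum>k\<le>Suc N. (1 - q ^ k) * ?h k) + (\<Sum>k\<le>Suc N. q ^ k * (1 - q ^ (Suc N - k)) * ?h k)"
    by (rule sum.distrib)
  also have "(\<Sum>k\<le>Suc N. (1 - q ^ k) * ?h k) = (\<Sum>k\<le>N. (1 - q ^ Suc k) * ?h (Suc k))"
    by (simp add: sum.atMost_Suc_shift del: sum.atMost_Suc)
  also have "\<dots> = (\<Sum>k\<le>N. g (Suc k) / (P q k * P q (N - k)))"
  proof (intro sum.cong refl)
    show "(1 - q ^ Suc k) * ?h (Suc k) = g (Suc k) / (P q k * P q (N - k))" for k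
      using one_minus_q_power_nz[of k] by (simp add: qpoch_Suc)
  qed
  also have "(\<Sum>k\<le>Suc N. q ^ k * (1 - q ^ (Suc N - k)) * ?h k) = (\<Sum>k\<le>N. q ^ k * (1 - q ^ (Suc N - k)) * ?h k)"
    by simp
  also have "\<dots> = (\<Sum>k\<le>N. q ^ k * g k / (P q k * P q (N - k)))"
  proof (intro sum.cong refl)
    fix k assume "k \<in> {..N}"
    then have "Suc N - k = Suc (N - k)" by auto
    then show "q ^ k * (1 - q ^ (Suc N - k)) * ?h k = q ^ k * g k / (P q k * P q (N - k))"
      using one_minus_q_power_nz[of "N - k"] by (simp add: qpoch_Suc)
  qed
  finally show ?thesis
    by (simp add: sum.distrib add_divide_distrib)
qed

lemma qpoch_gauss_sum:
  "(\<Sum>m\<le>M. P y m * y ^ (M - m) / (P q m * P q (M - m))) = 1 / P q M"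
proof (induction M)
  case (Suc M)
  have "(1 - q ^ Suc M) * (\<Sum>m\<le>Suc M. P y m * y ^ (Suc M - m) / (P q m * P q (Suc M - m)))
     = (\<Sum>m\<le>M. P y m * y ^ (M - m) / (P q m * P q (M - m)))"
    unfolding gauss_sum_Suc
    by (intro sum.cong refl) (simp add: qpoch_Suc Suc_diff_le algebra_simps)
  also have "\<dots> = (1 - q ^ Suc M) * (1 / P q (Suc M))"
    unfolding Suc using one_minus_q_power_nz[of M] by (simp add: qpoch_Suc)
  finally show ?case
    using one_minus_q_power_nz[of M] by (simp only: mult_cancel_left) simp
qed simp

text \<open>Multiplied by \<open>(q;q)\<^sub>k / ((q;q)\<^sub>j (q;q)\<^sub>k\<^sub>-\<^sub>j)\<close> this is \<open>(q\<^sup>-\<^sup>k;q)\<^sub>j q\<^sup>j / (q;q)\<^sub>j\<close>, the coefficient that occurs in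
  terminating series with argument \<open>q\<close>.\<close>

definition gauss_coeff :: "nat \<Rightarrow> nat \<Rightarrow> complex" where
  "gauss_coeff k j = (\<Prod>i<j. - (q ^ Suc i / q ^ k))"

lemma gauss_coeff_shift: "q ^ (j * n) * gauss_coeff (k + n) j = gauss_coeff k j"
proof -
  have "q ^ (j * n) = (\<Prod>i<j. q ^ n)"
    by (simp flip: power_mult) (simp add: mult.commute)
  then have "q ^ (j * n) * gauss_coeff (k + n) j = (\<Prod>i<j. q ^ n * - (q ^ Suc i / q ^ (k + n)))"
    by (simp only: gauss_coeff_def prod.distrib)
  also have "\<dots> = gauss_coeff k j"
    unfolding gauss_coeff_def using q_nz by (intro prod.cong) (auto simp: power_add)
  finally show ?thesis .
qed

lemma gauss_coeff_Suc: "gauss_coeff (Suc k) (Suc j) = - gauss_coeff k j / q ^ k"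
proof -
  have "gauss_coeff k j = q ^ j * gauss_coeff (Suc k) j" using gauss_coeff_shift[of j 1 k] by simp
  moreover have "gauss_coeff (Suc k) (Suc j) = gauss_coeff (Suc k) j * - (q ^ Suc j / q ^ Suc k)"
    by (simp add: gauss_coeff_def)
  ultimately show ?thesis using q_nz by simp
qed

text \<open>The \<open>q\<close>-Chu--Vandermonde sum with base parameters \<open>w\<close> and \<open>A w\<close>, cleared of the denominator
  \<open>(A w;q)\<^sub>j\<close>. The Pascal rule relates the sum of length \<open>k + 1\<close> at \<open>w\<close> to those of length \<open>k\<close> at \<open>w\<close> and
  at \<open>w q\<close>, whence the induction with \<open>w\<close> arbitrary.\<close>

lemma q_vandermonde:
  "(\<Sum>j\<le>k. gauss_coeff k j * P w j * P (A * w * q ^ j) (k - j) / (P q j * P q (k - j)))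
   = P A k * w ^ k / P q k"
proof (induction k arbitrary: w)
  case (Suc k)
  let ?T = "\<lambda>k w. (\<Sum>j\<le>k. gauss_coeff k j * P w j * P (A * w * q ^ j) (k - j) / (P q j * P q (k - j)))"
  have "(1 - q ^ Suc k) * ?T (Suc k) w
     = (\<Sum>j\<le>k. (1 - A * w * q ^ k) * (gauss_coeff k j * P w j * P (A * w * q ^ j) (k - j) / (P q j * P q (k - j)))
         - (1 - w) / q ^ k * (gauss_coeff k j * P (w * q) j * P (A * (w * q) * q ^ j) (k - j) / (P q j * P q (k - j))))"
    unfolding gauss_sum_Suc
  proof (intro sum.cong refl)
    fix j assume j: "j \<in> {..k}"
    then have s: "Suc k - j = Suc (k - j)" and e: "q ^ j * q ^ (k - j) = q ^ k" by (auto simp flip: power_add)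
    have "P (A * w * q ^ j) (Suc k - j) = P (A * w * q ^ j) (k - j) * (1 - A * w * q ^ k)"
      unfolding s qpoch_Suc using e by (simp add: mult.assoc)
    moreover have "q ^ j * gauss_coeff (Suc k) j = gauss_coeff k j" using gauss_coeff_shift[of j 1 k] by simp
    ultimately have 1: "q ^ j * (gauss_coeff (Suc k) j * P w j * P (A * w * q ^ j) (Suc k - j))
       = (1 - A * w * q ^ k) * (gauss_coeff k j * P w j * P (A * w * q ^ j) (k - j))"
      by (metis mult.assoc mult.commute)
    have 2: "gauss_coeff (Suc k) (Suc j) * P w (Suc j) * P (A * w * q ^ Suc j) (Suc k - Suc j)
       = - ((1 - w) / q ^ k * (gauss_coeff k j * P (w * q) j * P (A * (w * q) * q ^ j) (k - j)))"
      by (simp add: gauss_coeff_Suc qpoch_Suc' mult_ac)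
    show "(gauss_coeff (Suc k) (Suc j) * P w (Suc j) * P (A * w * q ^ Suc j) (Suc k - Suc j) +
         q ^ j * (gauss_coeff (Suc k) j * P w j * P (A * w * q ^ j) (Suc k - j))) / (P q j * P q (k - j))
       = (1 - A * w * q ^ k) * (gauss_coeff k j * P w j * P (A * w * q ^ j) (k - j) / (P q j * P q (k - j)))
         - (1 - w) / q ^ k * (gauss_coeff k j * P (w * q) j * P (A * (w * q) * q ^ j) (k - j) / (P q j * P q (k - j)))"
      unfolding 1 2 by (simp add: diff_divide_distrib)
  qed
  also have "\<dots> = (1 - A * w * q ^ k) * ?T k w - (1 - w) / q ^ k * ?T k (w * q)"
    by (simp only: sum_subtractf sum_distrib_left)
  also have "\<dots> = P A (Suc k) * w ^ Suc k / P q k"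
    unfolding Suc using q_nz qpoch_qq_nz[of k] by (simp add: qpoch_Suc field_simps)
  also have "\<dots> = (1 - q ^ Suc k) * (P A (Suc k) * w ^ Suc k / P q (Suc k))"
    using one_minus_q_power_nz[of k] by (simp add: qpoch_Suc[of q q])
  finally show ?case
    using one_minus_q_power_nz[of k] by (simp only: mult_cancel_left) simp
qed (simp add: gauss_coeff_def)

text \<open>Expand \<open>(A;q)\<^sub>k w\<^sup>k\<close> by \<open>q_vandermonde\<close> and interchange the sums; the inner sum is then
  \<open>qpoch_gauss_sum\<close> at \<open>y = B q\<^sup>j\<close> and collapses. The point of the transformation is that on the right \<open>A\<close> occurs
  only in the product \<open>A w\<close> and \<open>B\<close> only in \<open>(B;q)\<^sub>j\<close>.\<close>

lemma terminating_transformation: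
  "(\<Sum>k\<le>N. P A k * P B k * P (A * w * q ^ k) (N - k) * w ^ k * B ^ (N - k)
       / (P q k * P q (N - k)))
   = (\<Sum>j\<le>N. gauss_coeff N j * P w j * P B j * P (A * w * q ^ j) (N - j)
       / (P q j * P q (N - j)))"
proof -
  let ?P = "P q"
  let ?f = "\<lambda>k j. gauss_coeff k j * P w j * P (A * w * q ^ j) (N - j) * P B k * B ^ (N - k)
       / (?P j * ?P (k - j) * ?P (N - k))"
  have "P A k * P B k * P (A * w * q ^ k) (N - k) * w ^ k * B ^ (N - k) / (?P k * ?P (N - k))
     = (\<Sum>j\<le>k. ?f k j)" if k: "k \<le> N" for k
  proof -
    have "P A k * P B k * P (A * w * q ^ k) (N - k) * w ^ k * B ^ (N - k) / (?P k * ?P (N - k))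
      = (P A k * w ^ k / ?P k) * (P (A * w * q ^ k) (N - k) * P B k * B ^ (N - k) / ?P (N - k))"
      by simp
    also have "\<dots> = (\<Sum>j\<le>k. ?f k j)"
      unfolding q_vandermonde[symmetric] sum_distrib_right
    proof (intro sum.cong refl)
      fix j assume j: "j \<in> {..k}"
      then have "q ^ j * q ^ (k - j) = q ^ k" "(k - j) + (N - k) = N - j"
        using k by (auto simp flip: power_add)
      then have "P (A * w * q ^ j) (N - j) = P (A * w * q ^ j) (k - j) * P (A * w * q ^ k) (N - k)"
        using qpoch_add[of q "A * w * q ^ j" "k - j" "N - k"] by (simp add: mult.assoc)
      then show "gauss_coeff k j * P w j * P (A * w * q ^ j) (k - j) / (?P j * ?P (k - j)) *
          (P (A * w * q ^ k) (N - k) * P B k * B ^ (N - k) / ?P (N - k)) = ?f k j"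
        by simp
    qed
    finally show ?thesis .
  qed
  then have "(\<Sum>k\<le>N. P A k * P B k * P (A * w * q ^ k) (N - k) * w ^ k * B ^ (N - k)
       / (?P k * ?P (N - k))) = (\<Sum>k\<le>N. \<Sum>j\<le>k. ?f k j)"
    by (intro sum.cong refl) simp
  also have "\<dots> = (\<Sum>j\<le>N. \<Sum>m\<le>N - j. ?f (j + m) j)"
    by (rule sum_triangle_swap)
  also have "\<dots> = (\<Sum>j\<le>N. gauss_coeff N j * P w j * P B j * P (A * w * q ^ j) (N - j) / (?P j * ?P (N - j)))"
  proof (intro sum.cong refl)
    fix j assume j: "j \<in> {..N}"
    let ?y = "B * q ^ j"
    let ?c = "gauss_coeff N j * P w j * P B j * P (A * w * q ^ j) (N - j) / ?P j"
    have "(\<Sum>m\<le>N - j. ?f (j + m) j)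
       = (\<Sum>m\<le>N - j. ?c * (P ?y m * ?y ^ (N - j - m) / (?P m * ?P (N - j - m))))"
    proof (intro sum.cong refl)
      fix m assume m: "m \<in> {..N - j}"
      then have "j + m + (N - j - m) = N" using j by auto
      then have "gauss_coeff (j + m) j = q ^ (j * (N - j - m)) * gauss_coeff N j"
        using gauss_coeff_shift[of j "N - j - m" "j + m"] by simp
      moreover have "?y ^ (N - j - m) = B ^ (N - (j + m)) * q ^ (j * (N - j - m))"
        by (simp add: power_mult_distrib power_mult)
      ultimately show "?f (j + m) j = ?c * (P ?y m * ?y ^ (N - j - m) / (?P m * ?P (N - j - m)))"
        by (simp add: qpoch_add[of q B j m] mult_ac)
    qed
    also have "\<dots> = ?c * (1 / ?P (N - j))"
      unfolding sum_distrib_left[symmetric] qpoch_gauss_sum ..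
    finally show "(\<Sum>m\<le>N - j. ?f (j + m) j) = gauss_coeff N j * P w j * P B j * P (A * w * q ^ j) (N - j) / (?P j * ?P (N - j))"
      by simp
  qed
  finally show ?thesis .
qed

lemma qpoch_inf_nz_iff: "Q x \<noteq> 0 \<longleftrightarrow> (\<forall>n. P x n \<noteq> 0)"
proof
  assume "\<forall>n. P x n \<noteq> 0"
  then have "x * q ^ k \<noteq> 1" for k
    by (metis qpoch_Suc mult_zero_right right_minus_eq)
  then show "Q x \<noteq> 0" by (auto simp: qpoch_inf_eq_0_iff)
qed (metis qpoch_inf_split mult_zero_left)

lemma qpoch_inverse_bounded:
  assumes "Q x \<noteq> 0"
  obtains B where "B > 0" "\<And>n. norm (inverse (P x n)) \<le> B"
proof -
  have "(\<lambda>n. inverse (P x n)) \<longlonglongrightarrow> inverse (Q x)"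
    by (intro tendsto_inverse qpoch_LIMSEQ assms)
  then have "Bseq (\<lambda>n. inverse (P x n))"
    using convergent_def convergent_imp_Bseq by blast
  then show ?thesis using that by (auto simp: Bseq_def)
qed

lemma summable_q_binomial:
  assumes "norm z < 1"
  shows "summable (\<lambda>m. P e m / P q m * z ^ m)"
proof -
  obtain B where B: "B > 0" "\<And>n. norm (inverse (P q n)) \<le> B"
    by (rule qpoch_inverse_bounded[OF qpoch_inf_nz_small[OF q_lt_1]]) blast
  show ?thesis
  proof (rule summable_comparison_test')
    show "summable (\<lambda>m. exp (norm e / (1 - norm q)) * B * norm z ^ m)"
      using assms by (intro summable_mult summable_geometric) auto
    show "norm (P e m / P q m * z ^ m) \<le> exp (norm e / (1 - norm q)) * B * norm z ^ m" for m
    proof -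
      have "norm (P e m / P q m * z ^ m) = norm (P e m) * norm (inverse (P q m)) * norm z ^ m"
        by (simp add: norm_mult norm_power norm_divide norm_inverse divide_inverse)
      also have "\<dots> \<le> exp (norm e / (1 - norm q)) * B * norm z ^ m"
        by (intro mult_mono mult_nonneg_nonneg norm_qpoch_le B) (use B(1) in auto)
      finally show ?thesis .
    qed
  qed
qed

text \<open>The series \<open>f\<close> satisfies \<open>(1 - z) f(z) = (1 - e z) f(q z)\<close>; iterating this leads to \<open>f(0) = 1\<close>.\<close>

theorem q_binomial:
  assumes z: "norm z < 1"
  shows "(\<lambda>m. P e m / P q m * z ^ m) sums (Q (e * z) / Q z)"
proof -
  define f where "f = (\<lambda>z. \<Sum>m. P e m / P q m * z ^ m)"
  have small: "norm (z * q ^ n) < 1" for n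
  proof -
    have "norm z * norm q ^ n \<le> norm z * 1"
      using q_lt_1 by (intro mult_left_mono power_le_one) auto
    with z show ?thesis by (simp add: norm_mult norm_power)
  qed
  have step: "(1 - y) * f y = (1 - e * y) * f (y * q)" if y: "norm y < 1" "norm (y * q) < 1" for y
  proof -
    have s: "(\<lambda>m. P e m / P q m * t ^ m) sums f t" if "norm t < 1" for t
      unfolding f_def using summable_q_binomial[OF that] by (rule summable_sums)
    have 1: "(\<lambda>m. P e m / P q m * y ^ m - P e m / P q m * (y * q) ^ m) sums (f y - f (y * q))"
      by (intro sums_diff s y)
    have 2: "(\<lambda>m. y * (P e m / P q m * y ^ m - e * (P e m / P q m * (y * q) ^ m)))
        sums (y * (f y - e * f (y * q)))"
      by (intro sums_diff sums_mult s y)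
    have "y * (P e m / P q m * y ^ m - e * (P e m / P q m * (y * q) ^ m))
        = P e (Suc m) / P q (Suc m) * y ^ Suc m - P e (Suc m) / P q (Suc m) * (y * q) ^ Suc m" for m
    proof -
      have lin: "C * y ^ Suc m - C * (y * q) ^ Suc m = C * (1 - q * q ^ m) * y ^ Suc m" for C
        by (simp add: power_mult_distrib algebra_simps)
      have "P e (Suc m) / P q (Suc m) * y ^ Suc m - P e (Suc m) / P q (Suc m) * (y * q) ^ Suc m
         = P e (Suc m) / P q (Suc m) * (1 - q * q ^ m) * y ^ Suc m"
        by (rule lin)
      also have "P e (Suc m) / P q (Suc m) * (1 - q * q ^ m) = P e (Suc m) / P q m"
        using one_minus_q_power_nz[of m] by (simp add: qpoch_Suc[of q q])
      finally show ?thesis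
        by (simp add: qpoch_Suc power_mult_distrib algebra_simps diff_divide_distrib)
    qed
    then have "(\<lambda>m. P e (Suc m) / P q (Suc m) * y ^ Suc m - P e (Suc m) / P q (Suc m) * (y * q) ^ Suc m)
        sums (y * (f y - e * f (y * q)))"
      using 2 by simp
    then have "(\<lambda>m. P e m / P q m * y ^ m - P e m / P q m * (y * q) ^ m)
        sums (y * (f y - e * f (y * q)))"
      by (subst (asm) sums_Suc_iff) simp
    with 1 have "f y - f (y * q) = y * (f y - e * f (y * q))"
      using sums_unique2 by blast
    then show ?thesis by (simp add: algebra_simps)
  qed
  have fin: "P z n * f z = P (e * z) n * f (z * q ^ n)" for n
  proof (induction n)
    case (Suc n)
    have "P z (Suc n) * f z = (1 - z * q ^ n) * (P z n * f z)"
      by (simp add: qpoch_Suc)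
    also have "\<dots> = P (e * z) n * ((1 - z * q ^ n) * f (z * q ^ n))"
      unfolding Suc by simp
    also have "\<dots> = P (e * z) (Suc n) * f (z * q ^ Suc n)"
      using step[of "z * q ^ n"] small[of n] small[of "Suc n"] by (simp add: qpoch_Suc mult_ac)
    finally show ?case .
  qed simp
  have cont: "isCont f 0"
  proof -
    have "summable (\<lambda>m. P e m / P q m * (1/2) ^ m)"
      by (rule summable_q_binomial) (simp add: norm_divide)
    then show ?thesis unfolding f_def by (rule isCont_powser) simp
  qed
  have "(\<lambda>n. z * q ^ n) \<longlonglongrightarrow> z * 0"
    using q_lt_1 by (intro tendsto_intros LIMSEQ_power_zero)
  then have "(\<lambda>n. f (z * q ^ n)) \<longlonglongrightarrow> f 0"
    by (intro isCont_tendsto_compose[OF cont]) simp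
  moreover have "f 0 = 1" unfolding f_def powser_zero by simp
  ultimately have "(\<lambda>n. P z n * f z) \<longlonglongrightarrow> Q (e * z) * 1"
    unfolding fin by (intro tendsto_mult qpoch_LIMSEQ) auto
  moreover have "(\<lambda>n. P z n * f z) \<longlonglongrightarrow> Q z * f z"
    by (intro tendsto_intros qpoch_LIMSEQ)
  ultimately have "Q z * f z = Q (e * z)"
    using LIMSEQ_unique by force
  then have "f z = Q (e * z) / Q z"
    using qpoch_inf_nz_small[OF z] by (simp add: field_simps)
  then show ?thesis
    using summable_q_binomial[OF z, of e] unfolding f_def by (simp add: sums_iff)
qed

text \<open>Expand each quotient of infinite products by the \<open>q\<close>-binomial theorem and sum by diagonals \<open>k + m = N\<close>. As
  \<open>(e;q)\<^sub>k (eq\<^sup>k;q)\<^sub>m = (e;q)\<^sub>N\<close>, the parameter \<open>e\<close> separates from everything else. This is applied to both sides of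
  the theorem.\<close>

lemma q_binomial_rearrangement:
  assumes z: "norm z < 1" and w: "norm w < 1" and \<alpha>: "\<And>k. norm (\<alpha> k) \<le> K"
  shows "(\<lambda>N. P e N * (\<Sum>k\<le>N. \<alpha> k * w ^ k * z ^ (N - k) / P q (N - k)))
     sums (\<Sum>k. P e k * \<alpha> k * w ^ k * (Q (e * z * q ^ k) / Q z))"
proof -
  obtain B where B: "B > 0" "\<And>n. norm (inverse (P q n)) \<le> B"
    by (rule qpoch_inverse_bounded[OF qpoch_inf_nz_small[OF q_lt_1]]) blast
  define E where "E = exp (norm e / (1 - norm q))"
  have K: "0 \<le> K" using \<alpha>[of 0] norm_ge_zero order_trans by blast
  define f where "f = (\<lambda>k m. P e (k + m) * \<alpha> k * w ^ k * z ^ m / P q m)"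
  have "(\<lambda>N. \<Sum>k\<le>N. f k (N - k)) sums (\<Sum>k. \<Sum>m. f k m)"
  proof (rule suminf_diagonals)
    show "summable (\<lambda>k. E * K * norm w ^ k)" "summable (\<lambda>m. B * norm z ^ m)"
      using z w by (auto intro!: summable_mult summable_geometric)
    show "norm (f k m) \<le> E * K * norm w ^ k * (B * norm z ^ m)" for k m
    proof -
      have "norm (f k m) = norm (P e (k + m)) * norm (\<alpha> k) * norm w ^ k * norm z ^ m * norm (inverse (P q m))"
        by (simp add: f_def norm_mult norm_power divide_inverse)
      also have "\<dots> \<le> E * K * norm w ^ k * norm z ^ m * B"
        unfolding E_def using K
        by (intro mult_mono mult_nonneg_nonneg norm_qpoch_le \<alpha> B) auto
      finally show ?thesis by (simp add: mult_ac)
    qed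
  qed (use K B in \<open>auto simp: E_def\<close>)
  moreover have "(\<Sum>k\<le>N. f k (N - k)) = P e N * (\<Sum>k\<le>N. \<alpha> k * w ^ k * z ^ (N - k) / P q (N - k))" for N
    unfolding f_def sum_distrib_left by (intro sum.cong refl) simp
  moreover have "(\<Sum>m. f k m) = P e k * \<alpha> k * w ^ k * (Q (e * z * q ^ k) / Q z)" for k
  proof -
    have "(\<lambda>m. (P e k * \<alpha> k * w ^ k) * (P (e * q ^ k) m / P q m * z ^ m))
      sums (P e k * \<alpha> k * w ^ k * (Q (e * q ^ k * z) / Q z))"
      by (intro sums_mult q_binomial z)
    then show ?thesis
      unfolding f_def qpoch_add by (auto simp: sums_iff mult_ac)
  qed
  ultimately show ?thesis by simp
qed

end

section \<open>The sum over the residues\<close>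

text \<open>The letters \<open>a, b, c, e, z, D\<close> stand for \<open>q\<^sup>a, q\<^sup>b, q\<^sup>c, q\<^sup>e, q\<^sup>f, q\<^sup>d\<close>; the dependence on \<open>s\<close> is through
  \<open>x = q\<^sup>s\<close> alone.\<close>

locale barnes_data = q_pair +
  fixes a b c z e :: complex
  assumes adm: "admissible a" "admissible b" "admissible c"
    and b_nz: "b \<noteq> 0"
    and small: "norm z < 1" "norm (z * q / D) < 1" "norm (c * z * q / D) < 1"
    and den: "Q (a * b * q / D) \<noteq> 0" "Q (e * z) \<noteq> 0"
begin

abbreviation "w \<equiv> c * z * q / D"
abbreviation "lam \<equiv> a * b * c * q / D"

text \<open>A term of the series \<open>\<^sub>3\<phi>\<^sub>2\<close> of the integrand, multiplied by \<open>(lam x, e z x;q)\<^sub>\<infinity>\<close>. This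
  clears its denominators, so that \<open>Phi\<close> below is entire.\<close>

definition Phi_term :: "complex \<Rightarrow> nat \<Rightarrow> complex" where
  "Phi_term x k = P e k * P (a * x) k * P (b * x) k / P q k * w ^ k
      * Q (lam * x * q ^ k) * Q (e * z * x * q ^ k)"

definition Phi :: "complex \<Rightarrow> complex" where
  "Phi x = (\<Sum>k. Phi_term x k)"

lemma norm_Phi_term_le:
  obtains K where "\<And>x k. norm x \<le> R \<Longrightarrow> norm (Phi_term x k) \<le> K * norm w ^ k"
proof -
  obtain S where S: "S > 0" "\<And>n. norm (inverse (P q n)) \<le> S"
    by (rule qpoch_inverse_bounded[OF qpoch_inf_nz_small[OF q_lt_1]]) blast
  define E where "E = (\<lambda>t::complex. exp (norm t * R / (1 - norm q)))"
  define Ee where "Ee = exp (norm e / (1 - norm q))"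
  have E: "exp (norm (t * x) / (1 - norm q)) \<le> E t" if "norm x \<le> R" for t x
    unfolding E_def using q_lt_1 that by (simp add: divide_right_mono norm_mult mult_left_mono)
  have E': "norm (Q (t * x * q ^ k)) \<le> E t" if "norm x \<le> R" for t x k
  proof -
    have "norm x * norm q ^ k \<le> norm x * 1"
      using q_lt_1 by (intro mult_left_mono power_le_one) auto
    then have "norm (x * q ^ k) \<le> R" using that by (simp add: norm_mult norm_power)
    from order.trans[OF norm_qpoch_inf_le E[OF this]] show ?thesis by (simp add: mult.assoc)
  qed
  have "norm (Phi_term x k) \<le> (Ee * E a * E b * S * E lam * E (e * z)) * norm w ^ k" if x: "norm x \<le> R" for x k
  proof -
    have "norm (Phi_term x k) = norm (P e k) * norm (P (a * x) k) * norm (P (b * x) k)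
      * norm (inverse (P q k)) * norm (Q (lam * x * q ^ k))
      * norm (Q (e * z * x * q ^ k)) * norm w ^ k"
      by (simp add: Phi_term_def divide_inverse norm_mult norm_power mult_ac)
    also have "\<dots> \<le> Ee * E a * E b * S * E lam * E (e * z) * norm w ^ k"
      unfolding Ee_def
      by (intro mult_mono mult_nonneg_nonneg norm_ge_zero order.refl norm_qpoch_le E'[OF x] S zero_le_power
          order.trans[OF norm_qpoch_le E[OF x]]) (use S(1) in \<open>auto simp: E_def\<close>)
    finally show ?thesis .
  qed
  then show ?thesis using that by blast
qed

lemma summable_Phi_term: "summable (Phi_term x)"
proof -
  obtain K where K: "\<And>y k. norm y \<le> norm x \<Longrightarrow> norm (Phi_term y k) \<le> K * norm w ^ k"
    by (rule norm_Phi_term_le[of "norm x"]) blast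
  show ?thesis
  proof (rule summable_comparison_test')
    show "summable (\<lambda>k. K * norm w ^ k)"
      by (intro summable_mult summable_geometric) (use small in auto)
    show "norm (Phi_term x k) \<le> K * norm w ^ k" for k by (rule K) simp
  qed
qed

lemma holomorphic_Phi: "Phi holomorphic_on UNIV"
proof (rule holomorphic_uniform_sequence[where f = "\<lambda>N x. \<Sum>k<N. Phi_term x k"])
  show "(\<lambda>x. \<Sum>k<n. Phi_term x k) holomorphic_on UNIV" for n
    unfolding Phi_term_def qpoch_def by (intro holomorphic_intros) (use qpoch_qq_nz in \<open>auto simp: qpoch_def\<close>)
  show "\<exists>d>0. cball x d \<subseteq> UNIV \<and>
      uniform_limit (cball x d) (\<lambda>N x. \<Sum>k<N. Phi_term x k) Phi sequentially" for x
  proof (intro exI[of _ 1] conjI)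
    obtain K where K: "\<And>y k. norm y \<le> norm x + 1 \<Longrightarrow> norm (Phi_term y k) \<le> K * norm w ^ k"
      by (rule norm_Phi_term_le[of "norm x + 1"]) blast
    have "norm y \<le> norm x + 1" if "y \<in> cball x 1" for y
      using that norm_triangle_sub[of y x] by (auto simp: dist_norm norm_minus_commute)
    then show "uniform_limit (cball x 1) (\<lambda>N x. \<Sum>k<N. Phi_term x k) Phi sequentially"
      unfolding Phi_def[abs_def]
      by (intro Weierstrass_m_test[where M = "\<lambda>k. K * norm w ^ k"] K)
        (use small in \<open>auto intro!: summable_mult summable_geometric\<close>)
  qed auto
qed auto

text \<open>The integrand divided by \<open>q\<^sup>s\<close> and by the trigonometric factor, as a function of \<open>x = q\<^sup>s\<close>.\<close>

definition profile :: "complex \<Rightarrow> complex" where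
  "profile x = Q (q * x) * Q (D * x) * Phi x
     / (Q (a * x) * Q (b * x) * Q (c * x) * Q (z * x))"

text \<open>The \<open>N\<close>-th term of the expansion of \<open>x profile(x)\<close>, after the terminating transformation.\<close>

definition layer :: "nat \<Rightarrow> complex \<Rightarrow> complex" where
  "layer N x = P e N * (z / b) ^ N * (\<Sum>j\<le>N. gauss_coeff N j * P (b * c * q / D) j
      / (P q j * P q (N - j)) * kernel a (b * q ^ j) c x)"

text \<open>The \<open>k\<close>-th term of \<open>x profile(x)\<close> is this weight times \<open>(e;q)\<^sub>k w\<^sup>k (e z x q\<^sup>k;q)\<^sub>\<infinity> / (z x;q)\<^sub>\<infinity>\<close>.\<close>

definition weight :: "complex \<Rightarrow> nat \<Rightarrow> complex" where
  "weight x k = x * Q (q * x) * Q (D * x) * P (a * x) k * P (b * x) k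
     * Q (lam * x * q ^ k)
     / (P q k * (Q (a * x) * Q (b * x) * Q (c * x)))"

text \<open>This is \<open>terminating_transformation\<close> with \<open>A, B\<close> replaced by \<open>a x, b x\<close> and \<open>w\<close> by \<open>b c q / D\<close>, multiplied by
  \<open>(lam x q\<^sup>N;q)\<^sub>\<infinity>\<close> and the remaining factors of the kernel.\<close>

lemma layer_eq:
  assumes x: "Q (b * x) \<noteq> 0"
  shows "layer N x = P e N * (\<Sum>k\<le>N. weight x k * w ^ k * (z * x) ^ (N - k) / P q (N - k))"
proof -
  let ?P = "P q"
  define R where "R = x * Q (q * x) * Q (D * x) / (Q (a * x) * Q (b * x) * Q (c * x))"
  \<comment> \<open>\<open>eq1\<close> and \<open>eq2\<close> identify the terms on the two sides of the transformation with those of the two forms of the layer.\<close>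
  have eq1: "(z / b) ^ N * (R * Q (lam * x * q ^ N)) *
      (P (a * x) k * P (b * x) k * P (a * x * (b * c * q / D) * q ^ k) (N - k) * (b * c * q / D) ^ k * (b * x) ^ (N - k)
       / (?P k * ?P (N - k))) = weight x k * w ^ k * (z * x) ^ (N - k) / ?P (N - k)" if k: "k \<le> N" for k
  proof -
    have "(z / b) ^ N = (z / b) ^ k * (z / b) ^ (N - k)" using k by (simp flip: power_add)
    then have pw: "(z / b) ^ N * (b * c * q / D) ^ k * (b * x) ^ (N - k) = w ^ k * (z * x) ^ (N - k)"
      using b_nz by (simp add: power_mult_distrib[symmetric]) (simp add: power_mult_distrib power_divide field_simps)
    have "q ^ k * q ^ (N - k) = q ^ N" using k by (simp flip: power_add)
    then have Q: "Q (lam * x * q ^ k) = P (a * x * (b * c * q / D) * q ^ k) (N - k) * Q (lam * x * q ^ N)"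
      using qpoch_inf_split[of "lam * x * q ^ k" "N - k"] by (simp add: mult_ac)
    have "(z / b) ^ N * (R * Q (lam * x * q ^ N)) *
      (P (a * x) k * P (b * x) k * P (a * x * (b * c * q / D) * q ^ k) (N - k) * (b * c * q / D) ^ k * (b * x) ^ (N - k)
       / (?P k * ?P (N - k)))
      = R * P (a * x) k * P (b * x) k * (P (a * x * (b * c * q / D) * q ^ k) (N - k) * Q (lam * x * q ^ N))
        / (?P k * ?P (N - k)) * ((z / b) ^ N * (b * c * q / D) ^ k * (b * x) ^ (N - k))"
      by (simp only: times_divide_eq_right times_divide_eq_left mult_ac)
    also have "\<dots> = R * P (a * x) k * P (b * x) k * Q (lam * x * q ^ k) / (?P k * ?P (N - k)) * (w ^ k * (z * x) ^ (N - k))"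
      unfolding pw Q ..
    also have "\<dots> = weight x k * w ^ k * (z * x) ^ (N - k) / ?P (N - k)"
      by (simp add: weight_def R_def mult_ac)
    finally show ?thesis .
  qed
  have eq2: "(R * Q (lam * x * q ^ N)) *
      (gauss_coeff N j * P (b * c * q / D) j * P (b * x) j * P (a * x * (b * c * q / D) * q ^ j) (N - j)
       / (?P j * ?P (N - j))) = gauss_coeff N j * P (b * c * q / D) j / (?P j * ?P (N - j)) * kernel a (b * q ^ j) c x" if j: "j \<le> N" for j
  proof -
    have "q ^ j * q ^ (N - j) = q ^ N" using j by (simp flip: power_add)
    then have Q: "Q (lam * q ^ j * x) = P (a * x * (b * c * q / D) * q ^ j) (N - j) * Q (lam * x * q ^ N)"
      using qpoch_inf_split[of "lam * x * q ^ j" "N - j"] by (simp add: mult_ac)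
    have B: "Q (b * x) = P (b * x) j * Q (b * x * q ^ j)" by (rule qpoch_inf_split)
    have "R * P (b * x) j * Q (lam * q ^ j * x) = kernel a (b * q ^ j) c x"
      using x unfolding R_def kernel_def B by (simp add: mult_ac)
    then show ?thesis unfolding Q by (simp add: mult_ac)
  qed
  have "(z / b) ^ N * (\<Sum>j\<le>N. gauss_coeff N j * P (b * c * q / D) j / (?P j * ?P (N - j)) * kernel a (b * q ^ j) c x)
     = (z / b) ^ N * (R * Q (lam * x * q ^ N)) *
       (\<Sum>j\<le>N. gauss_coeff N j * P (b * c * q / D) j * P (b * x) j * P (a * x * (b * c * q / D) * q ^ j) (N - j)
       / (?P j * ?P (N - j)))"
    unfolding sum_distrib_left mult.assoc[of "(z / b) ^ N"]
    by (intro sum.cong refl arg_cong[of _ _ "\<lambda>t. (z / b) ^ N * t"]) (subst eq2, auto)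
  also have "\<dots> = (\<Sum>k\<le>N. weight x k * w ^ k * (z * x) ^ (N - k) / ?P (N - k))"
    unfolding terminating_transformation[symmetric] sum_distrib_left
    by (intro sum.cong refl) (subst eq1, auto)
  finally show ?thesis
    unfolding layer_def by (simp add: mult.assoc)
qed

lemma orbit_bounds:
  assumes y: "y = 1 \<or> y = q / D"
  obtains K where "K \<ge> 0" "\<And>n k. norm (weight (y * q ^ n) k) \<le> K * norm q ^ n"
proof -
  obtain A B C where AB: "\<And>n. norm (inverse (Q (a * (y * q ^ n)))) \<le> A"
    "\<And>n. norm (inverse (Q (b * (y * q ^ n)))) \<le> B"
    "\<And>n. norm (inverse (Q (c * (y * q ^ n)))) \<le> C"
    and pos: "A > 0" "B > 0" "C > 0"
    using admissible_inverse_bounded[OF adm(1) y] admissible_inverse_bounded[OF adm(2) y]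
      admissible_inverse_bounded[OF adm(3) y] by metis
  obtain S where S: "S > 0" "\<And>n. norm (inverse (P q n)) \<le> S"
    by (rule qpoch_inverse_bounded[OF qpoch_inf_nz_small[OF q_lt_1]]) blast
  define E where "E = (\<lambda>t. exp (norm (t * y) / (1 - norm q)))"
  have E0: "0 \<le> E t" for t by (simp add: E_def)
  have E1: "norm (Q (t * (y * q ^ n))) \<le> E t" and E2: "norm (P (t * (y * q ^ n)) k) \<le> E t" for t n k
    unfolding E_def by (rule norm_qpoch_inf_orbit_le, rule norm_qpoch_orbit_le)
  let ?K = "norm y * E q * E D * E a * E b * E lam * S * A * B * C"
  have "norm (weight (y * q ^ n) k) \<le> ?K * norm q ^ n" for n k
  proof -
    let ?x = "y * q ^ n"
    have "weight ?x k = ?x * Q (q * ?x) * Q (D * ?x) * P (a * ?x) k * P (b * ?x) k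
       * Q (lam * (y * q ^ (n + k))) * inverse (P q k) * inverse (Q (a * ?x))
       * inverse (Q (b * ?x)) * inverse (Q (c * ?x))"
      by (simp add: weight_def divide_inverse power_add mult_ac)
    then have "norm (weight ?x k) = norm ?x * norm (Q (q * ?x)) * norm (Q (D * ?x))
       * norm (P (a * ?x) k) * norm (P (b * ?x) k)
       * norm (Q (lam * (y * q ^ (n + k)))) * norm (inverse (P q k)) * norm (inverse (Q (a * ?x)))
       * norm (inverse (Q (b * ?x))) * norm (inverse (Q (c * ?x)))"
      by (simp only: norm_mult)
    also have "\<dots> \<le> norm ?x * E q * E D * E a * E b * E lam * S * A * B * C"
      by (intro mult_mono mult_nonneg_nonneg E1 E2 AB S norm_ge_zero E0 order.refl less_imp_le[OF pos(1)]
          less_imp_le[OF pos(2)] less_imp_le[OF pos(3)] less_imp_le[OF S(1)])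
    finally show ?thesis by (simp add: norm_mult norm_power mult_ac)
  qed
  moreover have "?K \<ge> 0"
    by (intro mult_nonneg_nonneg norm_ge_zero E0 less_imp_le[OF pos(1)]
          less_imp_le[OF pos(2)] less_imp_le[OF pos(3)] less_imp_le[OF S(1)])
  ultimately show ?thesis using that by blast
qed

lemma orbit_small: "y = 1 \<or> y = q / D \<Longrightarrow> norm (z * (y * q ^ n)) \<le> norm (z * y) \<and> norm (z * y) < 1"
proof -
  assume y: "y = 1 \<or> y = q / D"
  have "norm (z * y) * norm q ^ n \<le> norm (z * y) * 1"
    using q_lt_1 by (intro mult_left_mono power_le_one) auto
  then show ?thesis using y small(1,2) by (auto simp: norm_mult norm_power norm_divide mult_ac)
qed

text \<open>On both orbits \<open>\<bar>z x\<bar> < 1\<close>, so \<open>q_binomial_rearrangement\<close> applies with \<open>z x\<close> in place of \<open>z\<close>.\<close>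

lemma profile_eq_layers:
  assumes y: "y = 1 \<or> y = q / D"
  defines "x \<equiv> \<lambda>n. y * q ^ n"
  shows "(\<lambda>N. layer N (x n)) sums (x n * profile (x n))"
proof -
  obtain K where K: "K \<ge> 0" "\<And>n k. norm (weight (x n) k) \<le> K * norm q ^ n"
    using orbit_bounds[OF y] unfolding x_def by blast
  have zx: "norm (z * x n) < 1" using orbit_small[OF y, of n] by (auto simp: x_def)
  have "(\<lambda>N. layer N (x n)) sums
     (\<Sum>k. P e k * weight (x n) k * w ^ k * (Q (e * (z * x n) * q ^ k) / Q (z * x n)))"
    using q_binomial_rearrangement[OF zx small(3) K(2)]
    by (subst layer_eq) (use admissible_orbit[OF adm(2) y] in \<open>auto simp: x_def\<close>)
  also have "(\<Sum>k. P e k * weight (x n) k * w ^ k * (Q (e * (z * x n) * q ^ k) / Q (z * x n)))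
    = x n * profile (x n)"
  proof -
    define V where "V = x n * Q (q * x n) * Q (D * x n)
     / (Q (a * x n) * Q (b * x n) * Q (c * x n) * Q (z * x n))"
    have eq: "P e k * weight (x n) k * w ^ k * (Q (e * (z * x n) * q ^ k) / Q (z * x n)) = V * Phi_term (x n) k" for k
      unfolding V_def Phi_term_def weight_def by (simp add: mult_ac)
    have Vh: "V * Phi (x n) = x n * profile (x n)"
      unfolding V_def profile_def by (simp add: mult_ac)
    show ?thesis
      unfolding eq Vh[symmetric] Phi_def by (intro suminf_mult summable_Phi_term)
  qed
  finally show ?thesis .
qed

definition kernel_value :: complex where
  "kernel_value = Q q * Q D * Q (q / D) * Q (b * c * q / D)
     * Q (a * c * q / D) * Q (a * b * q / D)
     / (Q a * Q b * Q c
        * Q (a * q / D) * Q (b * q / D) * Q (c * q / D))"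

text \<open>The factor \<open>(bcq/D;q)\<^sub>j\<close> is kept on the left since it may vanish.\<close>

lemma jackson_kernel_shifted:
  "P (b * c * q / D) j * jackson (kernel a (b * q ^ j) c)
     = kernel_value * P b j * P (b * q / D) j / P (a * b * q / D) j"
proof -
  have s: "Q (b * c * q / D) = P (b * c * q / D) j * Q (b * q ^ j * c * q / D)"
    "Q (a * b * q / D) = P (a * b * q / D) j * Q (a * (b * q ^ j) * q / D)"
    "Q b = P b j * Q (b * q ^ j)"
    "Q (b * q / D) = P (b * q / D) j * Q (b * q ^ j * q / D)"
    using qpoch_inf_split[of "b * c * q / D" j] qpoch_inf_split[of "a * b * q / D" j]
      qpoch_inf_split[of b j] qpoch_inf_split[of "b * q / D" j] by (simp_all add: mult_ac)
  have nz: "P (a * b * q / D) j \<noteq> 0" "P b j \<noteq> 0" "P (b * q / D) j \<noteq> 0"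
    using den(1) adm(2) unfolding admissible_def s by auto
  show ?thesis
    unfolding nonterminating_saalschuetz[OF adm(1) admissible_shift[OF adm(2)] adm(3)] kernel_value_def s
    using nz by (simp add: mult_ac)
qed

lemma jackson_cmult: "jackson (\<lambda>x. k * g x) = k * jackson g" if "\<And>y. summable (\<lambda>n. g (y * q ^ n))"
  using jackson_linear[of g "\<lambda>_. 0" k 0] that by simp

lemma jackson_sum:
  assumes "finite I" "\<And>i y. i \<in> I \<Longrightarrow> summable (\<lambda>n. g i (y * q ^ n))"
  shows "jackson (\<lambda>x. \<Sum>i\<in>I. k i * g i x) = (\<Sum>i\<in>I. k i * jackson (g i))"
proof -
  have "qsum q y (\<lambda>x. \<Sum>i\<in>I. k i * g i x) = (\<Sum>i\<in>I. k i * qsum q y (g i))" for y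
    unfolding qsum_def
    by (intro sums_unique[symmetric] sums_sum sums_mult summable_sums assms(2))
  then show ?thesis
    by (simp add: jackson_def sum_subtractf right_diff_distrib)
qed

text \<open>After integration the sum over \<open>j\<close> is again the right-hand side of \<open>terminating_transformation\<close>, with
  \<open>A = a\<close>, \<open>B = b\<close> and \<open>w = b q / D\<close>; its left-hand side is the sum over \<open>k\<close> that \<open>q_binomial_rearrangement\<close> produces from
  the \<open>\<^sub>3\<phi>\<^sub>2\<close> on the right of the theorem.\<close>

lemma jackson_layer:
  "jackson (layer N) = kernel_value * (P e N * (\<Sum>k\<le>N. (P a k * P b k / (P q k * P (a * b * q / D) k))
      * (z * q / D) ^ k * z ^ (N - k) / P q (N - k)))"
proof -
  let ?P = "P q" and ?W = "P (a * b * q / D)"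
  have Wnz: "?W n \<noteq> 0" for n using den(1) qpoch_inf_nz_iff by blast
  have split: "?W N = ?W k * P (a * (b * q / D) * q ^ k) (N - k)" if "k \<le> N" for k
    using qpoch_add[of q "a * b * q / D" k "N - k"] that by (simp add: mult_ac)
  have "jackson (layer N) = P e N * (z / b) ^ N * jackson (\<lambda>x. \<Sum>j\<le>N. gauss_coeff N j * P (b * c * q / D) j
      / (?P j * ?P (N - j)) * kernel a (b * q ^ j) c x)"
    unfolding layer_def by (intro jackson_cmult summable_sum summable_mult summable_kernel)
  also have "jackson (\<lambda>x. \<Sum>j\<le>N. gauss_coeff N j * P (b * c * q / D) j / (?P j * ?P (N - j)) * kernel a (b * q ^ j) c x)
     = (\<Sum>j\<le>N. gauss_coeff N j * P (b * c * q / D) j / (?P j * ?P (N - j)) * jackson (kernel a (b * q ^ j) c))"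
    by (intro jackson_sum summable_kernel) auto
  also have "\<dots> = kernel_value / ?W N * (\<Sum>j\<le>N. gauss_coeff N j * P (b * q / D) j * P b j * P (a * (b * q / D) * q ^ j) (N - j)
       / (?P j * ?P (N - j)))"
    unfolding sum_distrib_left
  proof (intro sum.cong refl)
    fix j assume j: "j \<in> {..N}"
    have "gauss_coeff N j * P (b * c * q / D) j / (?P j * ?P (N - j)) * jackson (kernel a (b * q ^ j) c)
      = gauss_coeff N j / (?P j * ?P (N - j)) * (P (b * c * q / D) j * jackson (kernel a (b * q ^ j) c))"
      by simp
    also have "\<dots> = gauss_coeff N j / (?P j * ?P (N - j)) * (kernel_value * P b j * P (b * q / D) j / ?W j)"
      unfolding jackson_kernel_shifted ..
    also have "1 / ?W j = P (a * (b * q / D) * q ^ j) (N - j) / ?W N"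
      using split[of j] j Wnz[of j] Wnz[of N] by (simp add: field_simps)
    then have "kernel_value * P b j * P (b * q / D) j / ?W j = kernel_value * P b j * P (b * q / D) j * (P (a * (b * q / D) * q ^ j) (N - j) / ?W N)"
      by (metis mult.right_neutral times_divide_eq_right)
    finally show "gauss_coeff N j * P (b * c * q / D) j / (?P j * ?P (N - j)) * jackson (kernel a (b * q ^ j) c)
       = kernel_value / ?W N * (gauss_coeff N j * P (b * q / D) j * P b j * P (a * (b * q / D) * q ^ j) (N - j) / (?P j * ?P (N - j)))"
      by (simp add: mult_ac)
  qed
  also have "\<dots> = kernel_value / ?W N * (\<Sum>k\<le>N. P a k * P b k * P (a * (b * q / D) * q ^ k) (N - k) * (b * q / D) ^ k * b ^ (N - k)
       / (?P k * ?P (N - k)))"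
    unfolding terminating_transformation ..
  also have "P e N * (z / b) ^ N * \<dots> = kernel_value * (P e N * (\<Sum>k\<le>N. (P a k * P b k / (?P k * ?W k))
      * (z * q / D) ^ k * z ^ (N - k) / ?P (N - k)))"
    unfolding sum_distrib_left
  proof (intro sum.cong refl)
    fix k assume k: "k \<in> {..N}"
    have "(z / b) ^ N = (z / b) ^ k * (z / b) ^ (N - k)" using k by (simp flip: power_add)
    then have pw: "(z / b) ^ N * ((b * q / D) ^ k * b ^ (N - k)) = (z * q / D) ^ k * z ^ (N - k)"
      using b_nz by (simp add: power_mult_distrib power_divide)
    have W: "P (a * (b * q / D) * q ^ k) (N - k) / ?W N = 1 / ?W k"
      using split[of k] k Wnz[of k] Wnz[of N] by (simp add: field_simps)
    have "P e N * (z / b) ^ N * (kernel_value / ?W N * (P a k * P b k * P (a * (b * q / D) * q ^ k) (N - k) * (b * q / D) ^ k * b ^ (N - k)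
       / (?P k * ?P (N - k))))
      = P e N * kernel_value * P a k * P b k / (?P k * ?P (N - k)) * (P (a * (b * q / D) * q ^ k) (N - k) / ?W N)
        * ((z / b) ^ N * ((b * q / D) ^ k * b ^ (N - k)))"
      by (simp only: times_divide_eq_right times_divide_eq_left divide_divide_eq_left mult_ac)
    also have "\<dots> = kernel_value * (P e N * (P a k * P b k / (?P k * ?W k) * (z * q / D) ^ k * z ^ (N - k) / ?P (N - k)))"
      unfolding pw W by (simp only: times_divide_eq_right times_divide_eq_left divide_divide_eq_left mult_ac mult_1_left mult_1_right)
    finally show "P e N * (z / b) ^ N * (kernel_value / ?W N * (P a k * P b k * P (a * (b * q / D) * q ^ k) (N - k) * (b * q / D) ^ k * b ^ (N - k)
       / (?P k * ?P (N - k)))) = kernel_value * (P e N * (P a k * P b k / (?P k * ?W k) * (z * q / D) ^ k * z ^ (N - k) / ?P (N - k)))" .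
  qed
  finally show ?thesis .
qed

text \<open>The layers are bounded by a geometric sequence in \<open>n\<close> times a summable sequence in \<open>N\<close>, the Cauchy product of two
  geometric series.\<close>

lemma layers_swap:
  assumes y: "y = 1 \<or> y = q / D"
  shows "(\<lambda>n. y * q ^ n * profile (y * q ^ n)) sums (\<Sum>N. qsum q y (layer N))"
    and "summable (\<lambda>N. qsum q y (layer N))"
proof -
  obtain K where K: "K \<ge> 0" "\<And>n k. norm (weight (y * q ^ n) k) \<le> K * norm q ^ n"
    using orbit_bounds[OF y] by blast
  obtain S where S: "S > 0" "\<And>n. norm (inverse (P q n)) \<le> S"
    by (rule qpoch_inverse_bounded[OF qpoch_inf_nz_small[OF q_lt_1]]) blast
  define A where "A = (\<lambda>n. K * norm q ^ n)"
  define B where "B = (\<lambda>N. exp (norm e / (1 - norm q)) * S * (\<Sum>k\<le>N. norm w ^ k * norm (z * y) ^ (N - k)))"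
  have sA: "summable A"
    unfolding A_def using q_lt_1 by (intro summable_mult summable_geometric) auto
  have sB: "summable B"
    unfolding B_def
    by (intro summable_mult summable_Cauchy_product) (use small orbit_small[OF y, of 0] in \<open>auto intro!: summable_geometric\<close>)
  have le: "norm (layer N (y * q ^ n)) \<le> A n * B N" for n N
  proof -
    let ?x = "y * q ^ n"
    have "norm (layer N ?x) = norm (P e N) * norm (\<Sum>k\<le>N. weight ?x k * w ^ k * (z * ?x) ^ (N - k) / P q (N - k))"
      by (subst layer_eq) (use admissible_orbit[OF adm(2) y] in \<open>auto simp: norm_mult\<close>)
    also have "\<dots> \<le> exp (norm e / (1 - norm q)) * (\<Sum>k\<le>N. (K * norm q ^ n) * norm w ^ k * norm (z * y) ^ (N - k) * S)"
    proof (intro mult_mono norm_qpoch_le sum_norm_le norm_ge_zero exp_ge_zero)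
      fix k
      have "norm (weight ?x k * w ^ k * (z * ?x) ^ (N - k) / P q (N - k))
        = norm (weight ?x k) * norm w ^ k * norm (z * ?x) ^ (N - k) * norm (inverse (P q (N - k)))"
        by (simp add: norm_mult norm_power divide_inverse)
      also have "\<dots> \<le> (K * norm q ^ n) * norm w ^ k * norm (z * y) ^ (N - k) * S"
        by (intro mult_mono mult_nonneg_nonneg K S zero_le_power power_mono norm_ge_zero order.refl
            conjunct1[OF orbit_small[OF y]] less_imp_le[OF S(1)])
      finally show "norm (weight ?x k * w ^ k * (z * ?x) ^ (N - k) / P q (N - k))
         \<le> (K * norm q ^ n) * norm w ^ k * norm (z * y) ^ (N - k) * S" .
    qed
    also have "\<dots> = A n * B N"
      unfolding A_def B_def sum_distrib_left by (intro sum.cong refl) (simp only: mult_ac)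
    finally show ?thesis .
  qed
  have nonneg: "0 \<le> A n" "0 \<le> B n" for n
    unfolding A_def B_def using K(1) S(1) by (auto intro!: mult_nonneg_nonneg sum_nonneg)
  have "(\<Sum>N. layer N (y * q ^ n)) = y * q ^ n * profile (y * q ^ n)" for n
    using profile_eq_layers[OF y, of n] by (simp add: sums_iff)
  then show "(\<lambda>n. y * q ^ n * profile (y * q ^ n)) sums (\<Sum>N. qsum q y (layer N))"
    and "summable (\<lambda>N. qsum q y (layer N))"
    using suminf_swap[where f = "\<lambda>n N. layer N (y * q ^ n)", OF sA sB le nonneg] by (simp_all add: qsum_def)
qed

theorem jackson_evaluation:
  shows "jackson (\<lambda>x. x * profile x) =
    kernel_value * (Q (e * z) / Q z) * phi32 q a b e (e * z) (a * b * q / D) (z * q / D)"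
proof -
  define \<alpha> where "\<alpha> = (\<lambda>k. P a k * P b k / (P q k * P (a * b * q / D) k))"
  have "\<exists>K. \<forall>k. norm (\<alpha> k) \<le> K"
  proof -
    obtain S where S: "S > 0" "\<And>n. norm (inverse (P q n)) \<le> S"
      by (rule qpoch_inverse_bounded[OF qpoch_inf_nz_small[OF q_lt_1]]) blast
    obtain T where T: "T > 0" "\<And>n. norm (inverse (P (a * b * q / D) n)) \<le> T"
      by (rule qpoch_inverse_bounded[OF den(1)]) blast
    have "norm (\<alpha> k) \<le> exp (norm a / (1 - norm q)) * exp (norm b / (1 - norm q)) * S * T" for k
    proof -
      have "norm (\<alpha> k) = norm (P a k) * norm (P b k) * norm (inverse (P q k)) * norm (inverse (P (a * b * q / D) k))"
        unfolding \<alpha>_def by (simp add: divide_inverse norm_mult)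
      also have "\<dots> \<le> exp (norm a / (1 - norm q)) * exp (norm b / (1 - norm q)) * S * T"
        by (intro mult_mono mult_nonneg_nonneg norm_qpoch_le S T norm_ge_zero exp_ge_zero less_imp_le[OF S(1)])
      finally show ?thesis .
    qed
    then show ?thesis by blast
  qed
  then obtain K where K: "\<And>k. norm (\<alpha> k) \<le> K" by blast
  have "jackson (\<lambda>x. x * profile x) = (\<Sum>N. qsum q 1 (layer N)) - (\<Sum>N. qsum q (q / D) (layer N))"
    using layers_swap(1)[of 1] layers_swap(1)[of "q / D"] by (auto simp: jackson_def qsum_def sums_iff)
  also have "\<dots> = (\<Sum>N. jackson (layer N))"
    unfolding jackson_def by (intro suminf_diff layers_swap) auto
  also have "(\<lambda>N. jackson (layer N)) sums (kernel_value * (\<Sum>k. P e k * \<alpha> k * (z * q / D) ^ k * (Q (e * z * q ^ k) / Q z)))"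
    unfolding jackson_layer using q_binomial_rearrangement[OF small(1,2) K] unfolding \<alpha>_def by (rule sums_mult)
  then have "(\<Sum>N. jackson (layer N)) = kernel_value * (\<Sum>k. P e k * \<alpha> k * (z * q / D) ^ k * (Q (e * z * q ^ k) / Q z))"
    by (simp add: sums_iff)
  also have "(\<lambda>k. P e k * \<alpha> k * (z * q / D) ^ k * (Q (e * z * q ^ k) / Q z))
    = (\<lambda>k. (Q (e * z) / Q z) * (qpochs q [a, b, e] k / qpochs q [q, e * z, a * b * q / D] k * (z * q / D) ^ k))"
  proof
    fix k
    have "P (e * z) k \<noteq> 0" using den(2) qpoch_inf_nz_iff by blast
    then have "Q (e * z * q ^ k) = Q (e * z) / P (e * z) k"
      using qpoch_inf_split[of "e * z" k] by simp
    then show "P e k * \<alpha> k * (z * q / D) ^ k * (Q (e * z * q ^ k) / Q z)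
      = (Q (e * z) / Q z) * (qpochs q [a, b, e] k / qpochs q [q, e * z, a * b * q / D] k * (z * q / D) ^ k)"
      by (simp add: \<alpha>_def qpochs_def mult_ac)
  qed
  also have "(\<Sum>k. (Q (e * z) / Q z) * (qpochs q [a, b, e] k / qpochs q [q, e * z, a * b * q / D] k * (z * q / D) ^ k))
     = (Q (e * z) / Q z) * phi32 q a b e (e * z) (a * b * q / D) (z * q / D)"
  proof -
    obtain T where T: "T > 0" "\<And>n. norm (inverse (P (e * z) n)) \<le> T"
      by (rule qpoch_inverse_bounded[OF den(2)]) blast
    have K0: "0 \<le> K" using K[of 0] norm_ge_zero order_trans by blast
    have "summable (\<lambda>k. qpochs q [a, b, e] k / qpochs q [q, e * z, a * b * q / D] k * (z * q / D) ^ k)"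
    proof (rule summable_comparison_test')
      show "summable (\<lambda>k. exp (norm e / (1 - norm q)) * K * T * norm (z * q / D) ^ k)"
        by (intro summable_mult summable_geometric) (use small in auto)
      show "norm (qpochs q [a, b, e] k / qpochs q [q, e * z, a * b * q / D] k * (z * q / D) ^ k)
        \<le> exp (norm e / (1 - norm q)) * K * T * norm (z * q / D) ^ k" for k
      proof -
        have "qpochs q [a, b, e] k / qpochs q [q, e * z, a * b * q / D] k * (z * q / D) ^ k
          = P e k * \<alpha> k * inverse (P (e * z) k) * (z * q / D) ^ k"
          by (simp add: \<alpha>_def qpochs_def divide_inverse mult_ac)
        then have "norm (qpochs q [a, b, e] k / qpochs q [q, e * z, a * b * q / D] k * (z * q / D) ^ k)
          = norm (P e k) * norm (\<alpha> k) * norm (inverse (P (e * z) k)) * norm (z * q / D) ^ k"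
          by (simp only: norm_mult norm_power)
        also have "\<dots> \<le> exp (norm e / (1 - norm q)) * K * T * norm (z * q / D) ^ k"
          by (intro mult_mono mult_nonneg_nonneg norm_qpoch_le T K K0 norm_ge_zero exp_ge_zero order.refl zero_le_power less_imp_le[OF T(1)])
        finally show ?thesis .
      qed
    qed
    then show ?thesis unfolding phi32_def by (rule suminf_mult)
  qed
  finally show ?thesis by (simp only: mult.assoc)
qed

end

section \<open>The two sides of a vertical contour\<close>

locale vertical_contour =
  fixes \<gamma> :: "real \<Rightarrow> complex" and T \<sigma> \<tau> :: real
  assumes inj: "inj \<gamma>" and pw: "\<gamma> piecewise_C1_differentiable_on UNIV"
    and T_pos: "0 < T"
    and upper: "\<And>t. t \<ge> T \<Longrightarrow> \<gamma> t = Complex \<sigma> t"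
    and lower: "\<And>t. t \<ge> T \<Longrightarrow> \<gamma> (- t) = Complex \<tau> (- t)"
begin

lemma continuous_on_contour: "continuous_on S \<gamma>"
  using pw continuous_on_subset unfolding piecewise_C1_differentiable_on_def by blast

lemma lower': "t \<le> - T \<Longrightarrow> \<gamma> t = Complex \<tau> t"
  using lower[of "- t"] by simp

lemma middle_bounded: "\<exists>B. \<forall>t\<in>{- T..T}. norm (\<gamma> t) \<le> B"
proof -
  have "bounded (\<gamma> ` {- T..T})"
    by (intro compact_imp_bounded compact_continuous_image continuous_on_contour) auto
  then show ?thesis unfolding bounded_iff by auto
qed

text \<open>Outside the strip \<open>\<bar>Im s\<bar> \<le> box_bound\<close> the contour consists of its two vertical ends, and it stays within
  \<open>\<bar>Re s\<bar> \<le> box_bound\<close> throughout.\<close>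

definition box_bound :: real where
  "box_bound = (SOME B. B \<ge> T \<and> B \<ge> \<bar>\<sigma>\<bar> \<and> B \<ge> \<bar>\<tau>\<bar> \<and> (\<forall>t\<in>{- T..T}. norm (\<gamma> t) \<le> B))"

lemma box_bound: "box_bound \<ge> T" "box_bound \<ge> \<bar>\<sigma>\<bar>" "box_bound \<ge> \<bar>\<tau>\<bar>"
  "t \<in> {- T..T} \<Longrightarrow> norm (\<gamma> t) \<le> box_bound"
proof -
  obtain B where B: "\<forall>t\<in>{- T..T}. norm (\<gamma> t) \<le> B" using middle_bounded by blast
  have "box_bound \<ge> T \<and> box_bound \<ge> \<bar>\<sigma>\<bar> \<and> box_bound \<ge> \<bar>\<tau>\<bar> \<and> (\<forall>t\<in>{- T..T}. norm (\<gamma> t) \<le> box_bound)"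
    unfolding box_bound_def
    by (rule someI[of _ "max B (max T (max \<bar>\<sigma>\<bar> \<bar>\<tau>\<bar>))"]) (use B in \<open>auto simp: le_max_iff_disj\<close>)
  then show "box_bound \<ge> T" "box_bound \<ge> \<bar>\<sigma>\<bar>" "box_bound \<ge> \<bar>\<tau>\<bar>"
    "t \<in> {- T..T} \<Longrightarrow> norm (\<gamma> t) \<le> box_bound" by blast+
qed

lemma contour_cases:
  obtains "t \<ge> T" "\<gamma> t = Complex \<sigma> t" | "t \<le> - T" "\<gamma> t = Complex \<tau> t"
    | "t \<in> {- T..T}" "norm (\<gamma> t) \<le> box_bound"
  using upper[of t] lower'[of t] box_bound(4)[of t] by (cases "t \<ge> T"; cases "t \<le> - T") auto

lemma Re_contour: "\<bar>Re (\<gamma> t)\<bar> \<le> box_bound"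
  by (rule contour_cases[of t]) (use box_bound(1-3) abs_Re_le_cmod[of "\<gamma> t"] in auto)

lemma high_contour: "\<bar>Im (\<gamma> t)\<bar> > box_bound \<Longrightarrow> Re (\<gamma> t) = (if Im (\<gamma> t) > 0 then \<sigma> else \<tau>)"
  by (rule contour_cases[of t]) (use box_bound(1-3) T_pos abs_Im_le_cmod[of "\<gamma> t"] in auto)

lemma Im_contour: "r \<ge> box_bound \<Longrightarrow> t \<in> {- r..r} \<Longrightarrow> \<bar>Im (\<gamma> t)\<bar> \<le> r"
  by (rule contour_cases[of t]) (use box_bound(1-3) T_pos abs_Im_le_cmod[of "\<gamma> t"] in auto)

lemma closed_contour: "closed (range \<gamma>)"
proof -
  have "range \<gamma> = \<gamma> ` {- T..T} \<union> {z. Re z = \<sigma> \<and> Im z \<ge> T} \<union> {z. Re z = \<tau> \<and> Im z \<le> - T}"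
  proof (intro equalityI subsetI)
    fix z assume "z \<in> range \<gamma>"
    then obtain t where "z = \<gamma> t" by blast
    then show "z \<in> \<gamma> ` {- T..T} \<union> {z. Re z = \<sigma> \<and> Im z \<ge> T} \<union> {z. Re z = \<tau> \<and> Im z \<le> - T}"
      by (cases rule: contour_cases[of t]) auto
  next
    fix z assume "z \<in> \<gamma> ` {- T..T} \<union> {z. Re z = \<sigma> \<and> Im z \<ge> T} \<union> {z. Re z = \<tau> \<and> Im z \<le> - T}"
    then consider "z \<in> \<gamma> ` {- T..T}" | "Re z = \<sigma>" "Im z \<ge> T" | "Re z = \<tau>" "Im z \<le> - T" by blast
    then show "z \<in> range \<gamma>"
    proof cases
      case 1
      then show ?thesis by blast
    next
      case 2
      then have "\<gamma> (Im z) = z" using upper[OF 2(2)] by (metis complex.collapse)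
      then show ?thesis by (metis rangeI)
    next
      case 3
      then have "\<gamma> (Im z) = z" using lower'[OF 3(2)] by (metis complex.collapse)
      then show ?thesis by (metis rangeI)
    qed
  qed
  moreover have "closed (\<gamma> ` {- T..T})"
    by (intro compact_imp_closed compact_continuous_image continuous_on_contour) auto
  moreover have "closed {z. Re z = \<sigma> \<and> Im z \<ge> T}" "closed {z. Re z = \<tau> \<and> Im z \<le> - T}"
    by (intro closed_Collect_conj closed_Collect_eq closed_Collect_le continuous_intros)+
  ultimately show ?thesis by auto
qed

definition piece :: "real \<Rightarrow> real \<Rightarrow> complex" where
  "piece r = \<gamma> \<circ> (\<lambda>u. (2 * r) *\<^sub>R u + - r)"

lemma piece_affine_image: "r > 0 \<Longrightarrow> (\<lambda>u. (2 * r) *\<^sub>R u + - r) ` {0..1} = {- r..r}"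
  using image_affinity_atLeastAtMost[of "2 * r" "- r" 0 1] by simp

lemma valid_path_piece [simp, intro]: "valid_path (piece r)"
  unfolding valid_path_def piece_def
  by (rule piecewise_C1_differentiable_affine, rule piecewise_C1_differentiable_on_subset[OF pw]) auto

lemma path_image_piece: "r > 0 \<Longrightarrow> path_image (piece r) = \<gamma> ` {- r..r}"
proof -
  assume "r > 0"
  have "path_image (piece r) = \<gamma> ` ((\<lambda>u. (2 * r) *\<^sub>R u + - r) ` {0..1})"
    unfolding path_image_def piece_def by (rule image_comp[symmetric])
  also have "\<dots> = \<gamma> ` {- r..r}"
    by (simp only: piece_affine_image[OF \<open>r > 0\<close>])
  finally show ?thesis .
qed

lemma piece_ends [simp]: "pathstart (piece r) = \<gamma> (- r)" "pathfinish (piece r) = \<gamma> r"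
  by (simp_all add: pathstart_def pathfinish_def piece_def)

lemma has_contour_integral_piece:
  assumes r: "r > 0" and f: "(f has_contour_integral i) (piece r)"
  shows "((\<lambda>t. f (\<gamma> t) * vector_derivative \<gamma> (at t)) has_integral i) {- r..r}"
proof -
  obtain S where S: "finite S" "\<gamma> C1_differentiable_on UNIV - S"
    using pw unfolding piecewise_C1_differentiable_on_def by blast
  have "((\<lambda>u. f (piece r u) * vector_derivative (piece r) (at u)) has_integral i) (cbox 0 1)"
    using f unfolding has_contour_integral by simp
  from has_integral_affinity'[OF this, of "1 / (2 * r)" "1 / 2"] r
  have aff: "((\<lambda>t. f (piece r ((1 / (2 * r)) *\<^sub>R t + 1 / 2)) * vector_derivative (piece r) (at ((1 / (2 * r)) *\<^sub>R t + 1 / 2)))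
      has_integral i /\<^sub>R (1 / (2 * r)) ^ DIM(real)) (cbox ((0 - 1 / 2) /\<^sub>R (1 / (2 * r))) ((1 - 1 / 2) /\<^sub>R (1 / (2 * r))))"
    by simp
  have "(0 - 1 / 2) /\<^sub>R (1 / (2 * r)) = - r" "(1 - 1 / 2) /\<^sub>R (1 / (2 * r)) = r"
    "i /\<^sub>R (1 / (2 * r)) ^ DIM(real) = (2 * r) *\<^sub>R i" "(1 / (2 * r)) *\<^sub>R t + 1 / 2 = t / (2 * r) + 1 / 2" for t
    by simp_all
  with aff have I: "((\<lambda>t. f (piece r (t / (2 * r) + 1 / 2)) * vector_derivative (piece r) (at (t / (2 * r) + 1 / 2)))
      has_integral (2 * r) *\<^sub>R i) {- r..r}"
    by (simp only: box_real)
  have E: "f (piece r (t / (2 * r) + 1 / 2)) * vector_derivative (piece r) (at (t / (2 * r) + 1 / 2))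
      = (2 * r) *\<^sub>R (f (\<gamma> t) * vector_derivative \<gamma> (at t))" if "t \<notin> S" for t
  proof -
    let ?u = "t / (2 * r) + 1 / 2"
    have u: "(2 * r) *\<^sub>R ?u + - r = t" using r by (simp add: field_simps)
    have "\<gamma> differentiable at t"
      using S(2) that by (auto simp: C1_differentiable_on_eq)
    moreover have "((\<lambda>u. (2 * r) *\<^sub>R u + - r) has_vector_derivative 2 * r) (at ?u)"
      unfolding has_real_derivative_iff_has_vector_derivative[symmetric]
      by (auto intro!: derivative_eq_intros)
    ultimately have "(piece r has_vector_derivative (2 * r) *\<^sub>R vector_derivative \<gamma> (at t)) (at ?u)"
      unfolding piece_def
      by (intro vector_diff_chain_at) (simp_all only: u vector_derivative_works)
    then have "vector_derivative (piece r) (at ?u) = (2 * r) *\<^sub>R vector_derivative \<gamma> (at t)"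
      by (rule vector_derivative_at)
    moreover have "piece r ?u = \<gamma> t" by (simp only: piece_def o_def u)
    ultimately show ?thesis
      by (simp only: mult_scaleR_right)
  qed
  have "((\<lambda>t. (2 * r) *\<^sub>R (f (\<gamma> t) * vector_derivative \<gamma> (at t))) has_integral (2 * r) *\<^sub>R i) {- r..r}"
    by (rule has_integral_spike_finite[OF S(1) _ I], rule E[symmetric]) blast
  then show ?thesis using r by (simp add: has_integral_cmul_iff)
qed

definition closing :: "real \<Rightarrow> real \<Rightarrow> real \<Rightarrow> complex" where
  "closing r x = linepath (\<gamma> r) (Complex x r) +++ linepath (Complex x r) (Complex x (- r))
      +++ linepath (Complex x (- r)) (\<gamma> (- r))"

definition loop :: "real \<Rightarrow> real \<Rightarrow> real \<Rightarrow> complex" where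
  "loop r x = piece r +++ closing r x"

lemma closing_ends [simp]: "pathstart (closing r x) = \<gamma> r" "pathfinish (closing r x) = \<gamma> (- r)"
  by (simp_all add: closing_def)

lemma valid_path_closing [simp, intro]: "valid_path (closing r x)"
  by (simp add: closing_def)

lemma valid_path_loop [simp, intro]: "valid_path (loop r x)"
  by (auto simp: loop_def intro!: valid_path_join)

lemma loop_ends [simp]: "pathstart (loop r x) = \<gamma> (- r)" "pathfinish (loop r x) = \<gamma> (- r)"
  by (simp_all add: loop_def)

lemma path_loop [simp, intro]: "path (loop r x)"
  by (rule valid_path_imp_path) auto

lemma path_image_closing:
  assumes "r \<ge> T"
  shows "path_image (closing r x) = {z. Im z = r \<and> Re z \<in> closed_segment \<sigma> x}
    \<union> {z. Re z = x \<and> \<bar>Im z\<bar> \<le> r} \<union> {z. Im z = - r \<and> Re z \<in> closed_segment \<tau> x}"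
proof -
  have h: "closed_segment (Complex u v) (Complex u' v) = {z. Im z = v \<and> Re z \<in> closed_segment u u'}" for u u' v
    by (subst closed_segment_same_Im) auto
  have v: "closed_segment (Complex u v) (Complex u v') = {z. Re z = u \<and> Im z \<in> closed_segment v v'}" for u v v'
    by (subst closed_segment_same_Re) auto
  have "closed_segment r (- r) = {- r..r}"
    using assms T_pos by (auto simp: closed_segment_eq_real_ivl)
  then show ?thesis
    unfolding closing_def using assms
    by (auto simp: path_image_join upper lower h v closed_segment_commute[of x])
qed

lemma path_image_loop: "r \<ge> T \<Longrightarrow> path_image (loop r x) = \<gamma> ` {- r..r} \<union> path_image (closing r x)"
  unfolding loop_def using T_pos by (subst path_image_join) (auto simp: path_image_piece)

lemma path_image_loop_Re_le:
  assumes "r \<ge> T" "x \<ge> box_bound" "w \<in> path_image (loop r x)"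
  shows "- box_bound \<le> Re w" "Re w \<le> x"
proof -
  consider t where "w = \<gamma> t" | "Re w \<in> closed_segment \<sigma> x" | "Re w = x" | "Re w \<in> closed_segment \<tau> x"
    using assms(3) unfolding path_image_loop[OF assms(1)] path_image_closing[OF assms(1)] by blast
  then have "- box_bound \<le> Re w \<and> Re w \<le> x"
  proof cases
    case (1 t)
    then show ?thesis using Re_contour[of t] assms(2) by (simp add: abs_le_iff)
  next
    case 2
    then show ?thesis using box_bound(2) assms(2) by (auto simp: closed_segment_eq_real_ivl split: if_splits)
  next
    case 3
    then show ?thesis using box_bound(2) assms(2) by auto
  next
    case 4
    then show ?thesis using box_bound(3) assms(2) by (auto simp: closed_segment_eq_real_ivl split: if_splits)
  qed
  then show "- box_bound \<le> Re w" "Re w \<le> x" by auto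
qed

lemma path_image_loop_Im:
  assumes "r \<ge> box_bound" "w \<in> path_image (loop r x)"
  shows "\<bar>Im w\<bar> \<le> r"
proof -
  have rT: "r \<ge> T" using assms(1) box_bound(1) by linarith
  show ?thesis
    using assms(2) Im_contour[OF assms(1)] rT T_pos
    unfolding path_image_loop[OF rT] path_image_closing[OF rT] by auto
qed

lemma winding_outside:
  assumes r: "r \<ge> box_bound" "x \<ge> box_bound"
    and z: "Re z < - box_bound \<or> Re z > x \<or> \<bar>Im z\<bar> > r"
  shows "winding_number (loop r x) z = 0"
proof -
  have rT: "r \<ge> T" using r(1) box_bound(1) by linarith
  have "convex ({w. - box_bound \<le> Re w} \<inter> {w. Re w \<le> x} \<inter> {w. Im w \<le> r} \<inter> {w. - r \<le> Im w})"
    by (intro convex_Int convex_halfspace_Re_le convex_halfspace_Re_ge convex_halfspace_Im_le convex_halfspace_Im_ge)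
  moreover have "path_image (loop r x) \<subseteq> {w. - box_bound \<le> Re w} \<inter> {w. Re w \<le> x} \<inter> {w. Im w \<le> r} \<inter> {w. - r \<le> Im w}"
    using path_image_loop_Re_le[OF rT r(2)] path_image_loop_Im[OF r(1)] by (fastforce simp: abs_le_iff)
  ultimately show ?thesis
    by (intro winding_number_zero_outside[OF path_loop _ _ _ _]) (use z in auto)
qed

text \<open>Left of \<open>z\<close> the piece of the contour may be replaced by three sides of a rectangle on the left, since together they
  form a loop in a half-plane that does not contain \<open>z\<close>. What remains is the boundary of a rectangle, traversed clockwise.\<close>

lemma winding_right:
  assumes r: "r \<ge> T" and z: "box_bound < Re z" "Re z < x" "\<bar>Im z\<bar> < r"
  shows "winding_number (loop r x) z = - 1"
proof -
  define f where "f = (\<lambda>w. 1 / (w - z))"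
  define L where "L = - box_bound - 1"
  have rpos: "r > 0" using r T_pos by linarith
  have bpos: "box_bound > 0" using box_bound(1) T_pos by linarith
  have fint: "f contour_integrable_on p" if "valid_path p" "z \<notin> path_image p" for p
    unfolding f_def using that by (intro contour_integrable_inversediff)
  have fl: "f contour_integrable_on linepath u v" if "z \<notin> closed_segment u v" for u v
    by (rule fint) (use that in auto)
  have fc: "continuous_on S f" if "z \<notin> S" for S
    unfolding f_def using that by (intro continuous_intros) auto
  have h: "closed_segment (Complex u v) (Complex u' v) = {z. Im z = v \<and> Re z \<in> closed_segment u u'}" for u u' v
    by (subst closed_segment_same_Im) auto
  have v: "closed_segment (Complex u v) (Complex u v') = {z. Re z = u \<and> Im z \<in> closed_segment v v'}" for u v v'
    by (subst closed_segment_same_Re) auto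
  let ?top = "\<gamma> r" and ?bot = "\<gamma> (- r)"
  have top: "?top = Complex \<sigma> r" and bot: "?bot = Complex \<tau> (- r)"
    using upper[of r] lower[of r] r by auto
  \<comment> \<open>The horizontal sides of the large rectangle are split at the ends of the contour; the parts left of it belong to
    \<open>left\<close>, the parts right of it to the closing path.\<close>
  define left where "left = linepath ?top (Complex L r) +++ linepath (Complex L r) (Complex L (- r))
      +++ linepath (Complex L (- r)) ?bot"
  have piece_img: "path_image (piece r) \<subseteq> {w. Re w \<le> box_bound}"
    using Re_contour unfolding path_image_piece[OF rpos] by (auto simp: abs_le_iff)
  have left_img: "path_image left \<subseteq> {w. Re w \<le> box_bound}"
    unfolding left_def using box_bound bpos
    by (auto simp: path_image_join top bot h v closed_segment_eq_real_ivl L_def split: if_splits)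
  have valid: "valid_path left" "valid_path (piece r)" unfolding left_def by auto
  have ends: "pathstart left = ?top" "pathfinish left = ?bot" unfolding left_def by auto
  have "path_image (piece r +++ left) \<subseteq> {w. Re w \<le> box_bound}"
    using piece_img left_img by (subst path_image_join) (auto simp: ends)
  then have "winding_number (piece r +++ left) z = 0"
    by (intro winding_number_zero_outside[OF _ convex_halfspace_Re_le])
      (use valid z in \<open>auto simp: ends intro!: valid_path_imp_path valid_path_join\<close>)
  moreover have nz: "z \<notin> path_image (piece r)" "z \<notin> path_image left" using piece_img left_img z by auto
  ultimately have "contour_integral (piece r +++ left) f = 0"
    using winding_number_valid_path[of "piece r +++ left" z] valid
    by (auto simp: f_def ends path_image_join intro!: valid_path_join)
  then have P: "contour_integral (piece r) f = - contour_integral left f"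
    using valid nz by (subst (asm) contour_integral_join) (auto intro!: fint simp: ends add_eq_0_iff2)
  have notin: "z \<notin> closed_segment ?top (Complex L r)" "z \<notin> closed_segment (Complex L r) (Complex L (- r))"
    "z \<notin> closed_segment (Complex L (- r)) ?bot" "z \<notin> closed_segment ?top (Complex x r)"
    "z \<notin> closed_segment (Complex x r) (Complex x (- r))" "z \<notin> closed_segment (Complex x (- r)) ?bot"
    "z \<notin> closed_segment (Complex L (- r)) (Complex x (- r))" "z \<notin> closed_segment (Complex x (- r)) (Complex x r)"
    "z \<notin> closed_segment (Complex x r) (Complex L r)" "z \<notin> closed_segment (Complex L r) (Complex x r)"
    using z rpos bpos by (auto simp: top bot h v L_def)
  define m1 m2 m3 l1 l2 l3 where "m1 = contour_integral (linepath ?top (Complex L r)) f"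
    and "m2 = contour_integral (linepath (Complex L r) (Complex L (- r))) f"
    and "m3 = contour_integral (linepath (Complex L (- r)) ?bot) f"
    and "l1 = contour_integral (linepath ?top (Complex x r)) f"
    and "l2 = contour_integral (linepath (Complex x r) (Complex x (- r))) f"
    and "l3 = contour_integral (linepath (Complex x (- r)) ?bot) f"
  have left: "contour_integral left f = m1 + m2 + m3"
    unfolding left_def m1_def m2_def m3_def
    by (subst contour_integral_join; (subst contour_integral_join)?)
      (auto intro!: fl contour_integrable_joinI notin simp: valid_path_join)
  have clos: "contour_integral (closing r x) f = l1 + l2 + l3"
    unfolding closing_def l1_def l2_def l3_def
    by (subst contour_integral_join; (subst contour_integral_join)?)
      (auto intro!: fl contour_integrable_joinI notin simp: valid_path_join)
  have seg: "?top \<in> closed_segment (Complex x r) (Complex L r)" "?bot \<in> closed_segment (Complex L (- r)) (Complex x (- r))"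
    using box_bound z by (auto simp: top bot h L_def closed_segment_eq_real_ivl)
  have bottom: "contour_integral (linepath (Complex L (- r)) (Complex x (- r))) f = m3 - l3"
    unfolding m3_def l3_def
    using contour_integral_split_linepath[OF fc[OF notin(7)] seg(2)]
      contour_integral_reverse_linepath[OF fc[OF notin(6)]] by simp
  have topi: "contour_integral (linepath (Complex x r) (Complex L r)) f = m1 - l1"
    unfolding m1_def l1_def
    using contour_integral_split_linepath[OF fc[OF notin(9)] seg(1)]
      contour_integral_reverse_linepath[OF fc[OF notin(4)]] by simp
  have righti: "contour_integral (linepath (Complex x (- r)) (Complex x r)) f = - l2"
    unfolding l2_def using contour_integral_reverse_linepath[OF fc[OF notin(8)]] .
  let ?R = "rectpath (Complex L (- r)) (Complex x r)"
  have inbox: "z \<in> box (Complex L (- r)) (Complex x r)"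
    using z bpos by (auto simp: in_box_complex_iff L_def)
  have "contour_integral ?R f = (m3 - l3) + (- l2) + (m1 - l1) + m2"
    unfolding rectpath_def Let_def bottom[symmetric] topi[symmetric] righti[symmetric] m2_def
    by (simp add: contour_integral_join contour_integrable_joinI fl notin add.assoc)
  moreover have "winding_number ?R z = 1" by (rule winding_number_rectpath[OF inbox])
  moreover have "z \<notin> path_image ?R"
    using path_image_rectpath_inter_box[of "Complex L (- r)" "Complex x r"] inbox z rpos bpos
    by (auto simp: L_def)
  then have "winding_number ?R z = 1 / (2 * pi * \<i>) * contour_integral ?R f"
    unfolding f_def by (intro winding_number_valid_path) auto
  ultimately have rect: "(m3 - l3) + (- l2) + (m1 - l1) + m2 = 2 * pi * \<i>"
    by (simp add: field_simps)
  have nzc: "z \<notin> path_image (closing r x)"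
    using z unfolding path_image_closing[OF r] by auto
  have "contour_integral (loop r x) f = - (m1 + m2 + m3) + (l1 + l2 + l3)"
    unfolding loop_def using nz nzc P left clos by (subst contour_integral_join) (auto intro!: fint)
  also have "\<dots> = - (2 * pi * \<i>)"
    unfolding rect[symmetric] by simp
  finally have "contour_integral (loop r x) f = - (2 * pi * \<i>)" .
  moreover have "winding_number (loop r x) z = 1 / (2 * pi * \<i>) * contour_integral (loop r x) f"
    unfolding f_def
    by (intro winding_number_valid_path) (use nz nzc in \<open>auto simp: loop_def path_image_join\<close>)
  ultimately show ?thesis by simp
qed

text \<open>The horizontal ray from \<open>p\<close> to the left does not meet the loop: above the strip of \<open>box_bound\<close> the contour is the line
  \<open>Re s = \<sigma>\<close>, below it the line \<open>Re s = \<tau>\<close>. Unlike \<open>winding_left_side\<close> this covers infinitely many points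
  with one and the same loop.\<close>

lemma winding_far_left:
  assumes "r \<ge> box_bound" "x \<ge> box_bound" "box_bound < \<bar>Im p\<bar>" "Re p < (if Im p > 0 then \<sigma> else \<tau>)"
  shows "winding_number (loop r x) p = 0"
proof -
  let ?S = "{w. Im w = Im p} \<inter> {w. Re w \<le> Re p}"
  have rT: "r \<ge> T" using assms(1) box_bound(1) by linarith
  define u where "u = Complex (min (Re p) (- box_bound) - 1) (Im p)"
  have "winding_number (loop r x) p = winding_number (loop r x) u"
  proof (rule winding_number_eq[of _ _ ?S])
    have "convex ({w. Im w \<le> Im p} \<inter> {w. Im w \<ge> Im p} \<inter> {w. Re w \<le> Re p})"
      by (intro convex_Int convex_halfspace_Re_le convex_halfspace_Im_le convex_halfspace_Im_ge)
    also have "{w. Im w \<le> Im p} \<inter> {w. Im w \<ge> Im p} \<inter> {w. Re w \<le> Re p} = ?S" by auto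
    finally show "connected ?S" by (rule convex_connected)
    show "?S \<inter> path_image (loop r x) = {}"
    proof (rule ccontr)
      assume "?S \<inter> path_image (loop r x) \<noteq> {}"
      then obtain w where w: "Im w = Im p" "Re w \<le> Re p" "w \<in> path_image (loop r x)" by blast
      have "w \<notin> range \<gamma>"
      proof
        assume "w \<in> range \<gamma>"
        then obtain t where "w = \<gamma> t" by blast
        then show False
          using high_contour[of t] assms(3,4) w(1,2) by (auto split: if_splits)
      qed
      then show False
        using w assms box_bound unfolding path_image_loop[OF rT] path_image_closing[OF rT]
        by (auto simp: closed_segment_eq_real_ivl split: if_splits)
    qed
  qed (auto simp: u_def)
  also have "\<dots> = 0" by (rule winding_outside) (use assms in \<open>auto simp: u_def\<close>)
  finally show ?thesis .
qed

text \<open>The complement of the contour is open, so the two points are joined by a path in it. This path is compact, hence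
  disjoint from every sufficiently large rectangle.\<close>

lemma eventually_same_winding:
  assumes "connected_component (- range \<gamma>) p z"
  shows "\<exists>N. \<forall>r x. N \<le> r \<longrightarrow> N \<le> x \<longrightarrow> winding_number (loop r x) p = winding_number (loop r x) z"
proof -
  have "path_component (- range \<gamma>) p z"
    using assms open_path_connected_component[of "- range \<gamma>"] closed_contour by (simp add: open_Compl)
  then obtain g where g: "path g" "path_image g \<subseteq> - range \<gamma>" "pathstart g = p" "pathfinish g = z"
    unfolding path_component_def by blast
  obtain B where B: "\<And>w. w \<in> path_image g \<Longrightarrow> norm w \<le> B"
    using compact_imp_bounded[OF compact_path_image[OF g(1)]] unfolding bounded_iff by blast
  show ?thesis
  proof (intro exI allI impI)
    fix r x assume rx: "max T (B + 1) \<le> r" "max T (B + 1) \<le> x"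
    have rT: "r \<ge> T" using rx by simp
    show "winding_number (loop r x) p = winding_number (loop r x) z"
    proof (rule winding_number_eq[of _ _ "path_image g"])
      show "path_image g \<inter> path_image (loop r x) = {}"
      proof (rule ccontr)
        assume "path_image g \<inter> path_image (loop r x) \<noteq> {}"
        then obtain w where w: "w \<in> path_image g" "w \<in> path_image (loop r x)" by blast
        have "\<bar>Re w\<bar> \<le> B" "\<bar>Im w\<bar> \<le> B"
          using B[OF w(1)] abs_Re_le_cmod[of w] abs_Im_le_cmod[of w] by linarith+
        then show False
          using w g(2) rx unfolding path_image_loop[OF rT] path_image_closing[OF rT] by auto
      qed
    qed (use g in \<open>auto intro!: connected_path_image\<close>)
  qed
qed

lemma winding_left_side:
  assumes "p \<in> left_side \<gamma>"
  shows "\<exists>N. \<forall>r x. N \<le> r \<longrightarrow> N \<le> x \<longrightarrow> winding_number (loop r x) p = 0"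
proof -
  obtain y where y: "\<And>z. Re z < y \<Longrightarrow> connected_component (- range \<gamma>) p z"
    using assms unfolding left_side_def by blast
  define z where "z = Complex (min y (- box_bound) - 1) 0"
  have "connected_component (- range \<gamma>) p z" by (rule y) (simp add: z_def)
  then obtain N where N: "\<And>r x. N \<le> r \<Longrightarrow> N \<le> x \<Longrightarrow> winding_number (loop r x) p = winding_number (loop r x) z"
    using eventually_same_winding by blast
  have "winding_number (loop r x) z = 0" if "r \<ge> box_bound" "x \<ge> box_bound" for r x
    using that by (intro winding_outside) (auto simp: z_def)
  then show ?thesis using N by (intro exI[of _ "max N box_bound"]) auto
qed

lemma winding_right_side:
  assumes "p \<in> right_side \<gamma>"
  shows "\<exists>N. \<forall>r x. N \<le> r \<longrightarrow> N \<le> x \<longrightarrow> winding_number (loop r x) p = - 1"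
proof -
  obtain y where y: "\<And>z. Re z > y \<Longrightarrow> connected_component (- range \<gamma>) p z"
    using assms unfolding right_side_def by blast
  define z where "z = Complex (max y box_bound + 1) 0"
  have "connected_component (- range \<gamma>) p z" by (rule y) (simp add: z_def)
  then obtain N where N: "\<And>r x. N \<le> r \<Longrightarrow> N \<le> x \<Longrightarrow> winding_number (loop r x) p = winding_number (loop r x) z"
    using eventually_same_winding by blast
  have "winding_number (loop r x) z = - 1" if "r \<ge> T" "x > max y box_bound + 1" for r x
    using that T_pos by (intro winding_right) (auto simp: z_def)
  then show ?thesis using N by (intro exI[of _ "max (max N T) (max y box_bound + 2)"]) auto
qed

lemma sides_disjoint: "left_side \<gamma> \<inter> right_side \<gamma> = {}"
proof (rule ccontr)
  assume "left_side \<gamma> \<inter> right_side \<gamma> \<noteq> {}"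
  then obtain p where p: "p \<in> left_side \<gamma>" "p \<in> right_side \<gamma>" by blast
  obtain N M where "\<And>r x. N \<le> r \<Longrightarrow> N \<le> x \<Longrightarrow> winding_number (loop r x) p = 0"
    "\<And>r x. M \<le> r \<Longrightarrow> M \<le> x \<Longrightarrow> winding_number (loop r x) p = - 1"
    using winding_left_side[OF p(1)] winding_right_side[OF p(2)] by blast
  from this[of "max N M" "max N M"] show False by simp
qed

lemma left_side_not_range: "p \<in> left_side \<gamma> \<Longrightarrow> p \<notin> range \<gamma>"
proof -
  assume "p \<in> left_side \<gamma>"
  then obtain y where "\<And>z. Re z < y \<Longrightarrow> connected_component (- range \<gamma>) p z"
    unfolding left_side_def by blast
  from this[of "Complex (y - 1) 0"] show ?thesis using connected_component_in by fastforce
qed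

lemma right_side_not_range: "p \<in> right_side \<gamma> \<Longrightarrow> p \<notin> range \<gamma>"
proof -
  assume "p \<in> right_side \<gamma>"
  then obtain y where "\<And>z. Re z > y \<Longrightarrow> connected_component (- range \<gamma>) p z"
    unfolding right_side_def by blast
  from this[of "Complex (y + 1) 0"] show ?thesis using connected_component_in by fastforce
qed

text \<open>Otherwise a horizontal segment to the right would join \<open>p\<close> to the right side.\<close>

lemma high_left_side:
  assumes p: "p \<in> left_side \<gamma>" and high: "\<bar>Im p\<bar> > box_bound"
  shows "Re p < (if Im p > 0 then \<sigma> else \<tau>)"
proof (rule ccontr)
  let ?s = "if Im p > 0 then \<sigma> else \<tau>"
  assume "\<not> Re p < ?s"
  moreover have "Re p \<noteq> ?s"
  proof
    assume s: "Re p = ?s"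
    have "p = \<gamma> (Im p)"
      using upper[of "Im p"] lower'[of "Im p"] high box_bound(1) T_pos s
      by (cases "Im p > 0") (auto simp: complex_eq_iff)
    with left_side_not_range[OF p] show False by blast
  qed
  ultimately have gt: "Re p > ?s" by linarith
  have "p \<in> right_side \<gamma>"
    unfolding right_side_def mem_Collect_eq
  proof (intro exI allI impI)
    fix z assume z: "Re z > max (Re p) box_bound"
    define u where "u = Complex (Re z) (Im p)"
    have "closed_segment p u \<subseteq> - range \<gamma>"
    proof
      fix w assume "w \<in> closed_segment p u"
      then have w: "Im w = Im p" "Re w \<ge> Re p"
        using z by (auto simp: closed_segment_same_Im u_def closed_segment_eq_real_ivl split: if_splits)
      have "w \<noteq> \<gamma> t" for t
        using high_contour[of t] high gt w by (auto split: if_splits)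
      then show "w \<in> - range \<gamma>" by auto
    qed
    moreover have "closed_segment u z \<subseteq> - range \<gamma>"
    proof
      fix w assume "w \<in> closed_segment u z"
      then have "Re w = Re z"
        by (auto simp: closed_segment_same_Re u_def)
      then have "w \<noteq> \<gamma> t" for t
        using z Re_contour[of t] by auto
      then show "w \<in> - range \<gamma>" by auto
    qed
    ultimately have "connected_component (- range \<gamma>) p u" "connected_component (- range \<gamma>) u z"
      unfolding connected_component_def
      by (meson connected_segment ends_in_segment)+
    then show "connected_component (- range \<gamma>) p z"
      by (rule connected_component_trans)
  qed
  with p sides_disjoint show False by blast
qed

end

section \<open>Closing a contour to the right\<close>

lemma integrable_exp_minus_abs: "(\<lambda>t::real. exp (- \<bar>t\<bar>)) integrable_on UNIV"
proof -
  have "(\<lambda>t::real. exp (- 1 * t)) integrable_on {0..}"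
    by (rule integrable_on_exp_minus_to_infinity) simp
  then have pos: "(\<lambda>t::real. exp (- \<bar>t\<bar>)) integrable_on {0..}"
    by (rule integrable_eq) simp
  have abs: "(\<lambda>t::real. exp (- \<bar>t\<bar>)) absolutely_integrable_on {0..}"
    by (rule nonnegative_absolutely_integrable_1[OF pos]) simp
  have 1: "uminus ` {..0::real} \<subseteq> {0..}" "uminus ` {0::real..} \<subseteq> {..0}" by auto
  have 2: "{..0::real} \<in> sets lebesgue"
    using sets_completionI_sets[of "{..0::real}" lborel] by simp
  note has_absolute_integral_reflect_real[OF 1 2, where f = "\<lambda>t. exp (- \<bar>t\<bar>)" and b = "integral {0..} (\<lambda>t. exp (- \<bar>t\<bar>))"]
  then have "(\<lambda>t::real. exp (- \<bar>- t\<bar>)) absolutely_integrable_on {..0}" using abs by blast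
  then have neg: "(\<lambda>t::real. exp (- \<bar>t\<bar>)) integrable_on {..0}"
    unfolding abs_minus_cancel by (rule set_lebesgue_integral_eq_integral(1))
  have 3: "negligible ({..0} \<inter> {0::real..})"
    by (rule negligible_subset[of "{0}"]) auto
  have 4: "UNIV = {..0} \<union> {0::real..}" by auto
  show ?thesis by (rule integrable_Un'[OF neg pos 3 4])
qed

context vertical_contour begin

lemma vector_derivative_tails:
  assumes "\<bar>t\<bar> > T"
  shows "vector_derivative \<gamma> (at t) = \<i>"
proof (rule vector_derivative_at)
  let ?s = "if t > 0 then \<sigma> else \<tau>"
  have "((\<lambda>t. Complex ?s t) has_vector_derivative \<i>) (at t)"
  proof -
    have "Complex ?s = (\<lambda>t. of_real ?s + t *\<^sub>R \<i>)"
      by (auto simp: fun_eq_iff complex_eq_iff)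
    then show ?thesis
      by (auto intro!: derivative_eq_intros)
  qed
  moreover have "open (if t > 0 then {T<..} else {..<- T})" "t \<in> (if t > 0 then {T<..} else {..<- T})"
    using assms by auto
  moreover have "Complex ?s u = \<gamma> u" if "u \<in> (if t > 0 then {T<..} else {..<- T})" for u
    using that upper[of u] lower'[of u] by (cases "t > 0") auto
  ultimately show "(\<gamma> has_vector_derivative \<i>) (at t)"
    by (rule has_vector_derivative_transform_within_open)
qed

text \<open>The derivative of a piecewise \<open>C\<^sup>1\<close> curve may be unbounded near its exceptional points, so the integrand need not be
  absolutely integrable. Dominated convergence is therefore applied only to the two vertical tails, and the middle piece is
  split off.\<close>

lemma has_integral_limit:
  fixes f :: "complex \<Rightarrow> complex"
  assumes int: "\<And>n::nat. n > 0 \<Longrightarrow> f contour_integrable_on piece n"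
    and bound: "\<And>s. min \<sigma> \<tau> \<le> Re s \<Longrightarrow> Y \<le> \<bar>Im s\<bar> \<Longrightarrow> norm (f s) \<le> C * exp (- \<bar>Im s\<bar>)"
    and lim: "(\<lambda>n::nat. contour_integral (piece (real n)) f) \<longlonglongrightarrow> I"
  shows "((\<lambda>t. f (\<gamma> t) * vector_derivative \<gamma> (at t)) has_integral I) UNIV"
proof -
  define h where "h = (\<lambda>t. f (\<gamma> t) * vector_derivative \<gamma> (at t))"
  define J where "J = (\<lambda>n. contour_integral (piece (real n)) f)"
  have hJ: "(h has_integral J n) {- real n..real n}" if "n > 0" for n
    unfolding h_def J_def using that
    by (intro has_contour_integral_piece has_contour_integral_integral int) auto
  obtain m :: nat where m: "real m > max T Y" using reals_Archimedean2 by blast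
  have m0: "m > 0" using m T_pos by (cases m) auto
  define k where "k = (\<lambda>n t. (if t \<in> {- real (n + m)..real (n + m)} then h t else 0)
      - (if t \<in> {- real m..real m} then h t else 0))"
  define g where "g = (\<lambda>t. h t - (if t \<in> {- real m..real m} then h t else 0))"
  have hR: "((\<lambda>t. if t \<in> {- real n..real n} then h t else 0) has_integral J n) UNIV" if "n > 0" for n
    unfolding has_integral_restrict_UNIV by (rule hJ[OF that])
  have kint: "(k n has_integral (J (n + m) - J m)) UNIV" for n
    unfolding k_def by (rule has_integral_diff[OF hR hR]) (use m0 in auto)
  have le: "norm (k n t) \<le> C * exp (- \<bar>t\<bar>)" for n t
  proof -
    have C: "0 \<le> C * exp (- \<bar>t\<bar>)"
    proof -
      have "0 \<le> norm (f (Complex \<sigma> Y))" by simp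
      also have "\<dots> \<le> C * exp (- \<bar>Y\<bar>)" using bound[of "Complex \<sigma> Y"] by auto
      finally show ?thesis by (simp add: zero_le_mult_iff)
    qed
    show ?thesis
    proof (cases "\<bar>t\<bar> > real m")
      case True
      then have t: "\<gamma> t = Complex (if t > 0 then \<sigma> else \<tau>) t" "\<bar>t\<bar> > T" "\<bar>t\<bar> > Y"
        using m upper[of t] lower'[of t] by auto
      have "norm (h t) = norm (f (\<gamma> t))"
        unfolding h_def vector_derivative_tails[OF t(2)] by (simp add: norm_mult)
      also have "\<dots> \<le> C * exp (- \<bar>t\<bar>)"
        using bound[of "\<gamma> t"] t by auto
      finally have "norm (h t) \<le> C * exp (- \<bar>t\<bar>)" .
      then show ?thesis using C True by (auto simp: k_def)
    next
      case False
      then have "k n t = 0" by (auto simp: k_def abs_le_iff)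
      then show ?thesis using C by simp
    qed
  qed
  have conv: "(\<lambda>n. k n t) \<longlonglongrightarrow> g t" for t
  proof (rule tendsto_eventually)
    obtain N :: nat where "real N > \<bar>t\<bar>" using reals_Archimedean2 by blast
    then show "\<forall>\<^sub>F n in sequentially. k n t = g t"
      by (intro eventually_sequentiallyI[of N]) (auto simp: k_def g_def abs_less_iff)
  qed
  have limJ: "(\<lambda>n. J (n + m) - J m) \<longlonglongrightarrow> I - J m"
    by (rule tendsto_diff[OF LIMSEQ_ignore_initial_segment[OF lim[folded J_def]] tendsto_const])
  have "(g has_integral (I - J m)) UNIV"
  proof (rule has_integral_dominated_convergence[OF kint _ _ _ limJ])
    show "(\<lambda>t. C * exp (- \<bar>t\<bar>)) integrable_on UNIV"
      by (rule integrable_on_mult_right[OF integrable_exp_minus_abs])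
  qed (blast intro: le conv)+
  from has_integral_add[OF this hR[OF m0]]
  have "((\<lambda>t. g t + (if t \<in> {- real m..real m} then h t else 0)) has_integral (I - J m + J m)) UNIV" .
  moreover have "(\<lambda>t. g t + (if t \<in> {- real m..real m} then h t else 0)) = h" by (simp add: g_def)
  ultimately show ?thesis by (simp only: h_def diff_add_cancel)
qed

text \<open>The set \<open>R\<close> contains the poles to be collected; all other poles lie on the left side of the contour. The \<open>n\<close>-th loop reaches
  up to \<open>\<bar>Im s\<bar> = n\<close> and right to \<open>Re s = n + \<theta>\<close>, where \<open>\<theta>\<close> is chosen so that the vertical side meets no point
  of \<open>R\<close>. Coupling height and width makes both the long horizontal sides and the long vertical side negligible.

  A single loop has to have the right winding number about all poles inside it, while \<open>winding_left_side\<close> and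
  \<open>winding_right_side\<close> give a bound on its size that depends on the pole. They are needed only for
  the finitely many poles in a bounded region; elsewhere \<open>winding_right\<close>, \<open>winding_far_left\<close> and \<open>winding_outside\<close> apply
  uniformly.\<close>

theorem close_to_the_right:
  fixes f :: "complex \<Rightarrow> complex" and R :: "complex set"
  assumes nm: "f nicely_meromorphic_on UNIV"
    and R_fin: "\<And>r. finite {p \<in> R. Re p \<le> r}"
    and R_im: "\<And>p. p \<in> R \<Longrightarrow> \<bar>Im p\<bar> \<le> M"
    and R_off: "\<And>p n. p \<in> R \<Longrightarrow> Re p \<noteq> real n + \<theta>" and \<theta>: "0 \<le> \<theta>"
    and poles: "\<And>p. is_pole f p \<Longrightarrow> if p \<in> R then p \<in> right_side \<gamma> else p \<in> left_side \<gamma> \<and> Re p \<le> W"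
    and hor: "\<And>s. min \<sigma> \<tau> \<le> Re s \<Longrightarrow> Y \<le> \<bar>Im s\<bar> \<Longrightarrow> norm (f s) \<le> C * exp (- \<bar>Im s\<bar>)"
    and ver: "\<And>n s. n \<ge> n0 \<Longrightarrow> Re s = real n + \<theta> \<Longrightarrow> norm (f s) \<le> B n"
    and B: "(\<lambda>n. real n * B n) \<longlonglongrightarrow> 0"
    and res: "(\<lambda>n. \<Sum>p\<in>{p \<in> R. Re p < real n + \<theta>}. residue f p) \<longlonglongrightarrow> S"
  shows "((\<lambda>t. f (\<gamma> t) * vector_derivative \<gamma> (at t)) has_integral - (2 * pi * \<i>) * S) UNIV"
proof -
  define P where "P = {p. is_pole f p}"
  have mero: "f meromorphic_on UNIV" using nm unfolding nicely_meromorphic_on_def by blast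
  have sparse: "P sparse_in UNIV"
    using meromorphic_on_imp_not_pole_cosparse[OF mero] by (simp add: eventually_cosparse P_def)
  have fin: "finite (K \<inter> P)" if "compact K" for K
    using sparse_in_compact_finite[OF sparse_in_subset[OF sparse] that] by simp
  have closedP: "closed P" by (rule sparse_in_UNIV_imp_closed[OF sparse])
  have "f analytic_on - P"
    unfolding analytic_on_analytic_at[of f "- P"]
    using nicely_meromorphic_on_imp_analytic_at[OF nm] by (auto simp: P_def)
  then have holo: "f holomorphic_on - P" by (rule analytic_imp_holomorphic)
  have openP: "open (- P)" using closedP by (rule open_Compl)
  have notP: "\<gamma> t \<notin> P" for t
    using poles[of "\<gamma> t"] left_side_not_range[of "\<gamma> t"] right_side_not_range[of "\<gamma> t"]
    unfolding P_def by (auto split: if_splits)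
  have pint: "f contour_integrable_on piece r" if "r > 0" for r
    by (rule contour_integrable_holomorphic_simple[OF holo openP])
      (use notP that in \<open>auto simp: path_image_piece\<close>)
  have int: "\<And>n::nat. n > 0 \<Longrightarrow> f contour_integrable_on piece (real n)"
    by (rule pint) simp
  define x where "x = (\<lambda>n::nat. real n + \<theta>)"
  have closing_off: "path_image (closing r (x n)) \<inter> P = {}"
    if r: "r \<ge> T" "r > M" "r > box_bound" "x n \<ge> max \<sigma> \<tau>" "x n > W" for r n
  proof (rule ccontr)
    assume "path_image (closing r (x n)) \<inter> P \<noteq> {}"
    then obtain p where p: "p \<in> path_image (closing r (x n))" "is_pole f p" unfolding P_def by blast
    have "p \<notin> R"
      using R_im[of p] R_off[of p n] p(1) r T_pos unfolding path_image_closing[OF r(1)] x_def by auto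
    then have left: "p \<in> left_side \<gamma>" "Re p \<le> W" using poles[OF p(2)] by auto
    then have "Re p \<noteq> x n" using r by simp
    then have "\<bar>Im p\<bar> = r" "Re p \<ge> (if Im p > 0 then \<sigma> else \<tau>)"
      using p(1) r T_pos unfolding path_image_closing[OF r(1)]
      by (auto simp: closed_segment_eq_real_ivl split: if_splits)
    with high_left_side[OF left(1)] r(3) show False by simp
  qed
  \<comment> \<open>For a finite set of points one loop size serves all of them.\<close>
  have fin_ev: "\<exists>N. \<forall>p\<in>A. \<forall>r x. N \<le> r \<longrightarrow> N \<le> x \<longrightarrow> winding_number (loop r x) p = w"
    if "finite A" "\<And>p. p \<in> A \<Longrightarrow> \<exists>N. \<forall>r x. N \<le> r \<longrightarrow> N \<le> x \<longrightarrow> winding_number (loop r x) p = w" for A :: "complex set" and w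
    using that
  proof (induction A rule: finite_induct)
    case (insert p A)
    then obtain N1 N2 where "\<forall>p\<in>A. \<forall>r x. N1 \<le> r \<longrightarrow> N1 \<le> x \<longrightarrow> winding_number (loop r x) p = w"
      "\<forall>r x. N2 \<le> r \<longrightarrow> N2 \<le> x \<longrightarrow> winding_number (loop r x) p = w" by (metis insertCI)
    then show ?case by (intro exI[of _ "max N1 N2"]) auto
  qed auto
  obtain N1 where N1: "\<And>p r x. p \<in> {p \<in> R. Re p \<le> box_bound} \<inter> P \<Longrightarrow> p \<in> right_side \<gamma> \<Longrightarrow> N1 \<le> r \<Longrightarrow> N1 \<le> x \<Longrightarrow> winding_number (loop r x) p = - 1"
    using fin_ev[of "{p \<in> R. Re p \<le> box_bound} \<inter> P \<inter> right_side \<gamma>" "- 1"] R_fin winding_right_side by blast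
  let ?K = "cbox (Complex (- box_bound) (- box_bound)) (Complex W box_bound)"
  obtain N2 where N2: "\<And>p r x. p \<in> ?K \<inter> P \<Longrightarrow> p \<in> left_side \<gamma> \<Longrightarrow> N2 \<le> r \<Longrightarrow> N2 \<le> x \<Longrightarrow> winding_number (loop r x) p = 0"
    using fin_ev[of "?K \<inter> P \<inter> left_side \<gamma>" 0] fin[OF compact_cbox] winding_left_side by blast
  obtain N :: nat where N: "real N > max (max (max N1 N2) (max T M)) (max (max box_bound Y) (max W (real n0)))"
    using reals_Archimedean2 by blast
  have loop_int: "contour_integral (piece (real n)) f + contour_integral (closing (real n) (x n)) f
      = - (2 * pi * \<i>) * (\<Sum>p\<in>{p \<in> R. Re p < real n + \<theta>}. residue f p)"
    and closing_int: "f contour_integrable_on closing (real n) (x n)"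
    if n: "n \<ge> N" for n
  proof -
    have nN: "real n \<ge> real N" using n by simp
    have xn: "x n \<ge> real n" using \<theta> by (simp add: x_def)
    have big: "real n \<ge> N1" "real n \<ge> N2" "real n \<ge> T" "real n > M" "real n \<ge> box_bound" "x n \<ge> N1" "x n \<ge> N2" "x n \<ge> box_bound"
      and big': "real n > box_bound" "x n > W"
      using N nN xn by auto
    have sx: "x n \<ge> max \<sigma> \<tau>" using big(8) box_bound by auto
    have n0: "real n > 0" using big(3) T_pos by linarith
    have off: "path_image (closing (real n) (x n)) \<inter> P = {}" by (rule closing_off[OF big(3,4) big'(1) sx big'(2)])
    show cint: "f contour_integrable_on closing (real n) (x n)"
      by (rule contour_integrable_holomorphic_simple[OF holo openP]) (use off in auto)
    let ?g = "loop (real n) (x n)"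
    define D where "D = box (Complex (- box_bound - 1) (- real n - 1)) (Complex (x n + 1) (real n + 1))"
    define pts where "pts = D \<inter> P"
    have finpts: "finite pts"
    proof (rule finite_subset)
      show "pts \<subseteq> cbox (Complex (- box_bound - 1) (- real n - 1)) (Complex (x n + 1) (real n + 1)) \<inter> P"
        unfolding pts_def D_def using box_subset_cbox by blast
    qed (rule fin[OF compact_cbox])
    have img: "path_image ?g \<subseteq> D - pts"
    proof
      fix w assume w: "w \<in> path_image ?g"
      have "w \<notin> P" using w off notP unfolding path_image_loop[OF big(3)] by auto
      moreover have "w \<in> D"
        using path_image_loop_Re_le[OF big(3,8) w] path_image_loop_Im[OF big(5) w]
        by (auto simp: D_def in_box_complex_iff abs_le_iff)
      ultimately show "w \<in> D - pts" by (simp add: pts_def)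
    qed
    have "contour_integral ?g f = 2 * pi * \<i> * (\<Sum>p\<in>pts. winding_number ?g p * residue f p)"
    proof (rule Residue_theorem[OF _ _ finpts])
      show "open D" "connected D" unfolding D_def by (auto intro: convex_connected)
      show "f holomorphic_on D - pts" by (rule holomorphic_on_subset[OF holo]) (auto simp: pts_def)
      show "\<forall>z. z \<notin> D \<longrightarrow> winding_number ?g z = 0"
      proof (intro allI impI)
        fix z assume "z \<notin> D"
        then have "Re z < - box_bound \<or> Re z > x n \<or> \<bar>Im z\<bar> > real n"
          by (auto simp: D_def in_box_complex_iff)
        then show "winding_number ?g z = 0" by (rule winding_outside[OF big(5,8)])
      qed
    qed (use img in auto)
    also have "(\<Sum>p\<in>pts. winding_number ?g p * residue f p) = (\<Sum>p\<in>{p \<in> R. Re p < x n} \<inter> pts. - residue f p)"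
    proof (rule sum.mono_neutral_cong_right[OF finpts])
      show "\<forall>p\<in>pts - {p \<in> R. Re p < x n} \<inter> pts. winding_number ?g p * residue f p = 0"
      proof
        fix p assume p: "p \<in> pts - {p \<in> R. Re p < x n} \<inter> pts"
        have pole: "is_pole f p" using p by (auto simp: pts_def P_def)
        have "winding_number ?g p = 0"
        proof (cases "p \<in> R")
          case True
          then have "Re p > x n" using p R_off[OF True, of n] by (auto simp: x_def)
          then show ?thesis by (intro winding_outside[OF big(5,8)]) auto
        next
          case False
          then have left: "p \<in> left_side \<gamma>" "Re p \<le> W" using poles[OF pole] by auto
          show ?thesis
          proof (cases "\<bar>Im p\<bar> > box_bound")
            case True
            then show ?thesis by (intro winding_far_left[OF big(5,8)] high_left_side[OF left(1)])
          next
            case le: False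
            show ?thesis
            proof (cases "Re p < - box_bound")
              case True
              then show ?thesis by (intro winding_outside[OF big(5,8)]) auto
            next
              case False
              then have "p \<in> ?K \<inter> P" using le left(2) pole by (auto simp: in_cbox_complex_iff P_def)
              then show ?thesis by (rule N2[OF _ left(1) big(2,7)])
            qed
          qed
        qed
        then show "winding_number ?g p * residue f p = 0" by simp
      qed
      show "winding_number ?g p * residue f p = - residue f p" if p: "p \<in> {p \<in> R. Re p < x n} \<inter> pts" for p
      proof -
        have pole: "is_pole f p" and pR: "p \<in> R" "Re p < x n" using p by (auto simp: pts_def P_def)
        have "p \<in> right_side \<gamma>" using poles[OF pole] pR by simp
        have "winding_number ?g p = - 1"
        proof (cases "Re p \<le> box_bound")
          case True
          then show ?thesis using pR pole \<open>p \<in> right_side \<gamma>\<close> by (intro N1[OF _ _ big(1,6)]) (auto simp: P_def)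
        next
          case False
          then show ?thesis using pR R_im[OF pR(1)] big by (intro winding_right) auto
        qed
        then show ?thesis by simp
      qed
    qed auto
    also have "\<dots> = (\<Sum>p\<in>{p \<in> R. Re p < x n}. - residue f p)"
    proof (rule sum.mono_neutral_left)
      show "finite {p \<in> R. Re p < x n}"
        by (rule finite_subset[OF _ R_fin[of "x n"]]) auto
      show "\<forall>p\<in>{p \<in> R. Re p < x n} - {p \<in> R. Re p < x n} \<inter> pts. - residue f p = 0"
      proof
        fix p assume p: "p \<in> {p \<in> R. Re p < x n} - {p \<in> R. Re p < x n} \<inter> pts"
        show "- residue f p = 0"
        proof (cases "p \<in> P")
          case True
          then have pole: "is_pole f p" and "p \<notin> D" and pR: "p \<in> R" "Re p < x n"
            using p by (auto simp: pts_def P_def)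
          then have "Re p < - box_bound"
            using R_im[OF pR(1)] big by (auto simp: D_def in_box_complex_iff)
          \<comment> \<open>No pole on the right side lies left of the whole contour: its winding number would be both \<open>-1\<close> and \<open>0\<close>.\<close>
          moreover have "p \<in> right_side \<gamma>" using poles[OF pole] pR by simp
          moreover have "Re p \<le> box_bound" using calculation(1) box_bound(1) T_pos by linarith
          ultimately have "winding_number ?g p = - 1" "winding_number ?g p = 0"
            using True pR by (auto intro!: N1[OF _ _ big(1,6)] winding_outside[OF big(5,8)])
          then show ?thesis by simp
        next
          case False
          then show ?thesis using residue_holo[OF openP _ holo, of p] by simp
        qed
      qed
    qed auto
    also have "\<dots> = - (\<Sum>p\<in>{p \<in> R. Re p < real n + \<theta>}. residue f p)"
      by (simp add: sum_negf x_def)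
    also have "contour_integral ?g f = contour_integral (piece (real n)) f + contour_integral (closing (real n) (x n)) f"
      unfolding loop_def by (intro contour_integral_join pint cint n0) auto
    finally show "contour_integral (piece (real n)) f + contour_integral (closing (real n) (x n)) f
      = - (2 * pi * \<i>) * (\<Sum>p\<in>{p \<in> R. Re p < real n + \<theta>}. residue f p)" by simp
  qed
  have closing_0: "(\<lambda>n. contour_integral (closing (real n) (x n)) f) \<longlonglongrightarrow> 0"
  proof (rule Lim_null_comparison)
    define k where "k = \<theta> + box_bound"
    define b where "b = (\<lambda>n. 2 * C * (real n * exp (- 1) ^ n + k * exp (- 1) ^ n) + 2 * (real n * B n))"
    have e: "(\<lambda>n. exp (- 1 :: real) ^ n) \<longlonglongrightarrow> 0" "(\<lambda>n. real n * exp (- 1) ^ n) \<longlonglongrightarrow> 0"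
      by (rule LIMSEQ_power_zero, simp) (rule powser_times_n_limit_0, simp)
    have "b \<longlonglongrightarrow> 2 * C * (0 + k * 0) + 2 * 0"
      unfolding b_def by (intro tendsto_intros e B)
    then show "b \<longlonglongrightarrow> 0" by simp
    show "\<forall>\<^sub>F n in sequentially. norm (contour_integral (closing (real n) (x n)) f) \<le> b n"
      using eventually_ge_at_top[of N]
    proof eventually_elim
      case (elim n)
      have nN: "real n \<ge> real N" using elim by simp
      have big: "real n \<ge> T" "real n \<ge> Y" "n \<ge> n0" "real n \<ge> box_bound"
        using N nN by auto
      have n0: "real n > 0" using big(1) T_pos by linarith
      have xn: "x n \<ge> real n" using \<theta> by (simp add: x_def)
      have sx: "x n \<ge> \<sigma>" "x n \<ge> \<tau>" using xn big(4) box_bound by auto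
      have ex: "exp (- real n) = exp (- 1) ^ n" by (simp add: exp_of_nat_mult[symmetric])
      define E where "E = C * exp (- real n)"
      have E0: "0 \<le> E"
        using order.trans[OF norm_ge_zero hor[of "Complex \<sigma> (real n)"]] big(2) by (simp add: E_def)
      have B0: "0 \<le> B n"
        using order.trans[OF norm_ge_zero ver[OF big(3), of "Complex (x n) 0"]] by (simp add: x_def)
      let ?l1 = "linepath (\<gamma> (real n)) (Complex (x n) (real n))"
      let ?l2 = "linepath (Complex (x n) (real n)) (Complex (x n) (- real n))"
      let ?l3 = "linepath (Complex (x n) (- real n)) (\<gamma> (- real n))"
      have ends: "\<gamma> (real n) = Complex \<sigma> (real n)" "\<gamma> (- real n) = Complex \<tau> (- real n)"
        using upper lower big(1) by auto
      have int: "f contour_integrable_on ?l1" "f contour_integrable_on ?l2" "f contour_integrable_on ?l3"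
        using closing_int[OF elim] unfolding closing_def by auto
      have "norm (contour_integral ?l1 f) \<le> E * norm (Complex (x n) (real n) - \<gamma> (real n))"
      proof (rule contour_integral_bound_linepath[OF int(1) E0])
        fix s assume "s \<in> closed_segment (\<gamma> (real n)) (Complex (x n) (real n))"
        then have "Im s = real n" "Re s \<ge> \<sigma>"
          using sx by (auto simp: ends closed_segment_same_Im closed_segment_eq_real_ivl)
        then show "norm (f s) \<le> E" using hor[of s] big by (simp add: E_def)
      qed
      also have "norm (Complex (x n) (real n) - \<gamma> (real n)) = x n - \<sigma>"
        using sx by (simp add: ends cmod_def)
      finally have 1: "norm (contour_integral ?l1 f) \<le> E * (x n - \<sigma>)" .
      have "norm (contour_integral ?l3 f) \<le> E * norm (\<gamma> (- real n) - Complex (x n) (- real n))"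
      proof (rule contour_integral_bound_linepath[OF int(3) E0])
        fix s assume "s \<in> closed_segment (Complex (x n) (- real n)) (\<gamma> (- real n))"
        then have "Im s = - real n" "Re s \<ge> \<tau>"
          using sx by (auto simp: ends closed_segment_same_Im closed_segment_eq_real_ivl split: if_splits)
        then show "norm (f s) \<le> E" using hor[of s] big by (simp add: E_def)
      qed
      also have "norm (\<gamma> (- real n) - Complex (x n) (- real n)) = x n - \<tau>"
        using sx by (simp add: ends cmod_def)
      finally have 3: "norm (contour_integral ?l3 f) \<le> E * (x n - \<tau>)" .
      have "norm (contour_integral ?l2 f) \<le> B n * norm (Complex (x n) (- real n) - Complex (x n) (real n))"
      proof (rule contour_integral_bound_linepath[OF int(2) B0])
        fix s assume "s \<in> closed_segment (Complex (x n) (real n)) (Complex (x n) (- real n))"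
        then have "Re s = real n + \<theta>" by (auto simp: closed_segment_same_Re x_def)
        then show "norm (f s) \<le> B n" by (rule ver[OF big(3)])
      qed
      also have "norm (Complex (x n) (- real n) - Complex (x n) (real n)) = 2 * real n"
        by (simp add: cmod_def real_sqrt_mult)
      finally have 2: "norm (contour_integral ?l2 f) \<le> B n * (2 * real n)" .
      have "contour_integral (closing (real n) (x n)) f
          = contour_integral ?l1 f + (contour_integral ?l2 f + contour_integral ?l3 f)"
        using int unfolding closing_def by (simp add: contour_integrable_joinI)
      then have "norm (contour_integral (closing (real n) (x n)) f)
          \<le> norm (contour_integral ?l1 f) + (norm (contour_integral ?l2 f) + norm (contour_integral ?l3 f))"
        by (metis norm_triangle_mono order.refl)
      also have "\<dots> \<le> E * (x n - \<sigma>) + (B n * (2 * real n) + E * (x n - \<tau>))"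
        by (intro add_mono 1 2 3)
      also have "\<dots> \<le> E * (x n + box_bound) + (B n * (2 * real n) + E * (x n + box_bound))"
        using box_bound by (intro add_mono mult_left_mono E0 order.refl) auto
      also have "\<dots> = b n"
        unfolding b_def E_def ex x_def k_def by (simp add: algebra_simps)
      finally show ?case .
    qed
  qed
  have "(\<lambda>n. - (2 * pi * \<i>) * (\<Sum>p\<in>{p \<in> R. Re p < real n + \<theta>}. residue f p)
      - contour_integral (closing (real n) (x n)) f) \<longlonglongrightarrow> - (2 * pi * \<i>) * S - 0"
    by (intro tendsto_intros res closing_0)
  moreover have "\<forall>\<^sub>F n in sequentially. - (2 * pi * \<i>) * (\<Sum>p\<in>{p \<in> R. Re p < real n + \<theta>}. residue f p)
      - contour_integral (closing (real n) (x n)) f = contour_integral (piece (real n)) f"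
    using eventually_ge_at_top[of N] by eventually_elim (use loop_int in \<open>simp add: algebra_simps\<close>)
  ultimately have "(\<lambda>n. contour_integral (piece (real n)) f) \<longlonglongrightarrow> - (2 * pi * \<i>) * S - 0"
    by (rule Lim_transform_eventually)
  then show ?thesis
    using has_integral_limit[OF int hor] by simp
qed

end

section \<open>Poles and residues of the integrand\<close>

lemma tendsto_quotient_of_zeros:
  fixes f g :: "complex \<Rightarrow> complex"
  assumes "(f has_field_derivative f') (at p)" "(g has_field_derivative g') (at p)"
    and "f p = 0" "g p = 0" "g' \<noteq> 0"
  shows "((\<lambda>s. f s / g s) \<longlongrightarrow> f' / g') (at p)"
proof -
  have "((\<lambda>s. ((f s - f p) / (s - p)) / ((g s - g p) / (s - p))) \<longlongrightarrow> f' / g') (at p)"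
    using assms by (intro tendsto_divide) (auto simp: has_field_derivative_iff)
  moreover have "\<forall>\<^sub>F s in at p. ((f s - f p) / (s - p)) / ((g s - g p) / (s - p)) = f s / g s"
    using eventually_neq_at_within[of p p] by eventually_elim (use assms in auto)
  ultimately show ?thesis by (rule Lim_transform_eventually)
qed

lemma tendsto_imp_not_pole: "(f \<longlongrightarrow> (l::complex)) (at (p::complex)) \<Longrightarrow> \<not> is_pole f p"
  unfolding is_pole_def using not_tendsto_and_filterlim_at_infinity[OF at_neq_bot] by blast

lemma norm_sin_ge_exp:
  assumes "\<bar>Im w\<bar> \<ge> 1"
  shows "norm (sin w) \<ge> exp \<bar>Im w\<bar> / 4"
proof -
  define y where "y = \<bar>Im w\<bar>"
  have y: "y \<ge> 1" using assms by (simp add: y_def)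
  have e2: "exp y \<ge> 2" using exp_ge_add_one_self[of y] y by linarith
  have "exp (2 * Im w) = exp y ^ 2 \<or> exp (2 * Im w) = inverse (exp y ^ 2)"
    by (cases "Im w \<ge> 0") (auto simp: y_def exp_double exp_minus power_inverse)
  then have sym: "exp (2 * Im w) + inverse (exp (2 * Im w)) = exp y ^ 2 + inverse (exp y ^ 2)"
    by auto
  have "inverse (exp y) \<le> exp y / 4"
  proof -
    have "4 \<le> exp y * exp y" using mult_mono[OF e2 e2] by simp
    then show ?thesis by (simp add: field_simps)
  qed
  then have ge: "exp y / 2 - inverse (exp y) / 2 \<ge> exp y / 4"
    using e2 by linarith
  have "(exp y / 4) ^ 2 \<le> (exp y / 2 - inverse (exp y) / 2) ^ 2"
    using ge by (intro power_mono) auto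
  also have "\<dots> = (exp y ^ 2 + inverse (exp y ^ 2) - 2) / 4"
    by (simp add: power2_eq_square field_simps)
  also have "\<dots> \<le> norm (sin w) ^ 2"
    unfolding norm_sin_squared sym by (simp add: divide_right_mono)
  finally show ?thesis
    unfolding y_def[symmetric] by (rule power2_le_imp_le) simp
qed

lemma norm_sin_ge_sin_Re: "norm (sin w) \<ge> \<bar>sin (Re w)\<bar>"
proof -
  have "exp (2 * Im w) + inverse (exp (2 * Im w)) \<ge> 2"
  proof -
    have "0 \<le> (exp (2 * Im w) - 1) ^ 2 / exp (2 * Im w)" by simp
    also have "\<dots> = exp (2 * Im w) + inverse (exp (2 * Im w)) - 2"
      by (simp add: power2_eq_square field_simps)
    finally show ?thesis by simp
  qed
  then have "(2 - 2 * cos (2 * Re w)) / 4 \<le> norm (sin w) ^ 2"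
    unfolding norm_sin_squared by (simp add: divide_right_mono)
  moreover have "(2 - 2 * cos (2 * Re w)) / 4 = sin (Re w) ^ 2"
    by (simp add: cos_double_sin)
  ultimately have "\<bar>sin (Re w)\<bar> ^ 2 \<le> norm (sin w) ^ 2" by simp
  then show ?thesis by (rule power2_le_imp_le) simp
qed

text \<open>The hypotheses of the theorem that do not concern the contour.\<close>

locale barnes_integrand =
  fixes \<omega> :: real and q a b c d e f :: complex
  assumes \<omega>: "\<omega> > 0" and q_def: "q = of_real (exp (- \<omega>))"
    and norms: "norm (q powr f) < 1" "norm (q powr (1 + f - d)) < 1" "norm (q powr (1 + c + f - d)) < 1"
    and sin_d: "sin (of_real pi * d) \<noteq> 0"
    and nonzero: "qpochs_inf q [q powr a, q powr b, q powr c, q powr f,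
                       q powr (1 + a - d), q powr (1 + b - d), q powr (1 + c - d)] \<noteq> 0"
    and nonzero': "\<And>k. qpochs q [q, q powr (e + f), q powr (1 + a + b - d)] k \<noteq> 0"
begin

lemma q_nonzero [simp]: "q \<noteq> 0" and norm_q: "norm q < 1" and ln_q: "ln q = - of_real \<omega>"
proof -
  show "q \<noteq> 0" by (simp add: q_def)
  show "norm q < 1" using \<omega> by (simp add: q_def)
  show "ln q = - of_real \<omega>" unfolding q_def by (simp add: Ln_of_real)
qed

abbreviation X :: "complex \<Rightarrow> complex" where "X s \<equiv> q powr s"

lemma X_exp: "X s = exp (- of_real \<omega> * s)"
  using q_nonzero by (simp add: powr_def ln_q mult.commute)

lemma X_add: "X (s + t) = X s * X t" and X_diff: "X (s - t) = X s / X t"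
  by (simp_all add: powr_add powr_diff)

lemma X_1: "X 1 = q" using q_nonzero by simp

lemma X_nz [simp]: "X s \<noteq> 0" by (simp add: X_exp)

lemma norm_X: "norm (X s) = exp (- \<omega> * Re s)" by (simp add: X_exp)

lemma X_eq_1_iff: "X s = 1 \<longleftrightarrow> (\<exists>m::int. s = 2 * of_real pi * \<i> * of_int m / of_real \<omega>)"
proof
  assume "X s = 1"
  then obtain n :: int where n: "Re (- of_real \<omega> * s) = 0" "Im (- of_real \<omega> * s) = of_int (2 * n) * pi"
    unfolding X_exp exp_eq_1 by blast
  have "s = 2 * of_real pi * \<i> * of_int (- n) / of_real \<omega>"
    using n \<omega> by (auto simp: complex_eq_iff field_simps)
  then show "\<exists>m::int. s = 2 * of_real pi * \<i> * of_int m / of_real \<omega>" by blast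
next
  assume "\<exists>m::int. s = 2 * of_real pi * \<i> * of_int m / of_real \<omega>"
  then obtain m :: int where m: "s = 2 * of_real pi * \<i> * of_int m / of_real \<omega>" ..
  show "X s = 1"
    unfolding X_exp exp_eq_1 m using \<omega> by (auto intro!: exI[of _ "- m"])
qed

lemma analytic_X [analytic_intros]: "g analytic_on A \<Longrightarrow> (\<lambda>s. X (g s)) analytic_on A"
  unfolding X_exp by (intro analytic_intros)

lemma isCont_X: "isCont X s"
  using analytic_at_imp_isCont[OF analytic_X[OF analytic_on_ident]] .

sublocale B: barnes_data q "X d" "X a" "X b" "X c" "X f" "X e"
proof -
  interpret q_base q by standard (use q_nonzero norm_q in auto)
  interpret q_pair q "X d" by standard simp
  have r: "X (1 + t - d) = X t * q / X d" for t
    using q_nonzero by (simp add: X_add X_diff X_1 mult.commute)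
  have nz: "qpoch_inf q (X a) \<noteq> 0" "qpoch_inf q (X b) \<noteq> 0" "qpoch_inf q (X c) \<noteq> 0"
    "qpoch_inf q (X a * q / X d) \<noteq> 0" "qpoch_inf q (X b * q / X d) \<noteq> 0" "qpoch_inf q (X c * q / X d) \<noteq> 0"
    using nonzero unfolding r by (auto simp: qpochs_inf_def)
  have "qpoch q (X a * X b * q / X d) k \<noteq> 0 \<and> qpoch q (X e * X f) k \<noteq> 0" for k
    using nonzero'[of k] r[of "a + b"] by (auto simp: qpochs_def X_add add.assoc)
  then show "barnes_data q (X d) (X a) (X b) (X c) (X f) (X e)"
    by unfold_locales
      (use nz norms r[of f] r[of "c + f"] in \<open>auto simp: admissible_def qpoch_inf_nz_iff X_add add.assoc\<close>)
qed

definition F :: "complex \<Rightarrow> complex" where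
  "F = (\<lambda>s. qpochs_inf q [q powr (1+s), q powr (d+s), q powr (1+a+b+c+s-d), q powr (e+f+s)]
        / qpochs_inf q [q powr (a+s), q powr (b+s), q powr (c+s), q powr (f+s)]
        * (of_real pi * q powr s / (sin (of_real pi * s) * sin (of_real pi * (d+s))))
        * phi32 q (q powr e) (q powr (a+s)) (q powr (b+s))
                  (q powr (e+f+s)) (q powr (1+a+b+c+s-d)) (q powr (1+c+f-d)))"

text \<open>The same meromorphic function as \<open>F\<close>. The two differ at most at the isolated points where a denominator of
  the \<open>\<^sub>3\<phi>\<^sub>2\<close> vanishes, as a term divided by zero counts as zero in \<open>F\<close>.\<close>

definition G :: "complex \<Rightarrow> complex" where
  "G s = X s * B.profile (X s) * (of_real pi / (sin (of_real pi * s) * sin (of_real pi * (d + s))))"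

lemma Phi_eq_phi32:
  assumes nz: "qpoch_inf q (B.lam * x) \<noteq> 0" "qpoch_inf q (X e * X f * x) \<noteq> 0"
  shows "B.Phi x = qpoch_inf q (B.lam * x) * qpoch_inf q (X e * X f * x)
    * phi32 q (X e) (X a * x) (X b * x) (X e * X f * x) (B.lam * x) B.w"
proof -
  define k0 where "k0 = qpoch_inf q (B.lam * x) * qpoch_inf q (X e * X f * x)"
  have k0: "k0 \<noteq> 0" using nz by (simp add: k0_def)
  have summand: "qpochs q [X e, X a * x, X b * x] k / qpochs q [q, X e * X f * x, B.lam * x] k * B.w ^ k = B.Phi_term x k / k0" for k
  proof -
    have "qpoch q (B.lam * x) k \<noteq> 0" "qpoch q (X e * X f * x) k \<noteq> 0"
      using nz B.qpoch_inf_nz_iff by blast+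
    moreover have "qpoch_inf q (B.lam * x * q ^ k) \<noteq> 0" "qpoch_inf q (X e * X f * x * q ^ k) \<noteq> 0"
      using nz B.qpoch_inf_nz_shift by blast+
    ultimately show ?thesis
      unfolding B.Phi_term_def k0_def qpochs_def
        B.qpoch_inf_split[of "B.lam * x" k] B.qpoch_inf_split[of "X e * X f * x" k]
      by (simp add: mult_ac)
  qed
  have "phi32 q (X e) (X a * x) (X b * x) (X e * X f * x) (B.lam * x) B.w = B.Phi x / k0"
    unfolding phi32_def summand B.Phi_def by (rule suminf_divide[OF B.summable_Phi_term])
  then show ?thesis using k0 by (simp add: k0_def)
qed

lemma F_eq_G:
  assumes nz: "qpoch_inf q (B.lam * X s) \<noteq> 0" "qpoch_inf q (X e * X f * X s) \<noteq> 0"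
  shows "F s = G s"
proof -
  have args: "X (1 + s) = q * X s" "X (d + s) = X d * X s" "X (1+a+b+c+s-d) = B.lam * X s"
    "X (e + f + s) = X e * X f * X s" "X (1 + c + f - d) = B.w" "X (a + s) = X a * X s"
    "X (b + s) = X b * X s" "X (c + s) = X c * X s" "X (f + s) = X f * X s"
    by (simp_all add: X_add X_diff X_1[simplified] q_nonzero mult_ac)
  show ?thesis
    unfolding F_def G_def args B.profile_def Phi_eq_phi32[OF nz] by (simp add: qpochs_inf_def mult_ac)
qed

text \<open>The function is entire and not identically zero, as it tends to \<open>1\<close> for \<open>Re s\<close> tending to infinity.\<close>

lemma qpoch_zeros_sparse: "\<forall>\<^sub>F s in cosparse UNIV. qpoch_inf q (u * X s) \<noteq> 0"
proof -
  let ?g = "\<lambda>s. qpoch_inf q (u * X s)"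
  have an: "?g analytic_on UNIV" by (intro analytic_intros B.analytic_qpoch_inf)
  then have "eventually (\<lambda>s. ?g s = 0) (cosparse UNIV) \<or> eventually (\<lambda>s. ?g s \<noteq> 0) (cosparse UNIV)"
    by (intro meromorphic_imp_constant_or_avoid analytic_on_imp_meromorphic_on) auto
  moreover have False if ev: "eventually (\<lambda>s. ?g s = 0) (cosparse UNIV)"
  proof -
    obtain t :: real where t: "norm u * exp (- \<omega> * t) < 1"
    proof -
      have "((\<lambda>t. norm u * exp (- \<omega> * t)) \<longlongrightarrow> norm u * 0) at_top"
        using \<omega> by (intro tendsto_intros filterlim_compose[OF exp_at_bot]
          filterlim_tendsto_neg_mult_at_bot[OF tendsto_const _ filterlim_ident]) auto
      then have "\<forall>\<^sub>F t in at_top. norm u * exp (- \<omega> * t) < 1"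
        by (rule order_tendstoD(2)) simp
      then show ?thesis using that eventually_happens'[OF trivial_limit_at_top_linorder] by blast
    qed
    then have nz: "?g (of_real t) \<noteq> 0"
      by (intro B.qpoch_inf_nz_small) (simp add: norm_mult norm_X)
    have "\<forall>\<^sub>F s in at (of_real t). ?g s = 0"
      using eventually_cosparse_imp_eventually_at[OF ev, of "of_real t"] by simp
    moreover have "isCont ?g (of_real t)"
      using an analytic_at_imp_isCont analytic_on_subset by blast
    then have "\<forall>\<^sub>F s in at (of_real t). ?g s \<noteq> 0"
      using nz by (intro tendsto_imp_eventually_ne) (auto simp: isCont_def)
    ultimately have "\<forall>\<^sub>F s in at (complex_of_real t). False" by eventually_elim simp
    then show False by simp
  qed
  ultimately show ?thesis by blast
qed

lemma F_eq_G_cosparse: "\<forall>\<^sub>F s in cosparse UNIV. F s = G s"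
  using qpoch_zeros_sparse[of B.lam] qpoch_zeros_sparse[of "X e * X f"]
  by eventually_elim (rule F_eq_G)

lemma F_eq_G_at: "\<forall>\<^sub>F s in at p. F s = G s"
  using eventually_cosparse_imp_eventually_at[OF F_eq_G_cosparse, of p] by simp

abbreviation den :: "complex \<Rightarrow> complex" where
  "den x \<equiv> qpoch_inf q (X a * x) * qpoch_inf q (X b * x) * qpoch_inf q (X c * x) * qpoch_inf q (X f * x)"

lemma analytic_Phi [analytic_intros]: "g analytic_on A \<Longrightarrow> (\<lambda>x. B.Phi (g x)) analytic_on A"
  using analytic_on_compose[of g A B.Phi] B.holomorphic_Phi
  by (auto simp: o_def analytic_on_holomorphic)

lemma profile_meromorphic: "B.profile meromorphic_on A"
  unfolding B.profile_def[abs_def]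
  by (intro meromorphic_on_divide analytic_on_imp_meromorphic_on analytic_intros B.analytic_qpoch_inf)

lemma profile_analytic: "den x \<noteq> 0 \<Longrightarrow> B.profile analytic_on {x}"
  unfolding B.profile_def[abs_def]
  by (intro analytic_intros B.analytic_qpoch_inf) auto

lemma entire_part_analytic: "den x \<noteq> 0 \<Longrightarrow> (\<lambda>x. of_real pi * x * B.Phi x / den x) analytic_on {x}"
  by (intro analytic_intros B.analytic_qpoch_inf) auto

lemma G_meromorphic: "G meromorphic_on UNIV"
proof -
  have "(\<lambda>s. B.profile (X s)) meromorphic_on UNIV"
    by (rule meromorphic_on_compose[OF profile_meromorphic[of UNIV]]) (auto intro!: analytic_intros)
  then show ?thesis
    unfolding G_def[abs_def]
    by (intro meromorphic_on_mult meromorphic_on_divide) (auto intro!: analytic_on_imp_meromorphic_on analytic_intros)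
qed

lemma F_meromorphic: "F meromorphic_on UNIV"
  using meromorphic_on_cong'[OF F_eq_G_cosparse] G_meromorphic by blast

lemma is_pole_F_iff: "is_pole F p \<longleftrightarrow> is_pole G p"
  by (rule is_pole_cong[OF F_eq_G_at]) simp

text \<open>The candidates for the increasing sequences of poles. At each other zero of one of the two sines the
  corresponding factor of \<open>(q\<^sup>1\<^sup>+\<^sup>s, q\<^sup>d\<^sup>+\<^sup>s;q)\<^sub>\<infinity>\<close> vanishes as well.\<close>

definition right_points :: "complex set" where
  "right_points = range of_nat \<union> range (\<lambda>n. 1 - d + of_nat n)"

lemma den_zero:
  assumes "den (X p) = 0"
  obtains x n m where "x \<in> {a, b, c, f}" "p = - x - of_nat n + 2 * of_real pi * \<i> * of_int m / of_real \<omega>"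
proof -
  have "\<exists>x\<in>{a, b, c, f}. qpoch_inf q (X x * X p) = 0" using assms by auto
  then obtain x k where x: "x \<in> {a, b, c, f}" and "X x * X p * q ^ k = 1"
    unfolding B.qpoch_inf_eq_0_iff by blast
  then have "X (x + p + of_nat k) = 1" using q_nonzero by (simp add: X_add)
  then obtain m :: int where "x + p + of_nat k = 2 * of_real pi * \<i> * of_int m / of_real \<omega>"
    unfolding X_eq_1_iff by blast
  then have "p = - x - of_nat k + 2 * of_real pi * \<i> * of_int m / of_real \<omega>" by (simp add: algebra_simps)
  with x show ?thesis using that by blast
qed

lemma sin_pi_eq_0: "sin (of_real pi * s) = 0 \<longleftrightarrow> (\<exists>n::int. s = of_int n)" for s :: complex
proof -
  have "of_real pi * s = of_real (of_int n * pi) \<longleftrightarrow> s = of_int n" for n :: int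
    by (simp add: mult.commute)
  then show ?thesis by (simp only: Complex_Transcendental.sin_eq_0)
qed

lemma right_points_sin:
  assumes "sin (of_real pi * p) = 0" "p \<notin> right_points"
  shows "qpoch_inf q (q * X p) = 0"
proof -
  obtain n :: int where n: "p = of_int n" using assms(1) sin_pi_eq_0 by blast
  have "n < 0"
  proof (rule ccontr)
    assume "\<not> n < 0"
    then have "p = of_nat (nat n)" by (simp add: n)
    then show False using assms(2) unfolding right_points_def by blast
  qed
  then obtain k :: nat where k: "n = - int (Suc k)" by (metis neg_int_cases gr0_conv_Suc)
  have "X (1 + p + of_nat k) = 1" by (simp add: n k q_nonzero)
  then have "q * X p * q ^ k = 1" using q_nonzero by (simp add: X_add)
  then show ?thesis unfolding B.qpoch_inf_eq_0_iff by blast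
qed

lemma right_points_sin_d:
  assumes "sin (of_real pi * (d + p)) = 0" "p \<notin> right_points"
  shows "qpoch_inf q (X d * X p) = 0"
proof -
  obtain n :: int where n: "d + p = of_int n" using assms(1) sin_pi_eq_0 by blast
  have "n \<le> 0"
  proof (rule ccontr)
    assume "\<not> n \<le> 0"
    then have "p = 1 - d + of_nat (nat (n - 1))" using n by (simp add: algebra_simps)
    then show False using assms(2) unfolding right_points_def by blast
  qed
  then obtain k :: nat where k: "n = - int k" by (metis nonpos_int_cases)
  have "X (d + p + of_nat k) = 1" by (simp add: n k q_nonzero)
  then have "X d * X p * q ^ k = 1" using q_nonzero by (simp add: X_add)
  then show ?thesis unfolding B.qpoch_inf_eq_0_iff by blast
qed

lemma cos_pi_nz: "sin (of_real pi * s) = 0 \<Longrightarrow> cos (of_real pi * s) \<noteq> 0" for s :: complex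
  using sin_cos_squared_add[of "of_real pi * s"] by auto

text \<open>The zeros of the sine are simple, so a zero of \<open>g\<close> makes the singularity removable.\<close>

lemma quotient_over_sin:
  assumes g: "g analytic_on {p}" and zero: "sin (of_real pi * (t + p)) = 0 \<Longrightarrow> g p = 0"
  shows "\<exists>l. ((\<lambda>s. g s / sin (of_real pi * (t + s))) \<longlongrightarrow> l) (at p)"
proof (cases "sin (of_real pi * (t + p)) = 0")
  case True
  have d1: "((\<lambda>s. sin (of_real pi * (t + s))) has_field_derivative of_real pi * cos (of_real pi * (t + p))) (at p)"
    by (rule derivative_eq_intros refl | simp)+
  have d2: "(g has_field_derivative deriv g p) (at p)"
    using g by (intro field_differentiable_derivI analytic_on_imp_differentiable_at[OF g]) simp
  have "of_real pi * cos (of_real pi * (t + p)) \<noteq> 0" using cos_pi_nz[OF True] by simp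
  from tendsto_quotient_of_zeros[OF d2 d1 zero[OF True] True this] show ?thesis by blast
next
  case False
  have "isCont (\<lambda>s. g s / sin (of_real pi * (t + s))) p"
    using False analytic_at_imp_isCont[OF g] by (intro continuous_intros) auto
  then show ?thesis by (auto simp: isCont_def)
qed

text \<open>Away from the right points each sine is compensated by one of the factors of the numerator, and what is left can
  only blow up where a factor \<open>(q\<^sup>a\<^sup>+\<^sup>s;q)\<^sub>\<infinity>\<close>, \<open>\<dots>\<close>, \<open>(q\<^sup>f\<^sup>+\<^sup>s;q)\<^sub>\<infinity>\<close> of the denominator vanishes.\<close>

lemma pole_location:
  assumes "is_pole F p" "p \<notin> right_points"
  shows "den (X p) = 0"
proof (rule ccontr)
  assume den: "den (X p) \<noteq> 0"
  have "(\<lambda>s. qpoch_inf q (q * X s)) analytic_on {p}" "(\<lambda>s. qpoch_inf q (X d * X s)) analytic_on {p}"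
    by (intro analytic_intros B.analytic_qpoch_inf)+
  note an = this
  have z1: "qpoch_inf q (q * X p) = 0" if "sin (of_real pi * (0 + p)) = 0"
    using right_points_sin[OF _ assms(2)] that by simp
  from quotient_over_sin[OF an(1) z1]
  obtain l1 where l1: "((\<lambda>s. qpoch_inf q (q * X s) / sin (of_real pi * (0 + s))) \<longlongrightarrow> l1) (at p)" by blast
  from quotient_over_sin[OF an(2) right_points_sin_d[OF _ assms(2)]]
  obtain l2 where l2: "((\<lambda>s. qpoch_inf q (X d * X s) / sin (of_real pi * (d + s))) \<longlongrightarrow> l2) (at p)" by blast
  define k where "k = (\<lambda>x. of_real pi * x * B.Phi x / den x)"
  have "isCont k (X p)"
    unfolding k_def by (rule analytic_at_imp_isCont[OF entire_part_analytic[OF den]])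
  from isCont_tendsto_compose[OF this isCont_X[THEN isContD]]
  have l3: "((\<lambda>s. k (X s)) \<longlongrightarrow> k (X p)) (at p)" .
  have "G s = (qpoch_inf q (q * X s) / sin (of_real pi * (0 + s))) * (qpoch_inf q (X d * X s) / sin (of_real pi * (d + s)))
     * k (X s)" for s
    unfolding G_def B.profile_def k_def
    by (simp only: times_divide_eq_left times_divide_eq_right divide_divide_eq_left divide_divide_eq_right mult_ac add_0)
  then have Geq: "G = (\<lambda>s. (qpoch_inf q (q * X s) / sin (of_real pi * (0 + s))) * (qpoch_inf q (X d * X s) / sin (of_real pi * (d + s)))
     * k (X s))" by (rule ext)
  have "(G \<longlongrightarrow> l1 * l2 * k (X p)) (at p)"
    unfolding Geq by (rule tendsto_mult[OF tendsto_mult[OF l1 l2] l3])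
  then have "\<not> is_pole G p" by (rule tendsto_imp_not_pole)
  with assms(1) show False by (simp add: is_pole_F_iff)
qed

text \<open>This gives the correct value \<open>0\<close> also when the singularity is removable, so the residue formulas hold at
  every right point, whether or not it is a pole.\<close>

lemma residue_simple_at:
  assumes "((\<lambda>s. G s * (s - p)) \<longlongrightarrow> l) (at p)"
  shows "residue F p = l"
proof -
  have "G meromorphic_on {p}" using meromorphic_on_subset[OF G_meromorphic] by blast
  then have "isolated_singularity_at G p" by (rule meromorphic_on_isolated_singularity)
  then obtain A where A: "p \<in> A" "open A" "G analytic_on A - {p}"
    unfolding isolated_singularity_at_iff_analytic_nhd by blast
  have "residue G p = l"
    by (rule residue_simple'[OF A(2,1) analytic_imp_holomorphic[OF A(3)] assms])
  then show ?thesis using residue_cong[OF F_eq_G_at, of p p] by simp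
qed

lemma den_orbit: "y = 1 \<or> y = q / X d \<Longrightarrow> den (y * q ^ n) \<noteq> 0"
proof -
  assume y: "y = 1 \<or> y = q / X d"
  have "qpoch_inf q (X f * (y * q ^ n)) \<noteq> 0"
    by (rule B.qpoch_inf_nz_small) (use B.orbit_small[OF y, of n] in auto)
  then show ?thesis using B.admissible_orbit[OF _ y, of _ n] B.adm by auto
qed

lemma isCont_profile_X: "den (X p) \<noteq> 0 \<Longrightarrow> isCont (\<lambda>s. X s * B.profile (X s)) p"
  using tendsto_mult[OF isCont_X[THEN isContD] isCont_tendsto_compose[OF _ isCont_X[THEN isContD]]]
    analytic_at_imp_isCont[OF profile_analytic] unfolding isCont_def by blast

lemma residue_at_sine_zero:
  assumes g: "isCont g p" and G: "\<And>s. G s = g s * (of_real pi / sin (of_real pi * (t + s)))"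
    and z: "sin (of_real pi * (t + p)) = 0"
  shows "residue F p = g p / cos (of_real pi * (t + p))"
proof (rule residue_simple_at)
  let ?S = "\<lambda>s. sin (of_real pi * (t + s))" and ?c = "cos (of_real pi * (t + p))"
  have nz: "of_real pi * ?c \<noteq> 0" using cos_pi_nz[OF z] by simp
  have "(?S has_field_derivative of_real pi * ?c) (at p)"
    by (rule derivative_eq_intros refl | simp)+
  moreover have "((\<lambda>s. s - p) has_field_derivative 1) (at p)"
    by (auto intro!: derivative_eq_intros)
  ultimately have "((\<lambda>s. (s - p) / ?S s) \<longlongrightarrow> 1 / (of_real pi * ?c)) (at p)"
    using z nz by (intro tendsto_quotient_of_zeros) auto
  from tendsto_mult[OF tendsto_mult[OF g[THEN isContD] tendsto_const[of "of_real pi"]] this]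
  have lim: "((\<lambda>s. g s * of_real pi * ((s - p) / ?S s)) \<longlongrightarrow> g p * of_real pi * (1 / (of_real pi * ?c))) (at p)" .
  have E: "g p * of_real pi * (1 / (of_real pi * ?c)) = g p / ?c" by simp
  have Fn: "(\<lambda>s. g s * of_real pi * ((s - p) / ?S s)) = (\<lambda>s. G s * (s - p))"
    by (simp add: G fun_eq_iff)
  show "((\<lambda>s. G s * (s - p)) \<longlongrightarrow> g p / ?c) (at p)"
    using lim unfolding E Fn .
qed

lemma residue_nat:
  "residue F (of_nat n) = q ^ n * B.profile (q ^ n) / sin (of_real pi * d)"
proof -
  let ?p = "of_nat n :: complex" and ?g = "\<lambda>s. X s * B.profile (X s) / sin (of_real pi * (d + s))"
  have Xp: "X ?p = q ^ n" by simp
  have sp: "sin (of_real pi * ?p) = 0" unfolding sin_pi_eq_0 by (metis of_int_of_nat_eq)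
  have cp: "cos (of_real pi * ?p) = (-1) ^ n"
    by (subst mult.commute, subst cos_npi_complex') simp
  have sdp: "sin (of_real pi * (d + ?p)) = (-1) ^ n * sin (of_real pi * d)"
    by (simp add: distrib_left sin_add sp cp)
  have "den (X ?p) \<noteq> 0" unfolding Xp using den_orbit[of 1 n] by simp
  then have "isCont ?g ?p"
    using sin_d by (intro continuous_divide isCont_profile_X continuous_intros) (auto simp: sdp)
  then have "residue F ?p = ?g ?p / cos (of_real pi * (0 + ?p))"
    by (rule residue_at_sine_zero) (simp_all add: G_def sp mult_ac)
  also have "\<dots> = q ^ n * B.profile (q ^ n) / sin (of_real pi * d)"
    unfolding add_0 Xp cp sdp by (simp flip: power_mult_distrib)
  finally show ?thesis .
qed

lemma residue_shifted:
  "residue F (1 - d + of_nat n) = - (q / X d * q ^ n * B.profile (q / X d * q ^ n)) / sin (of_real pi * d)"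
proof -
  let ?p = "1 - d + of_nat n :: complex" and ?g = "\<lambda>s. X s * B.profile (X s) / sin (of_real pi * s)"
  have Xp: "X ?p = q / X d * q ^ n" by (simp add: X_add X_diff)
  have e: "d + ?p = of_nat (Suc n)" by simp
  have sdp: "sin (of_real pi * (d + ?p)) = 0" unfolding sin_pi_eq_0 e by (metis of_int_of_nat_eq)
  have cdp: "cos (of_real pi * (d + ?p)) = - ((-1) ^ n)"
    unfolding e by (subst mult.commute, subst cos_npi_complex') simp
  have sp: "sin (of_real pi * ?p) = (-1) ^ n * sin (of_real pi * d)"
  proof -
    have "of_real pi * ?p = of_real pi * (d + ?p) - of_real pi * d" by (simp add: algebra_simps)
    then have "sin (of_real pi * ?p) = sin (of_real pi * (d + ?p) - of_real pi * d)" by (rule arg_cong)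
    also have "\<dots> = (-1) ^ n * sin (of_real pi * d)"
      unfolding sin_diff sdp cdp by simp
    finally show ?thesis .
  qed
  have "den (X ?p) \<noteq> 0" unfolding Xp using den_orbit[of "q / X d" n] by simp
  then have "isCont ?g ?p"
    using sin_d sp by (intro continuous_divide isCont_profile_X continuous_intros) auto
  then have "residue F ?p = ?g ?p / cos (of_real pi * (d + ?p))"
    by (rule residue_at_sine_zero) (simp_all only: G_def sdp, simp)
  also have "\<dots> = - (q / X d * q ^ n * B.profile (q / X d * q ^ n)) / sin (of_real pi * d)"
    unfolding Xp cdp sp by (simp flip: power_mult_distrib)
  finally show ?thesis .
qed

end

section \<open>Decay of the integrand and evaluation of the integral\<close>

text \<open>The pole conditions leave room for a pole of the decreasing sequences to the right of the vertical ends of the contour,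
  at a moderate height.\<close>

locale barnes_contour = barnes_integrand \<omega> q a b c d e f + vertical_contour \<gamma> T \<sigma> \<tau>
  for \<omega> q a b c d e f \<gamma> T \<sigma> \<tau> +
  assumes right: "\<And>s n. is_pole F s \<Longrightarrow> s = of_nat n \<or> s = 1 - d + of_nat n \<Longrightarrow> s \<in> right_side \<gamma>"
    and left: "\<And>s x n m. is_pole F s \<Longrightarrow> x \<in> {a, b, c, f} \<Longrightarrow>
           s = - x - of_nat n + 2 * of_real pi * \<i> * of_int m / of_real \<omega> \<Longrightarrow> s \<in> left_side \<gamma>"
begin

definition left_bound :: real where "left_bound = Max {- Re a, - Re b, - Re c, - Re f}"

lemma pole_sides:
  assumes "is_pole F p"
  shows "if p \<in> right_points then p \<in> right_side \<gamma> else p \<in> left_side \<gamma> \<and> Re p \<le> left_bound"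
proof (cases "p \<in> right_points")
  case True
  then show ?thesis using right[OF assms] unfolding right_points_def by auto
next
  case False
  obtain x n m where x: "x \<in> {a, b, c, f}" and p: "p = - x - of_nat n + 2 * of_real pi * \<i> * of_int m / of_real \<omega>"
    by (rule den_zero[OF pole_location[OF assms False]])
  have "Re p = - Re x - real n" unfolding p by simp
  also have "\<dots> \<le> - Re x" by simp
  also have "\<dots> \<le> left_bound" unfolding left_bound_def by (rule Max_ge) (use x in auto)
  finally show ?thesis using left[OF assms x p] False by simp
qed

lemma right_points_Im: "p \<in> right_points \<Longrightarrow> \<bar>Im p\<bar> \<le> \<bar>Im d\<bar>"
  unfolding right_points_def by auto

lemma filterlim_X_at: "filterlim X (at (X p)) (at p)"
proof (rule filterlim_atI)
  show "(X \<longlongrightarrow> X p) (at p)" using isCont_X isCont_def by blast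
  have "X s \<noteq> X p" if "s \<noteq> p" "dist s p < 2 * pi / \<omega>" for s
  proof
    assume "X s = X p"
    then have "X (s - p) = 1" by (simp add: X_diff)
    then obtain m :: int where m: "s - p = 2 * of_real pi * \<i> * of_int m / of_real \<omega>"
      unfolding X_eq_1_iff by blast
    then have "m \<noteq> 0" using that(1) by auto
    then have "1 \<le> \<bar>real_of_int m\<bar>" by linarith
    then have "2 * pi / \<omega> * 1 \<le> 2 * pi / \<omega> * \<bar>real_of_int m\<bar>"
      using \<omega> by (intro mult_left_mono) auto
    also have "\<dots> = norm (s - p)" unfolding m using \<omega> by (simp add: norm_mult norm_divide)
    finally show False using that(2) by (simp add: dist_norm)
  qed
  then show "\<forall>\<^sub>F s in at p. X s \<noteq> X p"
    using \<omega> unfolding eventually_at by (intro exI[of _ "2 * pi / \<omega>"]) auto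
qed

lemma sin_nz_high:
  assumes "\<bar>Im p\<bar> > 0" shows "sin (of_real pi * p) \<noteq> 0"
  using assms unfolding sin_pi_eq_0 by auto

lemma G_pole_of_profile_pole:
  assumes h: "is_pole B.profile (X p)" and s: "sin (of_real pi * p) \<noteq> 0" "sin (of_real pi * (d + p)) \<noteq> 0"
  shows "is_pole F p"
proof -
  have "is_pole (\<lambda>s. B.profile (X s)) p"
    using h filterlim_compose[OF _ filterlim_X_at] unfolding is_pole_def by blast
  moreover have "(\<lambda>s. X s * (of_real pi / (sin (of_real pi * s) * sin (of_real pi * (d + s))))) analytic_on {p}"
    using s by (intro analytic_intros) auto
  ultimately have "is_pole (\<lambda>s. B.profile (X s) * (X s * (of_real pi / (sin (of_real pi * s) * sin (of_real pi * (d + s)))))) p"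
    by (rule is_pole_mult_analytic_nonzero2) (use s in auto)
  moreover have "(\<lambda>s. B.profile (X s) * (X s * (of_real pi / (sin (of_real pi * s) * sin (of_real pi * (d + s)))))) = G"
    unfolding G_def by (rule ext) (simp only: mult_ac)
  ultimately show ?thesis by (simp only: is_pole_F_iff)
qed

text \<open>A pole \<open>x = q\<^sup>p\<close> of the profile gives singularities of the integrand at all points \<open>p + 2 \<pi> i m / \<omega>\<close>. Far up and far down the
  sines have no zeros, so these are poles, on the left side by \<open>pole_sides\<close>, and there \<open>high_left_side\<close> places them to the
  left of the vertical ends. Consequently the profile is bounded on the disc that is the image of the half-plane
  \<open>Re s \<ge> min \<sigma> \<tau>\<close>, and this controls the integrand on the closing path.\<close>

lemma profile_pole_outside:
  assumes "is_pole B.profile x"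
  shows "norm x > exp (- \<omega> * min \<sigma> \<tau>)"
proof -
  have "den x = 0"
    using assms profile_analytic analytic_at_imp_no_pole by blast
  then have "x \<noteq> 0" by auto
  define p where "p = - Ln x / of_real \<omega>"
  have Xp: "X p = x" unfolding p_def X_exp using \<open>x \<noteq> 0\<close> \<omega> by simp
  have shift: "X (p + 2 * of_real pi * \<i> * of_int m / of_real \<omega>) = x" for m :: int
    using X_eq_1_iff[of "2 * of_real pi * \<i> * of_int m / of_real \<omega>"] by (simp only: X_add Xp) auto
  have key: "Re p < (if y > 0 then \<sigma> else \<tau>)"
    if y: "y = Im (p + 2 * of_real pi * \<i> * of_int m / of_real \<omega>)" "\<bar>y\<bar> > max box_bound \<bar>Im d\<bar>" for y and m :: int
  proof -
    let ?p = "p + 2 * of_real pi * \<i> * of_int m / of_real \<omega>"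
    have "Im (d + ?p) = Im d + y" by (simp add: y)
    then have "\<bar>Im ?p\<bar> > 0" "\<bar>Im (d + ?p)\<bar> > 0" using y by auto
    then have "is_pole F ?p"
      using assms by (intro G_pole_of_profile_pole sin_nz_high) (simp_all only: shift)
    moreover have "?p \<notin> right_points"
      using right_points_Im[of ?p] y by auto
    ultimately have "?p \<in> left_side \<gamma>" using pole_sides by auto
    from high_left_side[OF this] y have "Re ?p < (if y > 0 then \<sigma> else \<tau>)" by auto
    then show ?thesis by simp
  qed
  have Im_shift: "Im (p + 2 * of_real pi * \<i> * of_int m / of_real \<omega>) = Im p + (2 * pi / \<omega>) * of_int m" for m :: int
    using \<omega> by simp
  have big: "\<exists>m::nat. real m * (2 * pi / \<omega>) > u" for u
    using ex_less_of_nat_mult[of "2 * pi / \<omega>" u] \<omega> by auto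
  obtain m1 :: nat where m1: "real m1 * (2 * pi / \<omega>) > max box_bound \<bar>Im d\<bar> + \<bar>Im p\<bar>" using big by blast
  define v where "v = real m1 * (2 * pi / \<omega>)"
  have pos: "max box_bound \<bar>Im d\<bar> \<ge> 0" by auto
  have v: "v > max box_bound \<bar>Im d\<bar> + \<bar>Im p\<bar>" using m1 by (simp only: v_def)
  have "Im p + v = Im (p + 2 * of_real pi * \<i> * of_int (int m1) / of_real \<omega>)"
    "Im p - v = Im (p + 2 * of_real pi * \<i> * of_int (- int m1) / of_real \<omega>)"
    unfolding Im_shift v_def by (simp_all add: mult.commute)
  note Im_v = this
  have "\<bar>Im p + v\<bar> > max box_bound \<bar>Im d\<bar>" "Im p + v > 0" "\<bar>Im p - v\<bar> > max box_bound \<bar>Im d\<bar>" "\<not> Im p - v > 0"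
    using v pos by linarith+
  then have "Re p < \<sigma>" "Re p < \<tau>"
    using key[OF Im_v(1)] key[OF Im_v(2)] by simp_all
  then have "Re p < min \<sigma> \<tau>" by simp
  then show ?thesis
    unfolding Xp[symmetric] norm_X using \<omega> by simp
qed

abbreviation profile_ext :: "complex \<Rightarrow> complex" where "profile_ext \<equiv> remove_sings B.profile"

lemma profile_ext_analytic: "norm x \<le> exp (- \<omega> * min \<sigma> \<tau>) \<Longrightarrow> profile_ext analytic_on {x}"
proof -
  assume x: "norm x \<le> exp (- \<omega> * min \<sigma> \<tau>)"
  have m: "B.profile meromorphic_on {x}" by (rule profile_meromorphic)
  have "\<not> is_pole profile_ext x"
    using profile_pole_outside[of x] x is_pole_remove_sings_iff[OF meromorphic_on_isolated_singularity[OF m]] by auto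
  then show ?thesis
    using nicely_meromorphic_on_imp_analytic_at[OF remove_sings_nicely_meromorphic[OF m]] by simp
qed

lemma profile_ext_bounded: obtains K where "K \<ge> 0" "\<And>x. norm x \<le> exp (- \<omega> * min \<sigma> \<tau>) \<Longrightarrow> norm (profile_ext x) \<le> K"
proof -
  let ?C = "cball (0::complex) (exp (- \<omega> * min \<sigma> \<tau>))"
  have "profile_ext analytic_on ?C"
    unfolding analytic_on_analytic_at[of _ ?C] using profile_ext_analytic by simp
  then have "continuous_on ?C profile_ext"
    by (intro holomorphic_on_imp_continuous_on analytic_imp_holomorphic)
  then have "bounded (profile_ext ` ?C)"
    by (intro compact_imp_bounded compact_continuous_image) auto
  then obtain K where "K > 0" "\<And>y. y \<in> profile_ext ` ?C \<Longrightarrow> norm y \<le> K"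
    unfolding bounded_pos by blast
  then show ?thesis using that[of K] by auto
qed

abbreviation Fr :: "complex \<Rightarrow> complex" where "Fr \<equiv> remove_sings F"

text \<open>Near \<open>s\<close> the integrand agrees with the right-hand side, which is continuous; removing singularities turns
  this into equality at \<open>s\<close>, also if \<open>F\<close> has an accidental value there.\<close>

lemma Fr_eq:
  assumes s: "min \<sigma> \<tau> \<le> Re s" and nz: "sin (of_real pi * s) \<noteq> 0" "sin (of_real pi * (d + s)) \<noteq> 0"
  shows "Fr s = X s * profile_ext (X s) * (of_real pi / (sin (of_real pi * s) * sin (of_real pi * (d + s))))"
proof (rule remove_sings_eqI)
  let ?E = "\<lambda>s. X s * profile_ext (X s) * (of_real pi / (sin (of_real pi * s) * sin (of_real pi * (d + s))))"
  have "norm (X s) \<le> exp (- \<omega> * min \<sigma> \<tau>)"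
    unfolding norm_X using s \<omega> by simp
  from analytic_at_imp_isCont[OF profile_ext_analytic[OF this]]
  have c: "((\<lambda>s. profile_ext (X s)) \<longlongrightarrow> profile_ext (X s)) (at s)"
    by (rule isCont_tendsto_compose[OF _ isCont_X[THEN isContD]])
  have lim: "(?E \<longlongrightarrow> ?E s) (at s)"
    by (rule tendsto_mult[OF tendsto_mult[OF isCont_X[THEN isContD] c]])
      (use nz in \<open>auto intro!: tendsto_intros\<close>)
  have "\<forall>\<^sub>F x in at (X s). profile_ext x = B.profile x"
    by (rule eventually_remove_sings_eq_at[OF meromorphic_on_isolated_singularity[OF profile_meromorphic]])
  then have "\<forall>\<^sub>F w in at s. profile_ext (X w) = B.profile (X w)"
    by (rule eventually_compose_filterlim[OF _ filterlim_X_at])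
  then have "\<forall>\<^sub>F w in at s. ?E w = F w"
    using F_eq_G_at[of s] by eventually_elim (simp add: G_def)
  with lim show "(F \<longlongrightarrow> ?E s) (at s)"
    by (rule Lim_transform_eventually)
qed

lemma Fr_horizontal:
  obtains C Y where "\<And>s. min \<sigma> \<tau> \<le> Re s \<Longrightarrow> Y \<le> \<bar>Im s\<bar> \<Longrightarrow> norm (Fr s) \<le> C * exp (- \<bar>Im s\<bar>)"
proof -
  obtain K where K: "K \<ge> 0" "\<And>x. norm x \<le> exp (- \<omega> * min \<sigma> \<tau>) \<Longrightarrow> norm (profile_ext x) \<le> K"
    by (rule profile_ext_bounded) blast
  let ?r = "exp (- \<omega> * min \<sigma> \<tau>)"
  \<comment> \<open>With \<open>\<bar>Im s\<bar> \<ge> 1 + \<bar>Im d\<bar>\<close> both sines are bounded below by \<open>norm_sin_ge_exp\<close>; one of them supplies the decay.\<close>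
  have "norm (Fr s) \<le> (?r * K * (pi * 16)) * exp (- \<bar>Im s\<bar>)"
    if s: "min \<sigma> \<tau> \<le> Re s" "1 + \<bar>Im d\<bar> \<le> \<bar>Im s\<bar>" for s
  proof -
    have pi1: "pi \<ge> 1" using pi_gt3 by linarith
    have i1: "\<bar>Im (of_real pi * s)\<bar> = pi * \<bar>Im s\<bar>" "\<bar>Im (of_real pi * (d + s))\<bar> = pi * \<bar>Im (d + s)\<bar>"
      by (simp_all add: abs_mult)
    have "\<bar>Im (d + s)\<bar> \<ge> 1" using s(2) by (simp add: abs_if split: if_splits)
    then have g: "pi * \<bar>Im s\<bar> \<ge> \<bar>Im s\<bar>" "\<bar>Im s\<bar> \<ge> 1" "pi * \<bar>Im (d + s)\<bar> \<ge> 1"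
      using s(2) pi1 mult_mono[OF pi1, of 1 "\<bar>Im (d + s)\<bar>"] mult_right_mono[OF pi1, of "\<bar>Im s\<bar>"] by auto
    have "exp \<bar>Im s\<bar> / 4 \<le> exp (pi * \<bar>Im s\<bar>) / 4" using g by simp
    also have "\<dots> \<le> norm (sin (of_real pi * s))"
      using norm_sin_ge_exp[of "of_real pi * s"] g unfolding i1 by linarith
    finally have s1: "exp \<bar>Im s\<bar> / 4 \<le> norm (sin (of_real pi * s))" .
    have "1 / 4 \<le> exp (pi * \<bar>Im (d + s)\<bar>) / 4" using g by simp
    also have "\<dots> \<le> norm (sin (of_real pi * (d + s)))"
      using norm_sin_ge_exp[of "of_real pi * (d + s)"] g unfolding i1 by linarith
    finally have s2: "1 / 4 \<le> norm (sin (of_real pi * (d + s)))" .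
    have nz: "sin (of_real pi * s) \<noteq> 0" "sin (of_real pi * (d + s)) \<noteq> 0"
      using s1 s2 by (auto simp: not_le)
    have r: "norm (X s) \<le> ?r" unfolding norm_X using s \<omega> by simp
    have "norm (Fr s) = norm (X s) * norm (profile_ext (X s)) * (pi / (norm (sin (of_real pi * s)) * norm (sin (of_real pi * (d + s)))))"
      unfolding Fr_eq[OF s(1) nz] by (simp add: norm_mult norm_divide)
    also have "\<dots> \<le> ?r * K * (pi / (exp \<bar>Im s\<bar> / 4 * (1 / 4)))"
      using K s1 s2
      by (intro mult_mono r K mult_nonneg_nonneg divide_left_mono mult_pos_pos) (auto intro: less_le_trans[OF _ s1] less_le_trans[OF _ s2])
    also have "\<dots> = (?r * K * (pi * 16)) * exp (- \<bar>Im s\<bar>)"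
      by (simp add: exp_minus field_simps)
    finally show ?thesis .
  qed
  then show ?thesis using that by blast
qed

lemma Fr_vertical:
  assumes \<theta>: "sin (pi * \<theta>) \<noteq> 0" "sin (pi * (Re d + \<theta>)) \<noteq> 0"
  obtains B n0 where "\<And>n s. n \<ge> n0 \<Longrightarrow> Re s = real n + \<theta> \<Longrightarrow> norm (Fr s) \<le> B n"
    "(\<lambda>n. real n * B n) \<longlonglongrightarrow> 0"
proof -
  obtain K where K: "K \<ge> 0" "\<And>x. norm x \<le> exp (- \<omega> * min \<sigma> \<tau>) \<Longrightarrow> norm (profile_ext x) \<le> K"
    by (rule profile_ext_bounded) blast
  define u where "u = exp (- \<omega> * \<theta>) * K * (pi / (\<bar>sin (pi * \<theta>)\<bar> * \<bar>sin (pi * (Re d + \<theta>))\<bar>))"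
  define B where "B = (\<lambda>n. u * exp (- \<omega>) ^ n)"
  obtain n0 :: nat where n0: "real n0 > min \<sigma> \<tau> - \<theta>" using reals_Archimedean2 by blast
  have per: "\<bar>sin (pi * (real n + t))\<bar> = \<bar>sin (pi * t)\<bar>" for n t
  proof -
    have "sin (pi * (real n + t)) = (-1) ^ n * sin (pi * t)"
      by (simp add: distrib_left sin_add mult.commute[of pi "real n"])
    then show ?thesis by (simp add: abs_mult power_abs)
  qed
  have "norm (Fr s) \<le> B n" if n: "n \<ge> n0" and s: "Re s = real n + \<theta>" for n s
  proof -
    have le: "min \<sigma> \<tau> \<le> Re s" using n0 n s by linarith
    have s1: "\<bar>sin (pi * \<theta>)\<bar> \<le> norm (sin (of_real pi * s))"
      using norm_sin_ge_sin_Re[of "of_real pi * s"] per[of n \<theta>] by (simp add: s)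
    have shift: "real n + (Re d + \<theta>) = Re d + (real n + \<theta>)" by simp
    have s2: "\<bar>sin (pi * (Re d + \<theta>))\<bar> \<le> norm (sin (of_real pi * (d + s)))"
      using norm_sin_ge_sin_Re[of "of_real pi * (d + s)"] per[of n "Re d + \<theta>"] unfolding shift by (simp add: s)
    have nz: "sin (of_real pi * s) \<noteq> 0" "sin (of_real pi * (d + s)) \<noteq> 0"
      using s1 s2 \<theta> by auto
    have r: "norm (X s) = exp (- \<omega> * \<theta>) * exp (- \<omega>) ^ n"
      unfolding norm_X s by (simp add: exp_of_nat_mult[symmetric] exp_add[symmetric] algebra_simps)
    have r': "norm (X s) \<le> exp (- \<omega> * min \<sigma> \<tau>)" unfolding norm_X using le \<omega> by simp
    have "norm (Fr s) = norm (X s) * norm (profile_ext (X s)) * (pi / (norm (sin (of_real pi * s)) * norm (sin (of_real pi * (d + s)))))"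
      unfolding Fr_eq[OF le nz] by (simp add: norm_mult norm_divide)
    also have "\<dots> \<le> norm (X s) * K * (pi / (\<bar>sin (pi * \<theta>)\<bar> * \<bar>sin (pi * (Re d + \<theta>))\<bar>))"
      using K(1) s1 s2 \<theta> nz
      by (intro mult_mono K r' mult_nonneg_nonneg divide_left_mono mult_pos_pos) auto
    also have "\<dots> = B n" unfolding r B_def u_def by (simp only: mult_ac)
    finally show ?thesis .
  qed
  moreover have "(\<lambda>n. real n * B n) \<longlonglongrightarrow> 0"
  proof -
    have "(\<lambda>n. u * (real n * exp (- \<omega>) ^ n)) \<longlonglongrightarrow> u * 0"
      using \<omega> by (intro tendsto_mult tendsto_const powser_times_n_limit_0) auto
    then show ?thesis by (simp add: B_def mult_ac)
  qed
  ultimately show ?thesis using that by blast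
qed

text \<open>If \<open>1/2\<close> fails for the second sine, then \<open>Re d + 1/2\<close> is an integer and \<open>1/4\<close> works.\<close>

lemma theta_exists: obtains \<theta> :: real where "0 \<le> \<theta>" "sin (pi * \<theta>) \<noteq> 0" "sin (pi * (Re d + \<theta>)) \<noteq> 0"
proof (cases "sin (pi * (Re d + 1 / 2)) = 0")
  case False
  then show ?thesis by (intro that[of "1 / 2"]) auto
next
  case True
  have "pi * (Re d + 1 / 4) = pi * (Re d + 1 / 2) - pi / 4" by (simp add: field_simps)
  then have "sin (pi * (Re d + 1 / 4)) = - cos (pi * (Re d + 1 / 2)) * sin (pi / 4)"
    using True by (simp add: sin_diff)
  moreover have "cos (pi * (Re d + 1 / 2)) \<noteq> 0"
    using sin_cos_squared_add[of "pi * (Re d + 1 / 2)"] True by auto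
  moreover have "sin (pi / 4) \<noteq> 0" by (simp add: sin_45)
  ultimately show ?thesis
    by (intro that[of "1 / 4"]) (auto simp: mult.commute)
qed

text \<open>The two sequences of right points do not overlap, since \<open>d\<close> is not an integer.\<close>

lemma residue_sums:
  assumes \<theta>: "sin (pi * \<theta>) \<noteq> 0" "sin (pi * (Re d + \<theta>)) \<noteq> 0"
  shows "(\<lambda>n. \<Sum>p\<in>{p \<in> right_points. Re p < real n + \<theta>}. residue Fr p)
     \<longlonglongrightarrow> B.jackson (\<lambda>x. x * B.profile x) / sin (of_real pi * d)"
proof -
  define r1 r2 where "r1 = (\<lambda>j. residue F (of_nat j))" and "r2 = (\<lambda>j. residue F (1 - d + of_nat j))"
  define N1 N2 where "N1 = (\<lambda>n::nat. nat \<lceil>real n + \<theta>\<rceil>)" and "N2 = (\<lambda>n::nat. nat \<lceil>real n + (\<theta> - 1 + Re d)\<rceil>)"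
  have top: "filterlim (\<lambda>n::nat. nat \<lceil>real n + t\<rceil>) at_top sequentially" for t
    unfolding filterlim_at_top
  proof
    fix Z :: nat
    obtain M :: nat where "real M > real Z - t" using reals_Archimedean2 by blast
    then show "\<forall>\<^sub>F n in sequentially. Z \<le> nat \<lceil>real n + t\<rceil>"
      by (intro eventually_sequentiallyI[of M]) linarith
  qed
  have lt: "real j < real n + t \<longleftrightarrow> j < nat \<lceil>real n + t\<rceil>" for j n t
    by linarith
  have res: "residue Fr p = residue F p" for p
    by (intro residue_remove_sings meromorphic_on_isolated_singularity meromorphic_on_subset[OF F_meromorphic]) simp
  have inj1: "inj (of_nat :: nat \<Rightarrow> complex)" "inj (\<lambda>n::nat. 1 - d + of_nat n)"
    by (auto simp: inj_def)
  have disj: "of_nat j \<noteq> 1 - d + of_nat k" for j k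
  proof
    assume "of_nat j = 1 - d + of_nat k"
    then have "d = of_int (1 + int k - int j)" by (simp add: algebra_simps)
    then show False using sin_d sin_pi_eq_0 by blast
  qed
  have split: "(\<Sum>p\<in>{p \<in> right_points. Re p < real n + \<theta>}. residue Fr p) = (\<Sum>j<N1 n. r1 j) + (\<Sum>j<N2 n. r2 j)" for n
  proof -
    have "{p \<in> right_points. Re p < real n + \<theta>} = of_nat ` {..<N1 n} \<union> (\<lambda>j. 1 - d + of_nat j) ` {..<N2 n}"
    proof -
      have "Re (of_nat j :: complex) < real n + \<theta> \<longleftrightarrow> j < N1 n" for j
        unfolding N1_def lt[symmetric] by simp
      moreover have "Re (1 - d + of_nat j) < real n + \<theta> \<longleftrightarrow> j < N2 n" for j
        unfolding N2_def lt[symmetric] by auto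
      ultimately show ?thesis unfolding right_points_def by blast
    qed
    then have "(\<Sum>p\<in>{p \<in> right_points. Re p < real n + \<theta>}. residue Fr p)
       = (\<Sum>p\<in>of_nat ` {..<N1 n}. residue F p) + (\<Sum>p\<in>(\<lambda>j. 1 - d + of_nat j) ` {..<N2 n}. residue F p)"
      unfolding res by (simp only:) (rule sum.union_disjoint, use disj in auto)
    also have "(\<Sum>p\<in>of_nat ` {..<N1 n}. residue F p) = (\<Sum>j<N1 n. r1 j)"
      unfolding r1_def by (rule sum.reindex_cong[OF inj_on_subset[OF inj1(1)]]) auto
    also have "(\<Sum>p\<in>(\<lambda>j. 1 - d + of_nat j) ` {..<N2 n}. residue F p) = (\<Sum>j<N2 n. r2 j)"
      unfolding r2_def by (rule sum.reindex_cong[OF inj_on_subset[OF inj1(2)]]) auto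
    finally show ?thesis .
  qed
  let ?g = "\<lambda>x. x * B.profile x"
  have L: "(\<lambda>n. ?g (y * q ^ n)) sums qsum q y ?g" if "y = 1 \<or> y = q / X d" for y
    unfolding qsum_def by (rule summable_sums[OF sums_summable[OF B.layers_swap(1)[OF that]]])
  have s1: "r1 sums (qsum q 1 ?g / sin (of_real pi * d))"
    using sums_divide[OF L[of 1], of "sin (of_real pi * d)"] unfolding r1_def residue_nat by simp
  have s2: "r2 sums (- (qsum q (q / X d) ?g / sin (of_real pi * d)))"
    using sums_minus[OF sums_divide[OF L[of "q / X d"], of "sin (of_real pi * d)"]]
    unfolding r2_def residue_shifted minus_divide_left by simp
  have l1: "(\<lambda>n. \<Sum>j<N1 n. r1 j) \<longlonglongrightarrow> qsum q 1 ?g / sin (of_real pi * d)"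
    unfolding N1_def by (rule filterlim_compose[OF s1[unfolded sums_def] top])
  have l2: "(\<lambda>n. \<Sum>j<N2 n. r2 j) \<longlonglongrightarrow> - (qsum q (q / X d) ?g / sin (of_real pi * d))"
    unfolding N2_def by (rule filterlim_compose[OF s2[unfolded sums_def] top])
  have "qsum q 1 ?g / sin (of_real pi * d) + - (qsum q (q / X d) ?g / sin (of_real pi * d))
     = B.jackson ?g / sin (of_real pi * d)"
    unfolding B.jackson_def by (simp only: diff_divide_distrib add_uminus_conv_diff)
  with tendsto_add[OF l1 l2] show ?thesis
    unfolding split by (simp only:)
qed

lemma right_points_finite: "finite {p \<in> right_points. Re p \<le> r}"
proof -
  obtain N :: nat where N: "real N > \<bar>r\<bar> + \<bar>Re d\<bar> + 1" using reals_Archimedean2 by blast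
  have "{p \<in> right_points. Re p \<le> r} \<subseteq> of_nat ` {..N} \<union> (\<lambda>j. 1 - d + of_nat j) ` {..N}"
  proof
    fix p assume p: "p \<in> {p \<in> right_points. Re p \<le> r}"
    then obtain j :: nat where "p = of_nat j \<or> p = 1 - d + of_nat j" unfolding right_points_def by blast
    moreover from this have "j \<le> N" using p N by auto
    ultimately show "p \<in> of_nat ` {..N} \<union> (\<lambda>j. 1 - d + of_nat j) ` {..N}" by blast
  qed
  then show ?thesis by (rule finite_subset) auto
qed

text \<open>The general closing theorem applies to \<open>Fr\<close>, which has no removable singularities. On the contour it differs from \<open>F\<close> at countably many
  parameters at most, because the curve is injective.\<close>

theorem contour_evaluation:
  "((\<lambda>t. F (\<gamma> t) * vector_derivative \<gamma> (at t)) has_integral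
     - (2 * pi * \<i>) * (B.jackson (\<lambda>x. x * B.profile x) / sin (of_real pi * d))) UNIV"
proof -
  obtain \<theta> where \<theta>: "0 \<le> \<theta>" "sin (pi * \<theta>) \<noteq> 0" "sin (pi * (Re d + \<theta>)) \<noteq> 0" by (rule theta_exists) blast
  obtain C Y where hor: "\<And>s. min \<sigma> \<tau> \<le> Re s \<Longrightarrow> Y \<le> \<bar>Im s\<bar> \<Longrightarrow> norm (Fr s) \<le> C * exp (- \<bar>Im s\<bar>)"
    by (rule Fr_horizontal) blast
  obtain B n0 where ver: "\<And>n s. n \<ge> n0 \<Longrightarrow> Re s = real n + \<theta> \<Longrightarrow> norm (Fr s) \<le> B n"
    and B: "(\<lambda>n. real n * B n) \<longlonglongrightarrow> 0" by (rule Fr_vertical[OF \<theta>(2,3)]) blast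
  have off: "Re p \<noteq> real n + \<theta>" if p: "p \<in> right_points" for p n
  proof
    assume eq: "Re p = real n + \<theta>"
    have int: "sin (pi * of_int k) = 0" for k :: int
      by (metis mult.commute sin_npi_int)
    from p consider j :: nat where "p = of_nat j" | j :: nat where "p = 1 - d + of_nat j"
      unfolding right_points_def by blast
    then show False
    proof cases
      case (1 j)
      then have "\<theta> = of_int (int j - int n)" using eq by simp
      then show False using \<theta>(2) int by metis
    next
      case (2 j)
      then have "Re d + \<theta> = of_int (1 + int j - int n)" using eq by simp
      then show False using \<theta>(3) int by metis
    qed
  qed
  have poles: "if p \<in> right_points then p \<in> right_side \<gamma> else p \<in> left_side \<gamma> \<and> Re p \<le> left_bound" if "is_pole Fr p" for p
  proof (rule pole_sides)
    have "isolated_singularity_at F p"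
      by (intro meromorphic_on_isolated_singularity meromorphic_on_subset[OF F_meromorphic]) simp
    then show "is_pole F p" using that by (simp add: is_pole_remove_sings_iff)
  qed
  have "((\<lambda>t. Fr (\<gamma> t) * vector_derivative \<gamma> (at t)) has_integral
     - (2 * pi * \<i>) * (B.jackson (\<lambda>x. x * B.profile x) / sin (of_real pi * d))) UNIV"
  proof (rule close_to_the_right[where R = right_points and M = "\<bar>Im d\<bar>" and \<theta> = \<theta> and W = left_bound
        and C = C and Y = Y and ?n0.0 = n0 and B = B])
    show "Fr nicely_meromorphic_on UNIV" by (rule remove_sings_nicely_meromorphic[OF F_meromorphic])
    show "finite {p \<in> right_points. Re p \<le> r}" for r by (rule right_points_finite)
    show "\<bar>Im p\<bar> \<le> \<bar>Im d\<bar>" if "p \<in> right_points" for p using that by (rule right_points_Im)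
    show "Re p \<noteq> real n + \<theta>" if "p \<in> right_points" for p n using that by (rule off)
    show "0 \<le> \<theta>" by (rule \<theta>(1))
    show "if p \<in> right_points then p \<in> right_side \<gamma> else p \<in> left_side \<gamma> \<and> Re p \<le> left_bound" if "is_pole Fr p" for p
      using that by (rule poles)
    show "norm (Fr s) \<le> C * exp (- \<bar>Im s\<bar>)" if "min \<sigma> \<tau> \<le> Re s" "Y \<le> \<bar>Im s\<bar>" for s
      using that by (rule hor)
    show "norm (Fr s) \<le> B n" if "n \<ge> n0" "Re s = real n + \<theta>" for n s using that by (rule ver)
    show "(\<lambda>n. real n * B n) \<longlonglongrightarrow> 0" by (rule B)
    show "(\<lambda>n. \<Sum>p\<in>{p \<in> right_points. Re p < real n + \<theta>}. residue Fr p)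
       \<longlonglongrightarrow> B.jackson (\<lambda>x. x * B.profile x) / sin (of_real pi * d)"
      by (rule residue_sums[OF \<theta>(2,3)])
  qed
  note main = this
  have neg: "negligible {t. F (\<gamma> t) \<noteq> Fr (\<gamma> t)}"
  proof -
    have "{s. \<not> Fr s = F s} sparse_in UNIV"
      using eventually_remove_sings_eq[OF F_meromorphic] unfolding eventually_cosparse .
    from sparse_imp_countable[OF open_UNIV this] have "countable {s. \<not> Fr s = F s}" by simp
    then have "countable {t. \<gamma> t \<in> {s. \<not> Fr s = F s}}" by (rule countable_image_inj[OF _ inj])
    then have "countable {t. F (\<gamma> t) \<noteq> Fr (\<gamma> t)}" by (simp add: eq_commute)
    then have "negligible (\<Union>((\<lambda>t. {t}) ` {t. F (\<gamma> t) \<noteq> Fr (\<gamma> t)}))"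
      by (intro negligible_countable_Union countable_image) auto
    then show ?thesis by (simp only: UN_singleton)
  qed
  show ?thesis
  proof (rule has_integral_spike[OF neg _ main])
    fix t assume "t \<in> UNIV - {t. F (\<gamma> t) \<noteq> Fr (\<gamma> t)}"
    then have "F (\<gamma> t) = Fr (\<gamma> t)" by blast
    then show "F (\<gamma> t) * vector_derivative \<gamma> (at t) = Fr (\<gamma> t) * vector_derivative \<gamma> (at t)" by (rule arg_cong)
  qed
qed

end

theorem theorem7p4:
  fixes \<omega> :: real and q a b c d e f :: complex
    and F :: "complex \<Rightarrow> complex" and \<gamma> :: "real \<Rightarrow> complex"
  assumes "\<omega> > 0" and "q = of_real (exp (- \<omega>))"
    and "Max {norm (q powr f), norm (q powr (1+f-d)), norm (q powr (1+c+f-d))} < 1"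
    and F: "F = (\<lambda>s.
          qpochs_inf q [q powr (1+s), q powr (d+s), q powr (1+a+b+c+s-d), q powr (e+f+s)]
        / qpochs_inf q [q powr (a+s), q powr (b+s), q powr (c+s), q powr (f+s)]
        * (of_real pi * q powr s / (sin (of_real pi * s) * sin (of_real pi * (d+s))))
        * phi32 q (q powr e) (q powr (a+s)) (q powr (b+s))
                  (q powr (e+f+s)) (q powr (1+a+b+c+s-d)) (q powr (1+c+f-d)))"
    and "sin (of_real pi * d) \<noteq> 0"
    and "qpochs_inf q [q powr a, q powr b, q powr c, q powr f,
                       q powr (1+a-d), q powr (1+b-d), q powr (1+c-d)] \<noteq> 0"
    and "\<And>k. qpochs q [q, q powr (e+f), q powr (1+a+b-d)] k \<noteq> 0"
    and "imag_contour \<gamma>"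
    and "\<forall>\<^sub>F s in at_infinity. s \<in> range \<gamma> \<longrightarrow>
           Re (s * ln q - ln (sin (of_real pi * s) * sin (of_real pi * (d+s)))) < 0"
    and "\<And>s n. is_pole F s \<Longrightarrow> s = of_nat n \<or> s = 1 - d + of_nat n \<Longrightarrow> s \<in> right_side \<gamma>"
    and "\<And>s x n m. is_pole F s \<Longrightarrow> x \<in> {a, b, c, f} \<Longrightarrow>
           s = - x - of_nat n + 2 * of_real pi * \<i> * of_int m / of_real \<omega> \<Longrightarrow> s \<in> left_side \<gamma>"
  shows "imag_contour_integrable F \<gamma> \<and>
         1 / (2 * of_real pi * \<i>) * imag_contour_integral \<gamma> F =
         - (1 / sin (of_real pi * d)
          * (qpochs_inf q [q, q powr d, q powr (1-d), q powr (1+b+c-d), q powr (1+a+c-d),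
                           q powr (1+a+b-d), q powr (e+f)]
           / qpochs_inf q [q powr a, q powr b, q powr c, q powr f,
                           q powr (1+a-d), q powr (1+b-d), q powr (1+c-d)])
          * phi32 q (q powr a) (q powr b) (q powr e)
                    (q powr (e+f)) (q powr (1+a+b-d)) (q powr (1+f-d)))"
proof -
  interpret I: barnes_integrand \<omega> q a b c d e f
    by unfold_locales (use assms(1-3,5-7) in auto)
  obtain T \<sigma> \<tau> where T: "\<And>t. t \<ge> T \<Longrightarrow> \<gamma> t = Complex \<sigma> t \<and> \<gamma> (- t) = Complex \<tau> (- t)"
    and inj: "inj \<gamma>" and pw: "\<gamma> piecewise_C1_differentiable_on UNIV"
    using \<open>imag_contour \<gamma>\<close> unfolding imag_contour_def by blast
  have FF: "I.F = F" unfolding I.F_def F ..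
  interpret C: barnes_contour \<omega> q a b c d e f \<gamma> "max T 1" \<sigma> \<tau>
  proof
    show "inj \<gamma>" "\<gamma> piecewise_C1_differentiable_on UNIV" "0 < max T 1" by (rule inj, rule pw, simp)
    show "\<gamma> t = Complex \<sigma> t" "\<gamma> (- t) = Complex \<tau> (- t)" if "max T 1 \<le> t" for t
      using T[of t] that by auto
  next
    fix s n assume "is_pole I.F s" "s = of_nat n \<or> s = 1 - d + of_nat n"
    then show "s \<in> right_side \<gamma>" unfolding FF by (rule assms(10))
  next
    fix s x n m assume "is_pole I.F s" "x \<in> {a, b, c, f}"
      "s = - x - of_nat n + 2 * of_real pi * \<i> * of_int m / of_real \<omega>"
    then show "s \<in> left_side \<gamma>" unfolding FF by (rule assms(11))
  qed
  have r: "q powr (1 + t - d) = q powr t * q / q powr d" for t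
    by (simp add: powr_add powr_diff mult.commute)
  have r2: "q powr (1 + s + t - d) = q powr s * q powr t * q / q powr d" for s t
    using r[of "s + t"] by (simp add: powr_add add.assoc)
  have r0: "q powr (1 - d) = q / q powr d"
    by (simp add: powr_diff)
  have int: "((\<lambda>t. F (\<gamma> t) * vector_derivative \<gamma> (at t)) has_integral
     - (2 * pi * \<i>) * (I.B.jackson (\<lambda>x. x * I.B.profile x) / sin (of_real pi * d))) UNIV"
    using C.contour_evaluation unfolding FF .
  then have "imag_contour_integrable F \<gamma>"
    unfolding imag_contour_integrable_def by (rule has_integral_integrable)
  moreover have "1 / (2 * of_real pi * \<i>) * imag_contour_integral \<gamma> F
      = - (I.B.jackson (\<lambda>x. x * I.B.profile x) / sin (of_real pi * d))"
    unfolding imag_contour_integral_def integral_unique[OF int] by simp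
  moreover have "I.B.jackson (\<lambda>x. x * I.B.profile x) =
     qpochs_inf q [q, q powr d, q powr (1-d), q powr (1+b+c-d), q powr (1+a+c-d),
                           q powr (1+a+b-d), q powr (e+f)]
           / qpochs_inf q [q powr a, q powr b, q powr c, q powr f,
                           q powr (1+a-d), q powr (1+b-d), q powr (1+c-d)]
          * phi32 q (q powr a) (q powr b) (q powr e)
                    (q powr (e+f)) (q powr (1+a+b-d)) (q powr (1+f-d))"
    unfolding I.B.jackson_evaluation I.B.kernel_value_def r r2 r0 powr_add[of q e f]
    by (simp add: qpochs_inf_def mult_ac)
  ultimately show ?thesis by simp
qed

end
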